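(* Let $(M,F)$ be a forward complete (connected, finite-dimensional) Finsler manifold, and suppose that $\varphi:M\to M$ is a proper homothety of $(M,F)$. Then $\varphi$ has a unique fixed point $p\in M$, and $(M,F)$ is isometric to the tangent Minkowski vector space at $p$, i.e., to the vector space $T_pM$ equipped with the Minkowski norm $F\upharpoonright T_pM$.
   Context: Manifolds are finite-dimensional, connected, smooth, Hausdorff and have a countable basis of open sets. For a manifold $M$, $\tau:TM\to M$ is the tangent bundle, $\overset{\circ}{T}M$ is $TM$ with the zero vectors removed, and $\varphi_*:TM\to TM$ denotes the tangent map of a smooth map $\varphi:M\to M$ (similarly for maps between different manifolds). For a vector field $X$ on $M$, $X^{\mathsf v}$ is its vertical lift to $TM$, given by $X^{\mathsf v}(v)=\frac{d}{dt}\big|_{t=0}(v+tX(\tau(v)))$. Finsler manifold: a continuous function $F:TM\to[0,\infty[$ is a Finsler function over $M$ if it is smooth on $\overset{\circ}{T}M$, satisfies $F(\lambda v)=\lambda F(v)$ for all $\lambda\in[0,\infty[$ and $v\in TM$, and its metric tensor $g$, determined at each $u\in\overset{\circ}{T}M$ by $g_u(X(\tau(u)),Y(\tau(u))):=\frac12\big(X^{\mathsf v}Y^{\mathsf v}F^2\big)(u)$ for vector fields $X,Y$ on $M$, is nondegenerate on $T_{\tau(u)}M$ for every $u\in\overset{\circ}{T}M$. (Such a $g$ is then automatically symmetric and positive definite.) $F$ is not assumed to be reversible. A Finsler manifold $(M,F)$ is a manifold equipped with a Finsler function. Quasi-distance and completeness: the length of a piecewise smooth curve $\gamma:[\alpha,\beta]\to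 M$ is $L(\gamma):=\int_\alpha^\beta F\circ\dot\gamma$, and $\varrho_F(p,q)$ is the infimum of $L(\gamma)$ over all piecewise smooth curves $\gamma$ from $p$ to $q$. A sequence $(p_n)_{n\in\mathbb N}$ in $M$ is a forward Cauchy sequence if for every $\varepsilon>0$ there is $N\in\mathbb N$ such that $\varrho_F(p_m,p_n)<\varepsilon$ whenever $N\le m\le n$. $(M,F)$ is forward complete if every forward Cauchy sequence converges (in the manifold topology, which is generated by the forward balls $\{q\mid\varrho_F(a,q)<r\}$ and also by the backward balls $\{q\mid\varrho_F(q,a)<r\}$). Homotheties: a diffeomorphism $\varphi$ of $M$ is a homothety of $(M,F)$ if there is a real number $\lambda>0$ with $F\circ\varphi_*=\lambda F$; it is an isometry of $(M,F)$ if $\lambda=1$. A homothety is proper if it is not an isometry. Isometric: Finsler manifolds $(M_1,F_1)$ and $(M_2,F_2)$ are isometric if there is a diffeomorphism $\psi:M_1\to M_2$ with $F_2\circ\psi_*=F_1$. The Minkowski vector space $(T_pM,F\upharpoonright T_pM)$ is regarded as a Finsler manifold whose underlying manifold is the vector space $T_pM$ and whose Finsler function assigns to the tangent vector $w_v\in T_v(T_pM)$ corresponding to $w\in T_pM$ under the canonical identification $T_v(T_pM)\cong T_pM$ the value $F(w)$, for all $v,w\in T_pM$. *)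

theory Defs
  imports "HOL-Analysis.Analysis"
begin

section \<open>Smooth maps between open subsets of Euclidean spaces\<close>

text \<open>The two definitions below are meant for open sets \<open>S\<close>.
  Quantifying over all directions \<open>v\<close> expresses that all partial derivatives
  (in any linear coordinates) are again of class \<open>C\<^sup>k\<close>.\<close>

primrec Ck_on :: "nat \<Rightarrow> ('a::euclidean_space) set \<Rightarrow> ('a \<Rightarrow> 'b::euclidean_space) \<Rightarrow> bool" where
  "Ck_on 0 S f \<longleftrightarrow> continuous_on S f"
| "Ck_on (Suc k) S f \<longleftrightarrow>
     (\<forall>x\<in>S. f differentiable (at x)) \<and>
     (\<forall>v. Ck_on k S (\<lambda>x. frechet_derivative f (at x) v))"

definition smooth_on :: "('a::euclidean_space) set \<Rightarrow> ('a \<Rightarrow> 'b::euclidean_space) \<Rightarrow> bool" where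
  "smooth_on S f \<longleftrightarrow> (\<forall>k. Ck_on k S f)"


section \<open>Smooth manifolds\<close>

text \<open>The underlying set of a manifold is the universe of a topological type \<open>'m\<close>, and its
  smooth structure is given by an atlas (maximal or not) of charts with values in a Euclidean
  space \<open>'e\<close>, so that the dimension is \<open>DIM('e)\<close>. A chart is a pair consisting of its domain and
  its coordinate map; the values of the coordinate map outside the domain are irrelevant.\<close>

type_synonym ('m, 'e) chart = "'m set \<times> ('m \<Rightarrow> 'e)"

definition chart_inv :: "('m, 'e) chart \<Rightarrow> 'e \<Rightarrow> 'm" where
  "chart_inv c = inv_into (fst c) (snd c)"

definition is_chart :: "('m::topological_space, 'e::euclidean_space) chart \<Rightarrow> bool" where
  "is_chart c \<longleftrightarrow> open (fst c) \<and> open (snd c ` fst c) \<and>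
     homeomorphism (fst c) (snd c ` fst c) (snd c) (chart_inv c)"

definition smooth_atlas :: "('m::topological_space, 'e::euclidean_space) chart set \<Rightarrow> bool" where
  "smooth_atlas A \<longleftrightarrow>
     (\<forall>c\<in>A. is_chart c) \<and> (\<Union>c\<in>A. fst c) = UNIV \<and>
     (\<forall>c\<in>A. \<forall>d\<in>A. smooth_on (snd c ` (fst c \<inter> fst d)) (snd d \<circ> chart_inv c))"

definition smooth_manifold ::
  "('m::{t2_space,second_countable_topology}, 'e::euclidean_space) chart set \<Rightarrow> bool" where
  "smooth_manifold A \<longleftrightarrow> smooth_atlas A \<and> connected (UNIV :: 'm set)"

definition smooth_map_on ::
  "('m::topological_space, 'e::euclidean_space) chart set \<Rightarrow>
   ('n::topological_space, 'f::euclidean_space) chart set \<Rightarrow> 'm set \<Rightarrow> ('m \<Rightarrow> 'n) \<Rightarrow> bool" where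
  "smooth_map_on A B S f \<longleftrightarrow> continuous_on S f \<and>
     (\<forall>c\<in>A. \<forall>d\<in>B. smooth_on (snd c ` (S \<inter> fst c \<inter> f -` fst d)) (snd d \<circ> f \<circ> chart_inv c))"

definition diffeomorphism ::
  "('m::topological_space, 'e::euclidean_space) chart set \<Rightarrow>
   ('n::topological_space, 'f::euclidean_space) chart set \<Rightarrow> ('m \<Rightarrow> 'n) \<Rightarrow> bool" where
  "diffeomorphism A B f \<longleftrightarrow>
     bij f \<and> smooth_map_on A B UNIV f \<and> smooth_map_on B A UNIV (inv f)"

text \<open>The smooth structure of a finite-dimensional vector space.\<close>

definition vector_space_atlas :: "('e::euclidean_space, 'e) chart set" where
  "vector_space_atlas = {(UNIV, id)}"


section \<open>Tangent vectors\<close>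

text \<open>For each point \<open>p\<close> a chart \<open>chart_at A p\<close> around \<open>p\<close> is selected, and a tangent vector at
  \<open>p\<close> is represented by its coordinate vector with respect to this chart. Thus the vector space
  of tangent vectors at any point is a copy of \<open>'e\<close>, the tangent bundle is the type \<open>'m \<times> 'e\<close>
  with projection \<open>fst\<close>, and its zero vectors are the pairs \<open>(p, 0)\<close>. Since the selected chart
  may jump from point to point, the topology and smooth structure of the tangent bundle are
  \<^emph>\<open>not\<close> those of the product; they are given by the charts of the base manifold, see
  \<open>continuous_on_TM\<close> and \<open>smooth_on_slit_TM\<close>.\<close>

type_synonym ('m, 'e) tangent_bundle = "'m \<times> 'e"

definition chart_at :: "('m, 'e) chart set \<Rightarrow> 'm \<Rightarrow> ('m, 'e) chart" where
  "chart_at A p = (SOME c. c \<in> A \<and> p \<in> fst c)"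

definition tangent_map ::
  "('m, 'e::euclidean_space) chart set \<Rightarrow> ('n, 'f::euclidean_space) chart set \<Rightarrow>
   ('m \<Rightarrow> 'n) \<Rightarrow> ('m, 'e) tangent_bundle \<Rightarrow> ('n, 'f) tangent_bundle" where
  "tangent_map A B f u =
     (let p = fst u; c = chart_at A p; d = chart_at B (f p)
      in (f p, frechet_derivative (snd d \<circ> f \<circ> chart_inv c) (at (snd c p)) (snd u)))"

definition velocity ::
  "('m, 'e::euclidean_space) chart set \<Rightarrow> (real \<Rightarrow> 'm) \<Rightarrow> real \<Rightarrow> ('m, 'e) tangent_bundle" where
  "velocity A \<gamma> t = (\<gamma> t, vector_derivative (snd (chart_at A (\<gamma> t)) \<circ> \<gamma>) (at t))"

text \<open>A chart \<open>c\<close> with domain \<open>U\<close> and image \<open>V\<close> induces a chart of the tangent bundle, whose inverse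
  \<open>V \<times> 'e \<rightarrow> \<tau>\<^sup>-\<^sup>1(U)\<close> is the tangent map of the inverse of \<open>c\<close>. Continuity and smoothness
  of functions on the tangent bundle are tested in these induced charts.\<close>

definition continuous_on_TM ::
  "('m, 'e::euclidean_space) chart set \<Rightarrow> (('m, 'e) tangent_bundle \<Rightarrow> real) \<Rightarrow> bool" where
  "continuous_on_TM A h \<longleftrightarrow>
     (\<forall>c\<in>A. continuous_on ((snd c ` fst c) \<times> UNIV)
               (h \<circ> tangent_map vector_space_atlas A (chart_inv c)))"

definition smooth_on_slit_TM ::
  "('m, 'e::euclidean_space) chart set \<Rightarrow> (('m, 'e) tangent_bundle \<Rightarrow> real) \<Rightarrow> bool" where
  "smooth_on_slit_TM A h \<longleftrightarrow>
     (\<forall>c\<in>A. smooth_on ((snd c ` fst c) \<times> (UNIV - {0}))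
               (h \<circ> tangent_map vector_space_atlas A (chart_inv c)))"


section \<open>Finsler manifolds\<close>

text \<open>The action on functions of the vertical lift of a vector field with principal part \<open>X\<close>.\<close>

definition vertical_lift ::
  "('m \<Rightarrow> 'e::real_normed_vector) \<Rightarrow> (('m, 'e) tangent_bundle \<Rightarrow> real) \<Rightarrow>
   ('m, 'e) tangent_bundle \<Rightarrow> real" where
  "vertical_lift X h u = deriv (\<lambda>t. h (fst u, snd u + t *\<^sub>R X (fst u))) 0"

text \<open>In \<open>X\<^sup>v Y\<^sup>v F\<^sup>2\<close> only the values of \<open>X\<close> and \<open>Y\<close> at the base point matter (see
  \<open>metric_tensor_vector_fields\<close>), so that they may be replaced by constant principal parts.\<close>

definition metric_tensor ::
  "(('m, 'e::real_normed_vector) tangent_bundle \<Rightarrow> real) \<Rightarrow> ('m, 'e) tangent_bundle \<Rightarrow>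
   'e \<Rightarrow> 'e \<Rightarrow> real" where
  "metric_tensor F u x y =
     1/2 * vertical_lift (\<lambda>_. x) (vertical_lift (\<lambda>_. y) (\<lambda>w. (F w)\<^sup>2)) u"

lemma metric_tensor_vector_fields:
  "metric_tensor F u (X (fst u)) (Y (fst u)) =
     1/2 * vertical_lift X (vertical_lift Y (\<lambda>w. (F w)\<^sup>2)) u"
  by (simp add: metric_tensor_def vertical_lift_def)

definition finsler_function ::
  "('m, 'e::euclidean_space) chart set \<Rightarrow> (('m, 'e) tangent_bundle \<Rightarrow> real) \<Rightarrow> bool" where
  "finsler_function A F \<longleftrightarrow>
     (\<forall>u. 0 \<le> F u) \<and>
     continuous_on_TM A F \<and>
     smooth_on_slit_TM A F \<and>
     (\<forall>p v. \<forall>l\<ge>0. F (p, l *\<^sub>R v) = l * F (p, v)) \<and>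
     (\<forall>p v. v \<noteq> 0 \<longrightarrow> (\<forall>x. (\<forall>y. metric_tensor F (p, v) x y = 0) \<longrightarrow> x = 0))"

definition finsler_manifold ::
  "('m::{t2_space,second_countable_topology}, 'e::euclidean_space) chart set \<Rightarrow>
   (('m, 'e) tangent_bundle \<Rightarrow> real) \<Rightarrow> bool" where
  "finsler_manifold A F \<longleftrightarrow> smooth_manifold A \<and> finsler_function A F"

text \<open>A curve is smooth on a compact interval if it extends to a smooth curve on an open
  interval around it.\<close>

definition smooth_curve ::
  "('m::topological_space, 'e::euclidean_space) chart set \<Rightarrow> real \<Rightarrow> real \<Rightarrow> (real \<Rightarrow> 'm) \<Rightarrow> bool" where
  "smooth_curve A a b \<gamma> \<longleftrightarrow>
     (\<exists>e>0. \<exists>\<eta>. smooth_map_on vector_space_atlas A {a - e<..<b + e} \<eta> \<and> (\<forall>t\<in>{a..b}. \<gamma> t = \<eta> t))"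

definition piecewise_smooth_curve ::
  "('m::topological_space, 'e::euclidean_space) chart set \<Rightarrow> real \<Rightarrow> real \<Rightarrow> (real \<Rightarrow> 'm) \<Rightarrow> bool" where
  "piecewise_smooth_curve A a b \<gamma> \<longleftrightarrow> a < b \<and>
     (\<exists>n. \<exists>t :: nat \<Rightarrow> real. t 0 = a \<and> t n = b \<and>
        (\<forall>i<n. t i < t (Suc i) \<and> smooth_curve A (t i) (t (Suc i)) \<gamma>))"

text \<open>The velocity is unspecified at the finitely many break points and at the end points of a
  piecewise smooth curve; this does not affect the integral.\<close>

definition curve_length ::
  "('m, 'e::euclidean_space) chart set \<Rightarrow> (('m, 'e) tangent_bundle \<Rightarrow> real) \<Rightarrow>
   real \<Rightarrow> real \<Rightarrow> (real \<Rightarrow> 'm) \<Rightarrow> real" where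
  "curve_length A F a b \<gamma> = integral {a..b} (F \<circ> velocity A \<gamma>)"

definition quasi_distance ::
  "('m::topological_space, 'e::euclidean_space) chart set \<Rightarrow> (('m, 'e) tangent_bundle \<Rightarrow> real) \<Rightarrow>
   'm \<Rightarrow> 'm \<Rightarrow> real" where
  "quasi_distance A F p q =
     Inf {curve_length A F a b \<gamma> | a b \<gamma>. piecewise_smooth_curve A a b \<gamma> \<and> \<gamma> a = p \<and> \<gamma> b = q}"

definition forward_Cauchy ::
  "('m::topological_space, 'e::euclidean_space) chart set \<Rightarrow> (('m, 'e) tangent_bundle \<Rightarrow> real) \<Rightarrow>
   (nat \<Rightarrow> 'm) \<Rightarrow> bool" where
  "forward_Cauchy A F s \<longleftrightarrow>
     (\<forall>e>0. \<exists>N. \<forall>m n. N \<le> m \<and> m \<le> n \<longrightarrow> quasi_distance A F (s m) (s n) < e)"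

definition forward_complete ::
  "('m::topological_space, 'e::euclidean_space) chart set \<Rightarrow> (('m, 'e) tangent_bundle \<Rightarrow> real) \<Rightarrow>
   bool" where
  "forward_complete A F \<longleftrightarrow> (\<forall>s. forward_Cauchy A F s \<longrightarrow> (\<exists>l. s \<longlonglongrightarrow> l))"


section \<open>Homotheties and isometries\<close>

definition homothety ::
  "('m::topological_space, 'e::euclidean_space) chart set \<Rightarrow> (('m, 'e) tangent_bundle \<Rightarrow> real) \<Rightarrow>
   ('m \<Rightarrow> 'm) \<Rightarrow> bool" where
  "homothety A F \<phi> \<longleftrightarrow> diffeomorphism A A \<phi> \<and>
     (\<exists>l>0. F \<circ> tangent_map A A \<phi> = (\<lambda>u. l * F u))"

definition isometry_between ::
  "('m::topological_space, 'e::euclidean_space) chart set \<Rightarrow> (('m, 'e) tangent_bundle \<Rightarrow> real) \<Rightarrow>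
   ('n::topological_space, 'f::euclidean_space) chart set \<Rightarrow> (('n, 'f) tangent_bundle \<Rightarrow> real) \<Rightarrow>
   ('m \<Rightarrow> 'n) \<Rightarrow> bool" where
  "isometry_between A F B G \<psi> \<longleftrightarrow> diffeomorphism A B \<psi> \<and> G \<circ> tangent_map A B \<psi> = F"

definition proper_homothety ::
  "('m::topological_space, 'e::euclidean_space) chart set \<Rightarrow> (('m, 'e) tangent_bundle \<Rightarrow> real) \<Rightarrow>
   ('m \<Rightarrow> 'm) \<Rightarrow> bool" where
  "proper_homothety A F \<phi> \<longleftrightarrow> homothety A F \<phi> \<and> \<not> isometry_between A F A F \<phi>"

definition isometric ::
  "('m::topological_space, 'e::euclidean_space) chart set \<Rightarrow> (('m, 'e) tangent_bundle \<Rightarrow> real) \<Rightarrow>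
   ('n::topological_space, 'f::euclidean_space) chart set \<Rightarrow> (('n, 'f) tangent_bundle \<Rightarrow> real) \<Rightarrow>
   bool" where
  "isometric A F B G \<longleftrightarrow> (\<exists>\<psi>. isometry_between A F B G \<psi>)"

text \<open>The Finsler function of the tangent Minkowski vector space at \<open>p\<close>, whose underlying manifold
  is the vector space \<open>'e\<close> of tangent vectors at \<open>p\<close>, with atlas \<^const>\<open>vector_space_atlas\<close>.
  By \<open>velocity_vector_space\<close>, the pair \<open>(v, w)\<close> is the tangent vector at \<open>v\<close> that corresponds
  to \<open>w\<close> under the canonical identification.\<close>

definition tangent_minkowski ::
  "(('m, 'e::euclidean_space) tangent_bundle \<Rightarrow> real) \<Rightarrow> 'm \<Rightarrow> ('e, 'e) tangent_bundle \<Rightarrow> real" where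
  "tangent_minkowski F p = (\<lambda>(v, w). F (p, w))"

lemma chart_at_vector_space [simp]: "chart_at vector_space_atlas v = (UNIV, id)"
  unfolding chart_at_def vector_space_atlas_def by (rule some_equality) auto

lemma velocity_vector_space:
  "velocity vector_space_atlas (\<lambda>t. v + t *\<^sub>R w) 0 = (v, w)"
proof -
  have "((\<lambda>t. v + t *\<^sub>R w) has_vector_derivative w) (at 0)"
    by (auto intro!: derivative_eq_intros simp: has_vector_derivative_def)
  then show ?thesis
    by (simp add: velocity_def vector_derivative_at)
qed

end

theory Submission
  imports Defs
begin

text \<open>Passing to the inverse if necessary, let \<open>F \<circ> \<phi>\<^sub>* = \<kappa> F\<close> with \<open>\<kappa> < 1\<close>. A curve from \<open>q\<close> to \<open>\<phi> q\<close>
  and its images under the iterates of \<open>\<phi>\<close> have summable lengths, so every orbit converges to a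
  fixed point. Fixed points are attracting, so their basins are open and partition the connected
  manifold; hence there is only one fixed point \<open>p\<close>, and all orbits converge to it.

  The derivative \<open>L\<close> of \<open>\<phi>\<close> at \<open>p\<close> scales the Minkowski norm at \<open>p\<close> by \<open>\<kappa>\<close>, so \<open>\<parallel>L\<^sup>n\<parallel>\<close> and
  \<open>\<parallel>L\<^sup>-\<^sup>n\<parallel>\<close> are bounded by constant multiples of \<open>\<kappa>\<^sup>n\<close> and \<open>\<kappa>\<^sup>-\<^sup>n\<close>. There are thus no
  resonances, and in a chart centred at \<open>p\<close> the maps \<open>L\<^sup>-\<^sup>n \<circ> \<phi>\<^sup>n\<close> converge, together with all their
  derivatives, to a smooth map \<open>\<psi>\<close> with \<open>\<psi> \<circ> \<phi> = L \<circ> \<psi>\<close> and derivative the identity at \<open>p\<close> (Koenigs'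
  linearization). This relation extends \<open>\<psi>\<close> to a diffeomorphism from \<open>M\<close> onto the tangent space.
  It is an isometry: since \<open>F = \<kappa>\<^sup>-\<^sup>n F \<circ> (\<phi>\<^sup>n)\<^sub>*\<close> and \<open>\<phi>\<^sup>n q \<rightarrow> p\<close>, the limit of the right hand side is
  the Minkowski norm at \<open>p\<close> applied to \<open>\<psi>\<^sub>*\<close>.\<close>

section \<open>Differential calculus on open sets\<close>

text \<open>The obstacle is regularity. Contraction bounds the iterates themselves, but the limit
  map must be smooth. So all derivatives of the iterates are bounded by multiples of
  \<open>\<mu> ^ n\<close> on one neighbourhood \<open>U\<close> that does not shrink with the
  order. The remainder of \<open>f\<close> at its fixed point is quadratic and contributes
  \<mu>^(2n), against \<kappa>^(-n) from the inverse of the linear part. This is summable as soon as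
  \<mu>^2 < \<kappa>, and \<kappa> < 1 leaves room for such a \<mu> above \<kappa>. The linear part
  scales the Minkowski norm and not the Euclidean one, and the triangle inequality of the Minkowski
  norm is not established. Hence contraction is measured in a norm \<open>N\<close> built from the
  linear part. Forward completeness serves to give every orbit a limit; that a fixed point attracts
  its neighbours is read off from the contraction in a chart. In the isometry argument the rescaled
  vectors \<open>(1 / \<kappa>) ^ n *\<^sub>R D(f^n) v\<close> need not converge, because the
  rescaled linear part may rotate. Continuity, homogeneity and a convergent subsequence replace the
  missing limit.\<close>

lemma frechet_derivative_cong_open:
  assumes "open S" "x \<in> S" "\<And>y. y \<in> S \<Longrightarrow> f y = g y"
  shows "frechet_derivative f (at x) = frechet_derivative g (at x)"
proof -
  have "(f has_derivative D) (at x) \<longleftrightarrow> (g has_derivative D) (at x)" for D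
    using assms has_derivative_transform_within_open[of f D x UNIV S g]
      has_derivative_transform_within_open[of g D x UNIV S f] by auto
  then show ?thesis by (simp add: frechet_derivative_def)
qed

lemma frechet_derivative_eq:
  "(f has_derivative D) (at x) \<Longrightarrow> frechet_derivative f (at x) = D"
  by (metis frechet_derivative_at)

lemma differentiable_frechet:
  "f differentiable (at x) \<Longrightarrow> (f has_derivative frechet_derivative f (at x)) (at x)"
  by (simp add: frechet_derivative_works)

lemma linear_euclidean_sum:
  fixes D :: "'a::euclidean_space \<Rightarrow> 'b::real_vector"
  assumes "linear D"
  shows "D v = (\<Sum>b\<in>Basis. (v \<bullet> b) *\<^sub>R D b)"
  using arg_cong[OF euclidean_representation[of v, symmetric], of D] assms
  by (simp add: linear_sum linear_scale)

lemma linear_funpow: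
  fixes T :: "'a::real_vector \<Rightarrow> 'a"
  assumes "linear T"
  shows "linear (T ^^ n)"
proof (induction n)
  case (Suc n)
  then show ?case unfolding funpow.simps using assms by (rule linear_compose)
qed (simp add: linear_iff)

lemma funpow_left_inverse:
  fixes S T :: "'a \<Rightarrow> 'a"
  assumes "\<And>v. S (T v) = v"
  shows "(S ^^ n) ((T ^^ n) v) = v"
proof (induction n arbitrary: v)
  case (Suc n)
  then show ?case using assms by (metis comp_apply funpow.simps(2) funpow_Suc_right)
qed simp

text \<open>\<open>Ck_on\<close> and \<open>geom_bounded\<close> speak of derivatives in fixed
  directions, while the chain rule produces directions that vary with the point. This expansion
  mediates between the two.\<close>

lemma frechet_derivative_sum_Basis:
  fixes f :: "'a::euclidean_space \<Rightarrow> 'b::real_normed_vector"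
  assumes "f differentiable (at x)"
  shows "frechet_derivative f (at x) v = (\<Sum>b\<in>Basis. (v \<bullet> b) *\<^sub>R frechet_derivative f (at x) b)"
  using linear_euclidean_sum linear_frechet_derivative[OF assms] .

section \<open>Functions of class C^k\<close>

lemma Ck_on_cong:
  assumes "open S" "\<And>x. x \<in> S \<Longrightarrow> f x = g x"
  shows "Ck_on k S f \<longleftrightarrow> Ck_on k S g"
  using assms(2)
proof (induction k arbitrary: f g)
  case 0
  then show ?case by (simp cong: continuous_on_cong)
next
  case (Suc k)
  have fd: "frechet_derivative f (at x) = frechet_derivative g (at x)" if "x \<in> S" for x
    using frechet_derivative_cong_open[OF assms(1) that] Suc.prems by blast
  have "f differentiable (at x) \<longleftrightarrow> g differentiable (at x)" if "x \<in> S" for x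
    unfolding differentiable_def
    using assms(1) that Suc.prems has_derivative_transform_within_open[of f _ x UNIV S g]
      has_derivative_transform_within_open[of g _ x UNIV S f] by fastforce
  then show ?case
    using Suc.IH[of "\<lambda>x. frechet_derivative f (at x) v" "\<lambda>x. frechet_derivative g (at x) v" for v] fd
    by simp
qed

lemma Ck_on_subset: "Ck_on k S f \<Longrightarrow> T \<subseteq> S \<Longrightarrow> Ck_on k T f"
  by (induction k arbitrary: f) (auto intro: continuous_on_subset)

lemma Ck_on_imp_continuous_on: "Ck_on k S f \<Longrightarrow> continuous_on S f"
  by (cases k) (auto intro!: continuous_at_imp_continuous_on differentiable_imp_continuous_within)

lemma Ck_on_SucI:
  assumes "open S" "\<And>x. x \<in> S \<Longrightarrow> (f has_derivative f' x) (at x)"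
    "\<And>v. Ck_on k S (\<lambda>x. f' x v)"
  shows "Ck_on (Suc k) S f"
proof -
  have "Ck_on k S (\<lambda>x. frechet_derivative f (at x) v)" for v
    using assms(3)[of v] Ck_on_cong[OF assms(1), of "\<lambda>x. frechet_derivative f (at x) v" "\<lambda>x. f' x v"]
      frechet_derivative_eq[OF assms(2)] by auto
  then show ?thesis using assms(2) by (auto simp: differentiable_def)
qed

lemma Ck_on_Suc_lower: "Ck_on (Suc k) S f \<Longrightarrow> Ck_on k S f"
proof (induction k arbitrary: f)
  case 0
  then show ?case using Ck_on_imp_continuous_on[OF 0] by simp
next
  case (Suc k)
  then show ?case by simp
qed

lemma Ck_on_has_derivative:
  "Ck_on (Suc k) S f \<Longrightarrow> x \<in> S \<Longrightarrow> (f has_derivative frechet_derivative f (at x)) (at x)"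
  by (simp add: frechet_derivative_works)

lemma Ck_on_const: "Ck_on k S (\<lambda>x. c)"
  by (induction k arbitrary: c) (auto intro: continuous_on_const)

lemma Ck_on_linear:
  assumes "open S" "bounded_linear T"
  shows "Ck_on k S T"
proof (cases k)
  case 0
  then show ?thesis using assms(2) linear_continuous_on by auto
next
  case (Suc j)
  show ?thesis unfolding Suc
    by (rule Ck_on_SucI[where f' = "\<lambda>x. T"])
      (use assms in \<open>auto intro: bounded_linear_imp_has_derivative Ck_on_const\<close>)
qed

lemma Ck_on_add:
  assumes "open S" "Ck_on k S f" "Ck_on k S g"
  shows "Ck_on k S (\<lambda>x. f x + g x)"
  using assms(2,3)
proof (induction k arbitrary: f g)
  case 0
  then show ?case by (auto intro: continuous_on_add)
next
  case (Suc k)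
  show ?case
  proof (rule Ck_on_SucI[OF assms(1)])
    show "((\<lambda>x. f x + g x) has_derivative
        (\<lambda>v. frechet_derivative f (at x) v + frechet_derivative g (at x) v)) (at x)" if "x \<in> S" for x
      using that Suc.prems by (intro has_derivative_add Ck_on_has_derivative)
  qed (use Suc in auto)
qed

lemma Ck_on_bounded_linear:
  assumes "open S" "bounded_linear T" "Ck_on k S f"
  shows "Ck_on k S (\<lambda>x. T (f x))"
  using assms(3)
proof (induction k arbitrary: f)
  case 0
  then show ?case using assms(2) by (auto intro: bounded_linear.continuous_on)
next
  case (Suc k)
  show ?case
  proof (rule Ck_on_SucI[OF assms(1)])
    show "((\<lambda>x. T (f x)) has_derivative (\<lambda>v. T (frechet_derivative f (at x) v))) (at x)"
      if "x \<in> S" for x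
      using that Suc.prems by (intro bounded_linear.has_derivative[OF assms(2)] Ck_on_has_derivative)
  qed (use Suc in auto)
qed

lemma Ck_on_scaleR:
  fixes a :: "'a::euclidean_space \<Rightarrow> real"
  assumes "open S" "Ck_on k S a" "Ck_on k S f"
  shows "Ck_on k S (\<lambda>x. a x *\<^sub>R f x)"
  using assms(2,3)
proof (induction k arbitrary: a f)
  case 0
  then show ?case by (auto intro: continuous_on_scaleR)
next
  case (Suc k)
  show ?case
  proof (rule Ck_on_SucI[OF assms(1)])
    show "((\<lambda>x. a x *\<^sub>R f x) has_derivative
        (\<lambda>v. a x *\<^sub>R frechet_derivative f (at x) v + frechet_derivative a (at x) v *\<^sub>R f x)) (at x)"
      if "x \<in> S" for x
      using that Suc.prems by (intro has_derivative_scaleR Ck_on_has_derivative)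
  next
    fix v
    show "Ck_on k S (\<lambda>x. a x *\<^sub>R frechet_derivative f (at x) v + frechet_derivative a (at x) v *\<^sub>R f x)"
      using Suc.prems Ck_on_Suc_lower[OF Suc.prems(1)] Ck_on_Suc_lower[OF Suc.prems(2)]
      by (intro Ck_on_add[OF assms(1)] Suc.IH) auto
  qed
qed

lemma Ck_on_sum:
  assumes "open S" "\<And>i. i \<in> I \<Longrightarrow> Ck_on k S (f i)"
  shows "Ck_on k S (\<lambda>x. \<Sum>i\<in>I. f i x)"
  using assms(2)
  by (induction I rule: infinite_finite_induct) (auto intro: Ck_on_const Ck_on_add[OF assms(1)])

text \<open>The chain rule expanded over \<open>Basis\<close> is a sum of products of derivatives of
  \<open>f\<close> with compositions of derivatives of \<open>g\<close> with \<open>f\<close>. The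
  induction hypothesis applies to the latter, which is why \<open>g\<close> is arbitrary in the
  induction.\<close>

lemma Ck_on_compose:
  assumes "open S" "open T" "Ck_on k T g" "Ck_on k S f" "f ` S \<subseteq> T"
  shows "Ck_on k S (g \<circ> f)"
  using assms(3,4)
proof (induction k arbitrary: g)
  case 0
  then show ?case
    using assms(5) by (auto simp del: comp_apply intro!: continuous_on_compose intro: continuous_on_subset)
next
  case (Suc k)
  let ?D = "\<lambda>x v. \<Sum>b\<in>Basis. (frechet_derivative f (at x) v \<bullet> b) *\<^sub>R
      ((\<lambda>y. frechet_derivative g (at y) b) \<circ> f) x"
  show ?case
  proof (rule Ck_on_SucI[OF assms(1)])
    show "((g \<circ> f) has_derivative ?D x) (at x)" if "x \<in> S" for x
    proof -
      have "f x \<in> T" using that assms(5) by auto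
      with Suc.prems(1) have g: "g differentiable (at (f x))" by simp
      have "((g \<circ> f) has_derivative (\<lambda>v. frechet_derivative g (at (f x)) (frechet_derivative f (at x) v))) (at x)"
        using diff_chain_at[OF Ck_on_has_derivative[OF Suc.prems(2) that] differentiable_frechet[OF g]]
        by (simp add: o_def)
      moreover have "(\<lambda>v. frechet_derivative g (at (f x)) (frechet_derivative f (at x) v)) = ?D x"
        unfolding o_def by (rule ext) (rule frechet_derivative_sum_Basis[OF g])
      ultimately show ?thesis by simp
    qed
    show "Ck_on k S (\<lambda>x. ?D x v)" for v
      using Suc.prems
      by (intro Ck_on_sum[OF assms(1)] Ck_on_scaleR[OF assms(1)] Suc.IH Ck_on_Suc_lower[OF Suc.prems(2)]
          Ck_on_bounded_linear[OF assms(1), of "\<lambda>z. z \<bullet> b" for b] bounded_linear_inner_left) auto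
  qed
qed

lemma Ck_on_local:
  assumes "\<And>x. x \<in> S \<Longrightarrow> \<exists>T. open T \<and> x \<in> T \<and> Ck_on k T f"
  shows "Ck_on k S f"
  using assms
proof (induct k arbitrary: f)
  case 0
  show ?case
  proof -
    have "continuous (at x) f" if "x \<in> S" for x
    proof -
      from 0[OF that] obtain T where T: "open T" "x \<in> T" "Ck_on 0 T f" by blast
      then have "continuous_on T f" by simp
      with T show ?thesis using continuous_on_eq_continuous_at by blast
    qed
    then show ?thesis unfolding Ck_on.simps by (intro continuous_at_imp_continuous_on ballI)
  qed
next
  case (Suc k)
  have "f differentiable (at x)" if "x \<in> S" for x
  proof -
    from Suc.prems[OF that] obtain T where "x \<in> T" "Ck_on (Suc k) T f" by blast
    then show ?thesis by simp
  qed
  moreover have "Ck_on k S (\<lambda>x. frechet_derivative f (at x) v)" for v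
  proof (rule Suc.hyps)
    fix x assume "x \<in> S"
    from Suc.prems[OF this] obtain T where "open T" "x \<in> T" "Ck_on (Suc k) T f" by blast
    then show "\<exists>T. open T \<and> x \<in> T \<and> Ck_on k T (\<lambda>x. frechet_derivative f (at x) v)"
      by (intro exI[of _ T]) simp
  qed
  ultimately show ?case by simp
qed

section \<open>Smooth functions\<close>

lemma smooth_on_cong:
  "open S \<Longrightarrow> (\<And>x. x \<in> S \<Longrightarrow> f x = g x) \<Longrightarrow> smooth_on S f \<longleftrightarrow> smooth_on S g"
  unfolding smooth_on_def by (simp cong: Ck_on_cong)

lemma smooth_on_subset: "smooth_on S f \<Longrightarrow> T \<subseteq> S \<Longrightarrow> smooth_on T f"
  unfolding smooth_on_def by (auto intro: Ck_on_subset)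

lemma smooth_on_differentiable: "smooth_on S f \<Longrightarrow> x \<in> S \<Longrightarrow> f differentiable (at x)"
  unfolding smooth_on_def by (drule spec[of _ "Suc 0"]) simp

lemma smooth_on_has_derivative:
  "smooth_on S f \<Longrightarrow> x \<in> S \<Longrightarrow> (f has_derivative frechet_derivative f (at x)) (at x)"
  by (intro differentiable_frechet smooth_on_differentiable)

lemma smooth_on_frechet_derivative:
  "smooth_on S f \<Longrightarrow> smooth_on S (\<lambda>x. frechet_derivative f (at x) v)"
  unfolding smooth_on_def
proof
  fix k assume "\<forall>k. Ck_on k S f"
  then have "Ck_on (Suc k) S f" ..
  then show "Ck_on k S (\<lambda>x. frechet_derivative f (at x) v)" by simp
qed

lemma smooth_on_continuous_on: "smooth_on S f \<Longrightarrow> continuous_on S f"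
  unfolding smooth_on_def by (auto intro: Ck_on_imp_continuous_on)

lemma smooth_on_compose:
  "open S \<Longrightarrow> open T \<Longrightarrow> smooth_on T g \<Longrightarrow> smooth_on S f \<Longrightarrow> f ` S \<subseteq> T \<Longrightarrow> smooth_on S (g \<circ> f)"
  unfolding smooth_on_def by (simp add: Ck_on_compose)

lemma smooth_on_linear: "open S \<Longrightarrow> bounded_linear T \<Longrightarrow> smooth_on S T"
  unfolding smooth_on_def by (simp add: Ck_on_linear)

lemma smooth_on_const: "smooth_on S (\<lambda>x. c)"
  unfolding smooth_on_def by (simp add: Ck_on_const)

lemma smooth_on_add:
  "open S \<Longrightarrow> smooth_on S f \<Longrightarrow> smooth_on S g \<Longrightarrow> smooth_on S (\<lambda>x. f x + g x)"
  unfolding smooth_on_def by (simp add: Ck_on_add)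

lemma smooth_on_local:
  assumes "\<And>x. x \<in> S \<Longrightarrow> \<exists>T. open T \<and> x \<in> T \<and> smooth_on T f"
  shows "smooth_on S f"
  unfolding smooth_on_def
proof (intro allI Ck_on_local)
  fix k x assume "x \<in> S"
  from assms[OF this] show "\<exists>T. open T \<and> x \<in> T \<and> Ck_on k T f"
    unfolding smooth_on_def by blast
qed

section \<open>Sequences of functions with geometrically bounded derivatives\<close>

primrec geom_bounded ::
  "nat \<Rightarrow> real \<Rightarrow> ('a::euclidean_space) set \<Rightarrow> (nat \<Rightarrow> 'a \<Rightarrow> 'b::euclidean_space) \<Rightarrow> bool" where
  "geom_bounded 0 r U g \<longleftrightarrow> (\<exists>C. \<forall>n. \<forall>x\<in>U. norm (g n x) \<le> C * r ^ n)"
| "geom_bounded (Suc k) r U g \<longleftrightarrow> (\<exists>C. \<forall>n. \<forall>x\<in>U. norm (g n x) \<le> C * r ^ n) \<and>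
     (\<forall>n. \<forall>x\<in>U. g n differentiable (at x)) \<and>
     (\<forall>v. geom_bounded k r U (\<lambda>n x. frechet_derivative (g n) (at x) v))"

lemma geom_bounded_0I:
  "(\<And>n x. x \<in> U \<Longrightarrow> norm (g n x) \<le> C * r ^ n) \<Longrightarrow> geom_bounded 0 r U g"
  by auto

lemma geom_bounded_D0: "geom_bounded k r U g \<Longrightarrow> geom_bounded 0 r U g"
  by (cases k) auto

lemma geom_bounded_bound:
  assumes "geom_bounded k r U g" "0 \<le> r"
  shows "\<exists>C\<ge>0. \<forall>n. \<forall>x\<in>U. norm (g n x) \<le> C * r ^ n"
proof -
  from geom_bounded_D0[OF assms(1)]
  obtain C where "\<And>n x. x \<in> U \<Longrightarrow> norm (g n x) \<le> C * r ^ n"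
    by auto
  moreover have "C * r ^ n \<le> \<bar>C\<bar> * r ^ n" for n
    using assms(2) by (intro mult_right_mono) auto
  ultimately show ?thesis by (intro exI[of _ "\<bar>C\<bar>"]) (auto intro: order_trans)
qed

lemma geom_bounded_cong:
  assumes "open U" "\<And>n x. x \<in> U \<Longrightarrow> g n x = h n x"
  shows "geom_bounded k r U g \<longleftrightarrow> geom_bounded k r U h"
  using assms(2)
proof (induction k arbitrary: g h)
  case 0
  then show ?case by simp
next
  case (Suc k)
  have fd: "frechet_derivative (g n) (at x) = frechet_derivative (h n) (at x)" if "x \<in> U" for x n
    using frechet_derivative_cong_open[OF assms(1) that] Suc.prems by blast
  have "g n differentiable (at x) \<longleftrightarrow> h n differentiable (at x)" if "x \<in> U" for x n
    unfolding differentiable_def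
    using assms(1) that Suc.prems has_derivative_transform_within_open[of "g n" _ x UNIV U "h n"]
      has_derivative_transform_within_open[of "h n" _ x UNIV U "g n"] by fastforce
  then show ?case
    using Suc.IH[of "\<lambda>n x. frechet_derivative (g n) (at x) v"
        "\<lambda>n x. frechet_derivative (h n) (at x) v" for v] fd Suc.prems
    by simp
qed

lemma geom_bounded_SucI:
  assumes "open U" "geom_bounded 0 r U g"
    "\<And>n x. x \<in> U \<Longrightarrow> (g n has_derivative g' n x) (at x)"
    "\<And>v. geom_bounded k r U (\<lambda>n x. g' n x v)"
  shows "geom_bounded (Suc k) r U g"
proof -
  have "geom_bounded k r U (\<lambda>n x. frechet_derivative (g n) (at x) v)" for v
    using assms(4)[of v] geom_bounded_cong[OF assms(1),
        of "\<lambda>n x. frechet_derivative (g n) (at x) v" "\<lambda>n x. g' n x v"]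
      frechet_derivative_eq[OF assms(3)] by auto
  then show ?thesis using assms(2,3) by (auto simp: differentiable_def)
qed

lemma geom_bounded_has_derivative:
  "geom_bounded (Suc k) r U g \<Longrightarrow> x \<in> U \<Longrightarrow>
     (g n has_derivative frechet_derivative (g n) (at x)) (at x)"
  by (simp add: frechet_derivative_works)

lemma geom_bounded_frechet:
  "geom_bounded (Suc k) r U g \<Longrightarrow> geom_bounded k r U (\<lambda>n x. frechet_derivative (g n) (at x) v)"
  by simp

lemma geom_bounded_Suc_lower: "geom_bounded (Suc k) r U g \<Longrightarrow> geom_bounded k r U g"
  by (induction k arbitrary: g) auto

lemma geom_bounded_mono:
  assumes "0 \<le> r" "r \<le> s" "geom_bounded k r U g"
  shows "geom_bounded k s U g"
  using assms(3)
proof (induction k arbitrary: g)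
  case (0 g)
  from geom_bounded_bound[OF 0 assms(1)]
  obtain C where C: "C \<ge> 0" "\<And>n x. x \<in> U \<Longrightarrow> norm (g n x) \<le> C * r ^ n" by blast
  show ?case
  proof (rule geom_bounded_0I)
    fix n x assume "x \<in> U"
    from C(2)[OF this] show "norm (g n x) \<le> C * s ^ n"
      by (rule order_trans) (use C(1) assms in \<open>auto intro: mult_left_mono power_mono\<close>)
  qed
next
  case (Suc k)
  have "geom_bounded 0 s U g"
    using geom_bounded_D0[OF Suc.IH[OF geom_bounded_Suc_lower[OF Suc.prems]]] .
  then show ?case using Suc by simp
qed

lemma geom_bounded_0_fun: "geom_bounded k r U (\<lambda>n x. 0)"
  by (induction k) (auto intro: exI[of _ 0])

lemma geom_bounded_const_1: "geom_bounded k 1 U (\<lambda>n x. c)"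
  by (cases k) (auto intro: geom_bounded_0_fun)

lemma geom_bounded_add:
  assumes "open U" "0 \<le> r" "geom_bounded k r U f" "geom_bounded k r U g"
  shows "geom_bounded k r U (\<lambda>n x. f n x + g n x)"
  using assms(3,4)
proof (induction k arbitrary: f g)
  case (0 f g)
  from geom_bounded_bound[OF 0(1) assms(2)]
  obtain C where "C \<ge> 0" and C: "\<And>n x. x \<in> U \<Longrightarrow> norm (f n x) \<le> C * r ^ n" by blast
  from geom_bounded_bound[OF 0(2) assms(2)]
  obtain D where "D \<ge> 0" and D: "\<And>n x. x \<in> U \<Longrightarrow> norm (g n x) \<le> D * r ^ n" by blast
  show ?case
    by (rule geom_bounded_0I[where C="C + D"])
      (use norm_add_rule_thm[OF C D] in \<open>auto simp: algebra_simps\<close>)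
next
  case (Suc k)
  show ?case
  proof (rule geom_bounded_SucI[OF assms(1)])
    show "geom_bounded 0 r U (\<lambda>n x. f n x + g n x)"
      using geom_bounded_D0[OF Suc.IH[OF Suc.prems[THEN geom_bounded_Suc_lower]]] .
    show "((\<lambda>x. f n x + g n x) has_derivative
        (\<lambda>v. frechet_derivative (f n) (at x) v + frechet_derivative (g n) (at x) v)) (at x)"
      if "x \<in> U" for n x
      using that Suc.prems by (intro has_derivative_add geom_bounded_has_derivative)
  qed (use Suc in auto)
qed

lemma geom_bounded_sum:
  assumes "open U" "0 \<le> r" "finite I" "\<And>i. i \<in> I \<Longrightarrow> geom_bounded k r U (f i)"
  shows "geom_bounded k r U (\<lambda>n x. \<Sum>i\<in>I. f i n x)"
  using assms(3,4)
  by (induction I rule: finite_induct) (auto intro: geom_bounded_0_fun geom_bounded_add[OF assms(1,2)])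

text \<open>Rates multiply: both terms of the product rule have the same rate \<open>r * s\<close>,
  so differentiation does not spoil it.\<close>

lemma geom_bounded_scaleR:
  fixes a :: "nat \<Rightarrow> 'a::euclidean_space \<Rightarrow> real"
  assumes "open U" "0 \<le> r" "0 \<le> s" "geom_bounded k r U a" "geom_bounded k s U f"
  shows "geom_bounded k (r * s) U (\<lambda>n x. a n x *\<^sub>R f n x)"
  using assms(4,5)
proof (induction k arbitrary: a f)
  case (0 a f)
  from geom_bounded_bound[OF 0(1) assms(2)]
  obtain C where C: "C \<ge> 0" "\<And>n x. x \<in> U \<Longrightarrow> norm (a n x) \<le> C * r ^ n" by blast
  from geom_bounded_bound[OF 0(2) assms(3)]
  obtain D where "D \<ge> 0" and D: "\<And>n x. x \<in> U \<Longrightarrow> norm (f n x) \<le> D * s ^ n" by blast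
  have "norm (a n x *\<^sub>R f n x) \<le> (C * D) * (r * s) ^ n" if "x \<in> U" for n x
  proof -
    have "norm (a n x *\<^sub>R f n x) \<le> (C * r ^ n) * (D * s ^ n)"
      unfolding norm_scaleR real_norm_def[symmetric]
      by (rule mult_mono) (use C D that assms in auto)
    then show ?thesis by (simp add: power_mult_distrib algebra_simps)
  qed
  then show ?case by (rule geom_bounded_0I)
next
  case (Suc k)
  note lower = Suc.prems[THEN geom_bounded_Suc_lower]
  show ?case
  proof (rule geom_bounded_SucI[OF assms(1)])
    show "geom_bounded 0 (r * s) U (\<lambda>n x. a n x *\<^sub>R f n x)"
      using geom_bounded_D0[OF Suc.IH[OF lower]] .
    show "((\<lambda>x. a n x *\<^sub>R f n x) has_derivative
        (\<lambda>v. a n x *\<^sub>R frechet_derivative (f n) (at x) v + frechet_derivative (a n) (at x) v *\<^sub>R f n x)) (at x)"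
      if "x \<in> U" for n x
      using that Suc.prems by (intro has_derivative_scaleR geom_bounded_has_derivative)
    show "geom_bounded k (r * s) U
        (\<lambda>n x. a n x *\<^sub>R frechet_derivative (f n) (at x) v + frechet_derivative (a n) (at x) v *\<^sub>R f n x)" for v
      using assms lower Suc.prems
      by (intro geom_bounded_add[OF assms(1)] Suc.IH geom_bounded_frechet) auto
  qed
qed

text \<open>The operators vary with \<open>n\<close> and may grow: for powers of the inverse linear
  part the growth rate \<open>1 / \<kappa>\<close> has to be outweighed by the decay of
  \<open>g\<close>.\<close>

lemma geom_bounded_linear:
  assumes "open U" "0 \<le> r" "0 \<le> s" "0 \<le> K" "\<And>n. bounded_linear (T n)"
    "\<And>n v. norm (T n v) \<le> K * s ^ n * norm v" "geom_bounded k r U g"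
  shows "geom_bounded k (s * r) U (\<lambda>n x. T n (g n x))"
  using assms(7)
proof (induction k arbitrary: g)
  case (0 g)
  from geom_bounded_bound[OF 0 assms(2)]
  obtain C where C: "C \<ge> 0" "\<And>n x. x \<in> U \<Longrightarrow> norm (g n x) \<le> C * r ^ n" by blast
  have "norm (T n (g n x)) \<le> (K * C) * (s * r) ^ n" if "x \<in> U" for n x
  proof -
    have "norm (T n (g n x)) \<le> K * s ^ n * (C * r ^ n)"
      by (rule order_trans[OF assms(6)], rule mult_left_mono) (use C that assms in auto)
    then show ?thesis by (simp add: power_mult_distrib algebra_simps)
  qed
  then show ?case by (rule geom_bounded_0I)
next
  case (Suc k)
  show ?case
  proof (rule geom_bounded_SucI[OF assms(1)])
    show "geom_bounded 0 (s * r) U (\<lambda>n x. T n (g n x))"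
      using geom_bounded_D0[OF Suc.IH[OF Suc.prems[THEN geom_bounded_Suc_lower]]] .
    show "((\<lambda>x. T n (g n x)) has_derivative (\<lambda>v. T n (frechet_derivative (g n) (at x) v))) (at x)"
      if "x \<in> U" for n x
      using that Suc.prems by (intro bounded_linear.has_derivative[OF assms(5)] geom_bounded_has_derivative)
    show "geom_bounded k (s * r) U (\<lambda>n x. T n (frechet_derivative (g n) (at x) v))" for v
      using Suc.prems by (intro Suc.IH geom_bounded_frechet)
  qed
qed

lemma geom_bounded_bounded_linear:
  assumes "open U" "0 \<le> r" "bounded_linear T" "geom_bounded k r U g"
  shows "geom_bounded k r U (\<lambda>n x. T (g n x))"
proof -
  from bounded_linear.nonneg_bounded[OF assms(3)]
  obtain K where "0 \<le> K" "\<And>v. norm (T v) \<le> norm v * K" by blast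
  then show ?thesis
    using geom_bounded_linear[OF assms(1,2), of 1 K "\<lambda>_. T" k g] assms(3,4)
    by (simp add: mult.commute)
qed

lemma geom_bounded_summable:
  assumes "0 \<le> r" "r < 1" "geom_bounded k r U g" "x \<in> U"
  shows "summable (\<lambda>n. g n x)"
proof -
  from geom_bounded_bound[OF assms(3,1)]
  obtain C where C: "\<And>n x. x \<in> U \<Longrightarrow> norm (g n x) \<le> C * r ^ n" by blast
  show ?thesis
    by (rule summable_comparison_test'[where g="\<lambda>n. C * r ^ n" and N=0])
      (use assms C in \<open>auto intro: summable_mult summable_geometric\<close>)
qed

text \<open>Differentiation term by term requires the derivatives to be summed uniformly in operator
  norm, whereas the bounds are given direction by direction. Adding the constants of the basis
  directions yields the operator bound \<open>B * r ^ n\<close>.\<close>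

lemma geom_bounded_series_has_derivative:
  fixes g :: "nat \<Rightarrow> 'a::euclidean_space \<Rightarrow> 'b::euclidean_space"
  assumes "open U" "convex U" "0 \<le> r" "r < 1" "geom_bounded (Suc k) r U g" "x \<in> U"
  shows "((\<lambda>x. \<Sum>n. g n x) has_derivative (\<lambda>v. \<Sum>n. frechet_derivative (g n) (at x) v)) (at x)"
proof -
  let ?D = "\<lambda>n x. frechet_derivative (g n) (at x)"
  note summ = geom_bounded_summable[OF assms(3,4)]
  have "\<forall>b. \<exists>C\<ge>0. \<forall>n. \<forall>x\<in>U. norm (?D n x b) \<le> C * r ^ n"
    using geom_bounded_bound[OF geom_bounded_frechet[OF assms(5)] assms(3)] by blast
  from choice[OF this]
  obtain C where C: "\<And>b. C b \<ge> 0" "\<And>b n x. x \<in> U \<Longrightarrow> norm (?D n x b) \<le> C b * r ^ n"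
    by blast
  define B where "B = (\<Sum>b\<in>(Basis::'a set). C b)"
  have B0: "B \<ge> 0" unfolding B_def using C(1) by (intro sum_nonneg)
  have lin: "linear (?D n x)" if "x \<in> U" for n x
    using has_derivative_linear[OF geom_bounded_has_derivative[OF assms(5) that]] .
  have DB: "norm (?D n x v) \<le> norm v * B * r ^ n" if "x \<in> U" for n x v
  proof -
    have "norm (?D n x v) \<le> (\<Sum>b\<in>Basis. norm ((v \<bullet> b) *\<^sub>R ?D n x b))"
      by (subst linear_euclidean_sum[OF lin[OF that]]) (rule norm_sum)
    also have "\<dots> \<le> (\<Sum>b\<in>Basis. norm v * (C b * r ^ n))"
    proof (rule sum_mono)
      fix b :: 'a assume "b \<in> Basis"
      then show "norm ((v \<bullet> b) *\<^sub>R ?D n x b) \<le> norm v * (C b * r ^ n)"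
        unfolding norm_scaleR
        by (intro mult_mono Basis_le_norm C that) (auto simp: C(1))
    qed
    finally show ?thesis by (simp add: B_def sum_distrib_left sum_distrib_right mult.assoc)
  qed
  have "\<exists>h. \<forall>x\<in>U. (\<lambda>n. g n x) sums (h x) \<and>
      (h has_derivative (\<lambda>v. \<Sum>n. ?D n x v)) (at x within U)"
  proof (rule has_derivative_series[OF assms(2) _ _ assms(6)])
    show "(g n has_derivative ?D n x) (at x within U)" if "x \<in> U" for n x
      using geom_bounded_has_derivative[OF assms(5) that] has_derivative_at_withinI by blast
    show "(\<lambda>n. g n x) sums (\<Sum>n. g n x)"
      using summ[OF assms(5,6)] by (rule summable_sums)
    fix e :: real assume "e > 0"
    \<comment> \<open>\<open>B / (1 - r) * r ^ n\<close> is the tail from index \<open>n\<close> on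
      of the geometric series that dominates the operator norms.\<close>
    have "(\<lambda>n. B / (1 - r) * r ^ n) \<longlonglongrightarrow> 0"
      using assms by (auto intro!: tendsto_mult_right_zero LIMSEQ_power_zero)
    from order_tendstoD(2)[OF this \<open>e > 0\<close>]
    show "\<forall>\<^sub>F n in sequentially. \<forall>x\<in>U. \<forall>v. norm (sum (\<lambda>i. ?D i x v) {..<n} - (\<Sum>n. ?D n x v)) \<le> e * norm v"
    proof eventually_elim
      case (elim n)
      show ?case
      proof (intro ballI allI)
        fix x v assume x: "x \<in> U"
        have s: "summable (\<lambda>n. ?D n x v)"
          using summ[OF geom_bounded_frechet[OF assms(5)] x] .
        have s2: "summable (\<lambda>i. norm v * B * r ^ (i + n))"
          using assms(3,4) unfolding power_add mult.assoc[symmetric]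
          by (intro summable_mult summable_mult2 summable_geometric) auto
        have "norm (sum (\<lambda>i. ?D i x v) {..<n} - (\<Sum>n. ?D n x v)) = norm (\<Sum>i. ?D (i + n) x v)"
          using suminf_minus_initial_segment[OF s, of n] by (simp add: norm_minus_commute)
        also have "\<dots> \<le> (\<Sum>i. norm v * B * r ^ (i + n))"
          using DB[OF x] s2 by (rule norm_suminf_le)
        also have "\<dots> = norm v * (B / (1 - r) * r ^ n)"
        proof -
          have "(\<Sum>i. norm v * B * r ^ (i + n)) = (\<Sum>i. (norm v * B * r ^ n) * r ^ i)"
            by (simp add: power_add mult_ac)
          also have "\<dots> = (norm v * B * r ^ n) * (1 / (1 - r))"
            using assms(3,4) by (subst suminf_mult) (auto simp: suminf_geometric summable_geometric)
          finally show ?thesis by (simp add: field_simps)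
        qed
        also have "\<dots> \<le> norm v * e"
          using elim by (intro mult_left_mono) auto
        finally show "norm (sum (\<lambda>i. ?D i x v) {..<n} - (\<Sum>n. ?D n x v)) \<le> e * norm v"
          by (simp add: mult.commute)
      qed
    qed
  qed
  then obtain h where h: "\<And>x. x \<in> U \<Longrightarrow> (\<lambda>n. g n x) sums (h x)"
    "\<And>x. x \<in> U \<Longrightarrow> (h has_derivative (\<lambda>v. \<Sum>n. ?D n x v)) (at x within U)" by blast
  have "(h has_derivative (\<lambda>v. \<Sum>n. ?D n x v)) (at x)"
    using h(2)[OF assms(6)] unfolding at_within_open[OF assms(6,1)] .
  then show ?thesis
    by (rule has_derivative_transform_within_open[OF _ assms(1,6)]) (rule sums_unique[OF h(1)])
qed

text \<open>One order is given away, since continuity of the sum is obtained from its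
  differentiability. For smoothness this loss is harmless.\<close>

lemma geom_bounded_series_Ck_on:
  assumes "open U" "convex U" "0 \<le> r" "r < 1" "geom_bounded (Suc k) r U g"
  shows "Ck_on k U (\<lambda>x. \<Sum>n. g n x)"
  using assms(5)
proof (induction k arbitrary: g)
  case (0 g)
  show ?case unfolding Ck_on.simps
  proof (rule continuous_at_imp_continuous_on, rule ballI)
    fix x assume "x \<in> U"
    from geom_bounded_series_has_derivative[OF assms(1-4) 0 this]
    show "continuous (at x) (\<lambda>x. \<Sum>n. g n x)" by (rule has_derivative_continuous)
  qed
next
  case (Suc k)
  show ?case
    by (rule Ck_on_SucI[OF assms(1) geom_bounded_series_has_derivative[OF assms(1-4) Suc.prems]])
      (assumption, rule Suc.IH[OF geom_bounded_frechet[OF Suc.prems]])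
qed

section \<open>Linearization of a contraction\<close>

lemma has_derivative_seg_bound:
  fixes h :: "'a::euclidean_space \<Rightarrow> 'b::euclidean_space"
  assumes "convex S" "\<And>x. x \<in> S \<Longrightarrow> (h has_derivative h' x) (at x)"
    "\<And>x v. x \<in> S \<Longrightarrow> norm (h' x v) \<le> B * norm v" "0 \<in> S" "h 0 = 0" "y \<in> S"
  shows "norm (h y) \<le> B * norm y"
proof -
  have "norm (h y - h 0) \<le> B * norm (y - 0)"
  proof (rule differentiable_bound[OF assms(1)])
    show "(h has_derivative h' x) (at x within S)" if "x \<in> S" for x
      using assms(2)[OF that] by (rule has_derivative_at_withinI)
    show "onorm (h' x) \<le> B" if "x \<in> S" for x
      by (rule onorm_le) (use assms(3)[OF that] in auto)
  qed (use assms in auto)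
  then show ?thesis using assms(5) by simp
qed

lemma norm_linear_Basis_bound:
  fixes D :: "'a::euclidean_space \<Rightarrow> 'b::real_normed_vector"
  assumes "linear D" "\<And>b. b \<in> Basis \<Longrightarrow> norm (D b) \<le> C b"
  shows "norm (D v) \<le> (\<Sum>b\<in>Basis. C b) * norm v"
proof -
  have "norm (D v) \<le> (\<Sum>b\<in>Basis. norm ((v \<bullet> b) *\<^sub>R D b))"
    by (subst linear_euclidean_sum[OF assms(1)]) (rule norm_sum)
  also have "\<dots> \<le> (\<Sum>b\<in>Basis. norm v * C b)"
    unfolding norm_scaleR by (intro sum_mono mult_mono Basis_le_norm assms(2)) auto
  finally show ?thesis by (simp add: sum_distrib_left mult.commute)
qed

text \<open>The compact set \<open>K\<close> between \<open>U\<close> and \<open>W\<close> makes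
  every smooth function on \<open>W\<close> bounded on \<open>U\<close> together with all its
  derivatives. Convexity of \<open>U\<close> allows the mean value inequality along segments from 0.
  Since \<open>N_Df\<close> holds with factor \<open>\<mu>\<close> and no further constant, it can
  be iterated along orbits without loss of the rate.\<close>

locale contracting_map =
  fixes f :: "'a::euclidean_space \<Rightarrow> 'a" and U W K :: "'a set" and N :: "'a \<Rightarrow> real" and \<mu> B :: real
  assumes open_U: "open U" and convex_U: "convex U" and zero_U: "0 \<in> U"
    and compact_K: "compact K" and UK: "U \<subseteq> K" and KW: "K \<subseteq> W" and open_W: "open W"
    and smooth_f: "smooth_on W f" and f_U: "f ` U \<subseteq> U" and f_0: "f 0 = 0"
    and mu: "0 < \<mu>" "\<mu> < 1"
    and norm_le_N: "norm v \<le> N v" and N_le_norm: "N v \<le> B * norm v"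
    and N_add: "N (v + w) \<le> N v + N w"
    and N_f: "x \<in> U \<Longrightarrow> N (f x) \<le> \<mu> * N x"
    and N_Df: "x \<in> U \<Longrightarrow> N (frechet_derivative f (at x) v) \<le> \<mu> * N v"
begin

lemma UW: "U \<subseteq> W" using UK KW by auto

lemma B_nonneg: "B \<ge> 0"
proof -
  obtain b :: 'a where "b \<in> Basis" using nonempty_Basis by blast
  then show ?thesis using norm_le_N[of b] N_le_norm[of b] by simp
qed

lemma orbit_U: "x \<in> U \<Longrightarrow> (f ^^ n) x \<in> U"
  by (induction n) (use f_U in auto)

lemma N_orbit: "x \<in> U \<Longrightarrow> N ((f ^^ n) x) \<le> \<mu> ^ n * N x"
proof (induction n)
  case (Suc n)
  have "N ((f ^^ Suc n) x) \<le> \<mu> * N ((f ^^ n) x)" using N_f[OF orbit_U[OF Suc.prems]] by simp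
  also have "\<dots> \<le> \<mu> * (\<mu> ^ n * N x)" using Suc mu by (intro mult_left_mono) auto
  finally show ?case by (simp add: mult.assoc)
qed simp

lemma orbit_tendsto_0: "x \<in> U \<Longrightarrow> (\<lambda>n. (f ^^ n) x) \<longlonglongrightarrow> 0"
proof (rule Lim_null_comparison)
  assume x: "x \<in> U"
  show "\<forall>\<^sub>F n in sequentially. norm ((f ^^ n) x) \<le> \<mu> ^ n * N x"
    using order_trans[OF norm_le_N N_orbit[OF x]] by (intro always_eventually allI)
  show "(\<lambda>n. \<mu> ^ n * N x) \<longlonglongrightarrow> 0"
    using mu by (intro tendsto_mult_left_zero LIMSEQ_power_zero) auto
qed

lemma orbit_geom_bounded_0: "geom_bounded 0 \<mu> U (\<lambda>n. f ^^ n)"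
proof -
  obtain D where D: "\<And>x. x \<in> U \<Longrightarrow> norm x \<le> D"
    using compact_imp_bounded[OF compact_K] UK unfolding bounded_iff by blast
  show ?thesis
  proof (rule geom_bounded_0I[where C="B * D"])
    fix n x assume x: "x \<in> U"
    have "norm ((f ^^ n) x) \<le> \<mu> ^ n * N x" using order_trans[OF norm_le_N N_orbit[OF x]] .
    also have "N x \<le> B * D" using N_le_norm[of x] D[OF x] B_nonneg by (meson mult_left_mono order_trans)
    finally show "norm ((f ^^ n) x) \<le> B * D * \<mu> ^ n" using mu by (simp add: mult.commute)
  qed
qed

lemma smooth_orbit: "smooth_on U (f ^^ n)"
proof (induction n)
  case 0
  have "smooth_on U (\<lambda>x. x)" by (rule smooth_on_linear[OF open_U bounded_linear_ident])
  then show ?case by (simp add: id_def)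
next
  case (Suc n)
  show ?case unfolding funpow.simps
    by (rule smooth_on_compose[OF open_U open_W smooth_f Suc]) (use orbit_U UW in auto)
qed

lemma has_derivative_comp_orbit:
  assumes "smooth_on W h" "x \<in> U"
  shows "((\<lambda>x. h ((f ^^ n) x)) has_derivative
    (\<lambda>v. \<Sum>b\<in>Basis. (frechet_derivative (f ^^ n) (at x) v \<bullet> b) *\<^sub>R
       frechet_derivative h (at ((f ^^ n) x)) b)) (at x)"
proof -
  have W: "(f ^^ n) x \<in> W" using orbit_U[OF assms(2)] UW by blast
  note hd = smooth_on_differentiable[OF assms(1) W]
  have "((\<lambda>x. h ((f ^^ n) x)) has_derivative
    (\<lambda>v. frechet_derivative h (at ((f ^^ n) x)) (frechet_derivative (f ^^ n) (at x) v))) (at x)"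
    using diff_chain_at[OF smooth_on_has_derivative[OF smooth_orbit assms(2)] differentiable_frechet[OF hd]]
    by (simp add: o_def)
  moreover have "(\<lambda>v. frechet_derivative h (at ((f ^^ n) x)) (frechet_derivative (f ^^ n) (at x) v)) =
    (\<lambda>v. \<Sum>b\<in>Basis. (frechet_derivative (f ^^ n) (at x) v \<bullet> b) *\<^sub>R
       frechet_derivative h (at ((f ^^ n) x)) b)"
    by (rule ext) (rule frechet_derivative_sum_Basis[OF hd])
  ultimately show ?thesis by simp
qed

lemma bounded_on_U:
  fixes h :: "'a \<Rightarrow> 'b::euclidean_space"
  assumes "smooth_on W h"
  shows "\<exists>C. \<forall>x\<in>U. norm (h x) \<le> C"
proof -
  have "compact (h ` K)"
    using compact_K continuous_on_subset[OF smooth_on_continuous_on[OF assms] KW]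
    by (rule compact_continuous_image[rotated])
  then have "bounded (h ` K)" by (rule compact_imp_bounded)
  then obtain C where "\<And>x. x \<in> K \<Longrightarrow> norm (h x) \<le> C" unfolding bounded_iff by auto
  then show ?thesis using UK by (intro exI[of _ C] ballI) auto
qed

lemma vanish_bound:
  fixes h :: "'a \<Rightarrow> 'b::euclidean_space"
  assumes "smooth_on W h" "h 0 = 0"
  shows "\<exists>C. \<forall>x\<in>U. norm (h x) \<le> C * norm x"
proof -
  have "\<forall>b. \<exists>C. \<forall>x\<in>U. norm (frechet_derivative h (at x) b) \<le> C"
    by (intro allI bounded_on_U smooth_on_frechet_derivative assms)
  from choice[OF this] obtain C where C: "\<And>b x. x \<in> U \<Longrightarrow> norm (frechet_derivative h (at x) b) \<le> C b"
    by blast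
  have hd: "(h has_derivative frechet_derivative h (at x)) (at x)" if "x \<in> U" for x
    using smooth_on_has_derivative[OF assms(1)] that UW by blast
  have "norm (h y) \<le> (\<Sum>b\<in>Basis. C b) * norm y" if "y \<in> U" for y
    by (rule has_derivative_seg_bound[OF convex_U hd])
      (use norm_linear_Basis_bound[OF has_derivative_linear[OF hd] C] zero_U assms(2) that in auto)
  then show ?thesis by blast
qed

text \<open>The second order Taylor estimate by two uses of the mean value inequality. By
  \<open>vanish_bound\<close> the derivative is bounded by a multiple of \<open>norm x\<close>. The
  second use takes place on the segment from 0 to \<open>y\<close> instead of \<open>U\<close>,
  because there \<open>norm x\<close> is at most \<open>norm y\<close>.\<close>

lemma vanish2_bound:
  fixes h :: "'a \<Rightarrow> 'b::euclidean_space"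
  assumes "smooth_on W h" "h 0 = 0" "\<And>v. frechet_derivative h (at 0) v = 0"
  shows "\<exists>C. \<forall>x\<in>U. norm (h x) \<le> C * (norm x)\<^sup>2"
proof -
  have "\<forall>b. \<exists>C. \<forall>x\<in>U. norm (frechet_derivative h (at x) b) \<le> C * norm x"
    by (intro allI vanish_bound smooth_on_frechet_derivative assms)
  from choice[OF this]
  obtain C where C: "\<And>b x. x \<in> U \<Longrightarrow> norm (frechet_derivative h (at x) b) \<le> C b * norm x"
    by blast
  define c where "c = (\<Sum>b\<in>(Basis::'a set). \<bar>C b\<bar>)"
  have c0: "c \<ge> 0" unfolding c_def by (intro sum_nonneg) auto
  have hd: "(h has_derivative frechet_derivative h (at x)) (at x)" if "x \<in> U" for x
    using smooth_on_has_derivative[OF assms(1)] that UW by blast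
  have "norm (h y) \<le> c * norm y * norm y" if y: "y \<in> U" for y
  proof (rule has_derivative_seg_bound)
    have seg: "closed_segment 0 y \<subseteq> U"
      using convex_U zero_U y by (simp add: closed_segment_subset)
    show "convex (closed_segment 0 y)" by simp
    show "(h has_derivative frechet_derivative h (at x)) (at x)" if "x \<in> closed_segment 0 y" for x
      using hd seg that by blast
    show "norm (frechet_derivative h (at x) v) \<le> c * norm y * norm v" if "x \<in> closed_segment 0 y" for x v
    proof -
      have xU: "x \<in> U" using seg that by blast
      have nx: "norm x \<le> norm y"
        using segment_bound(1)[OF that] by simp
      have "norm (frechet_derivative h (at x) v) \<le> (\<Sum>b\<in>Basis. \<bar>C b\<bar> * norm y) * norm v"
      proof (rule norm_linear_Basis_bound[OF has_derivative_linear[OF hd[OF xU]]])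
        fix b
        have "C b * norm x \<le> \<bar>C b\<bar> * norm y" using nx by (intro mult_mono) auto
        with C[OF xU, of b] show "norm (frechet_derivative h (at x) b) \<le> \<bar>C b\<bar> * norm y" by linarith
      qed
      then show ?thesis by (simp add: c_def sum_distrib_right)
    qed
  qed (use assms(2) in auto)
  then show ?thesis by (intro exI[of _ c]) (simp add: power2_eq_square mult.assoc)
qed

section \<open>Decay of functions and their derivatives along orbits\<close>

lemma comp_orbit_0:
  assumes "smooth_on W h"
  shows "geom_bounded 0 1 U (\<lambda>n x. h ((f ^^ n) x))"
  using bounded_on_U[OF assms] orbit_U by (simp del: funpow.simps) blast

text \<open>Differentiating \<open>h\<close> composed with \<open>f ^^ n\<close> brings out a
  derivative of \<open>f ^^ n\<close>, which contributes the additional factor \<open>\<mu>\<close>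
  to the rate.\<close>

lemma comp_orbit_deriv:
  assumes "smooth_on W h" "geom_bounded (Suc k) \<mu> U (\<lambda>n. f ^^ n)"
    "\<And>b. geom_bounded k s U (\<lambda>n x. frechet_derivative h (at ((f ^^ n) x)) b)" "0 \<le> s"
  shows "geom_bounded k (\<mu> * s) U (\<lambda>n x. frechet_derivative (\<lambda>x. h ((f ^^ n) x)) (at x) v)"
proof -
  have "geom_bounded k (\<mu> * s) U (\<lambda>n x. \<Sum>b\<in>Basis. (frechet_derivative (f ^^ n) (at x) v \<bullet> b) *\<^sub>R
       frechet_derivative h (at ((f ^^ n) x)) b)"
    using mu assms
    by (intro geom_bounded_sum geom_bounded_scaleR open_U geom_bounded_frechet
        geom_bounded_bounded_linear[OF open_U _ bounded_linear_inner_left]) auto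
  then show ?thesis
    by (subst geom_bounded_cong[OF open_U]) (simp_all add: frechet_derivative_eq[OF has_derivative_comp_orbit[OF assms(1)]])
qed

text \<open>Only the values have to be estimated at the full rate \<open>\<mu> * r\<close>; the
  derivatives get one factor \<open>\<mu>\<close> from the chain rule. It is used with
  \<open>r = 1\<close> for functions vanishing at 0, and with \<open>r = \<mu>\<close> for functions
  vanishing to second order.\<close>

lemma geom_bounded_comp_orbitI:
  assumes "smooth_on W h" "geom_bounded k \<mu> U (\<lambda>n. f ^^ n)" "0 \<le> r"
    "geom_bounded 0 (\<mu> * r) U (\<lambda>n x. h ((f ^^ n) x))"
    "\<And>j b. j < k \<Longrightarrow> geom_bounded j r U (\<lambda>n x. frechet_derivative h (at ((f ^^ n) x)) b)"
  shows "geom_bounded k (\<mu> * r) U (\<lambda>n x. h ((f ^^ n) x))"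
proof (cases k)
  case 0
  then show ?thesis using assms(4) by simp
next
  case (Suc j)
  have "(\<lambda>x. h ((f ^^ n) x)) differentiable (at x)" if "x \<in> U" for n x
    using has_derivative_comp_orbit[OF assms(1) that] by (auto simp: differentiable_def)
  then show ?thesis
    using assms(4) comp_orbit_deriv[OF assms(1), of j r] assms(2,3,5)[unfolded Suc]
    by (simp add: Suc)
qed

lemma geom_bounded_comp_orbit:
  assumes "smooth_on W h" "geom_bounded k \<mu> U (\<lambda>n. f ^^ n)"
  shows "geom_bounded k 1 U (\<lambda>n x. h ((f ^^ n) x))"
  using assms
proof (induction k arbitrary: h)
  case 0
  then show ?case using comp_orbit_0 by blast
next
  case (Suc k)
  note lower = geom_bounded_Suc_lower[OF Suc.prems(2)]
  have "geom_bounded k (\<mu> * 1) U (\<lambda>n x. frechet_derivative (\<lambda>x. h ((f ^^ n) x)) (at x) v)" for v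
    using Suc.IH[OF smooth_on_frechet_derivative[OF Suc.prems(1)] lower] Suc.prems
    by (intro comp_orbit_deriv) auto
  then have "geom_bounded k 1 U (\<lambda>n x. frechet_derivative (\<lambda>x. h ((f ^^ n) x)) (at x) v)" for v
    using mu by (intro geom_bounded_mono[of "\<mu> * 1" 1]) auto
  moreover have "(\<lambda>x. h ((f ^^ n) x)) differentiable (at x)" if "x \<in> U" for n x
    using has_derivative_comp_orbit[OF Suc.prems(1) that] by (auto simp: differentiable_def)
  ultimately show ?case
    using comp_orbit_0[OF Suc.prems(1)] by simp
qed

lemma geom_bounded_comp_orbit_vanish:
  assumes "smooth_on W h" "geom_bounded k \<mu> U (\<lambda>n. f ^^ n)" "h 0 = 0"
  shows "geom_bounded k \<mu> U (\<lambda>n x. h ((f ^^ n) x))"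
proof -
  obtain C where C: "\<And>x. x \<in> U \<Longrightarrow> norm (h x) \<le> C * norm x"
    using vanish_bound[OF assms(1,3)] by blast
  from geom_bounded_bound[OF orbit_geom_bounded_0] mu
  obtain D where D: "D \<ge> 0" "\<And>n x. x \<in> U \<Longrightarrow> norm ((f ^^ n) x) \<le> D * \<mu> ^ n" by auto
  have "geom_bounded 0 \<mu> U (\<lambda>n x. h ((f ^^ n) x))"
  proof (rule geom_bounded_0I)
    fix n x assume x: "x \<in> U"
    have "norm (h ((f ^^ n) x)) \<le> \<bar>C\<bar> * norm ((f ^^ n) x)"
      using C[OF orbit_U[OF x, of n]] abs_ge_self[of C] by (meson mult_right_mono norm_ge_zero order_trans)
    also have "\<dots> \<le> \<bar>C\<bar> * (D * \<mu> ^ n)" using D(2)[OF x] by (intro mult_left_mono) auto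
    finally show "norm (h ((f ^^ n) x)) \<le> \<bar>C\<bar> * D * \<mu> ^ n" by (simp add: mult.assoc)
  qed
  moreover have "geom_bounded j 1 U (\<lambda>n x. frechet_derivative h (at ((f ^^ n) x)) b)" if "j < k" for j b
  proof -
    have "geom_bounded j \<mu> U (\<lambda>n. f ^^ n)"
      using assms(2) that by (induction k) (auto simp: less_Suc_eq dest: geom_bounded_Suc_lower simp del: geom_bounded.simps)
    then show ?thesis by (rule geom_bounded_comp_orbit[OF smooth_on_frechet_derivative[OF assms(1)]])
  qed
  ultimately show ?thesis using geom_bounded_comp_orbitI[OF assms(1,2), of 1] by simp
qed

text \<open>The values decay at the rate \<mu>^2 by the quadratic estimate. The derivatives of
  \<open>h\<close> vanish at 0 and so decay at the rate \<mu> along orbits; the chain rule supplies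
  the second factor.\<close>

lemma geom_bounded_comp_orbit_vanish2:
  assumes "smooth_on W h" "geom_bounded k \<mu> U (\<lambda>n. f ^^ n)" "h 0 = 0" "\<And>v. frechet_derivative h (at 0) v = 0"
  shows "geom_bounded k (\<mu>\<^sup>2) U (\<lambda>n x. h ((f ^^ n) x))"
proof -
  obtain C where C: "\<And>x. x \<in> U \<Longrightarrow> norm (h x) \<le> C * (norm x)\<^sup>2"
    using vanish2_bound[OF assms(1,3,4)] by blast
  from geom_bounded_bound[OF orbit_geom_bounded_0] mu
  obtain D where D: "D \<ge> 0" "\<And>n x. x \<in> U \<Longrightarrow> norm ((f ^^ n) x) \<le> D * \<mu> ^ n" by auto
  have "geom_bounded 0 (\<mu>\<^sup>2) U (\<lambda>n x. h ((f ^^ n) x))"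
  proof (rule geom_bounded_0I)
    fix n x assume x: "x \<in> U"
    have "norm (h ((f ^^ n) x)) \<le> \<bar>C\<bar> * (norm ((f ^^ n) x))\<^sup>2"
      using C[OF orbit_U[OF x, of n]] abs_ge_self[of C] by (meson mult_right_mono zero_le_power2 order_trans)
    also have "\<dots> \<le> \<bar>C\<bar> * (D * \<mu> ^ n)\<^sup>2" using D(2)[OF x] by (intro mult_left_mono power_mono) auto
    finally show "norm (h ((f ^^ n) x)) \<le> (\<bar>C\<bar> * D\<^sup>2) * (\<mu>\<^sup>2) ^ n"
      by (simp add: power_mult_distrib mult.assoc flip: power_mult) (simp add: mult.commute)
  qed
  moreover have "geom_bounded j \<mu> U (\<lambda>n x. frechet_derivative h (at ((f ^^ n) x)) b)" if "j < k" for j b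
  proof -
    have "geom_bounded j \<mu> U (\<lambda>n. f ^^ n)"
      using assms(2) that by (induction k) (auto simp: less_Suc_eq dest: geom_bounded_Suc_lower simp del: geom_bounded.simps)
    then show ?thesis
      by (rule geom_bounded_comp_orbit_vanish[OF smooth_on_frechet_derivative[OF assms(1)]]) (rule assms(4))
  qed
  ultimately show ?thesis using geom_bounded_comp_orbitI[OF assms(1,2), of \<mu>] mu by (simp add: power2_eq_square)
qed

end

section \<open>Decay of all derivatives of the iterates\<close>

context contracting_map
begin

text \<open>The constant \<open>D\<close> below is chosen such that the term \<open>D (\<mu>\<^sup>n - \<mu>\<^sup>2\<^sup>n)\<close> exactly absorbs the
  contribution of \<open>e\<close>.\<close>

lemma linear_recursion_base:
  assumes rec: "\<And>n x. x \<in> U \<Longrightarrow> h (Suc n) x =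
      (\<Sum>b\<in>Basis. (h n x \<bullet> b) *\<^sub>R frechet_derivative f (at ((f ^^ n) x)) b) + e n x"
    and e: "geom_bounded 0 (\<mu>\<^sup>2) U e" and h0: "geom_bounded 0 1 U (\<lambda>n. h 0)"
  shows "geom_bounded 0 \<mu> U h"
proof -
  from geom_bounded_bound[OF e] obtain E
    where E: "E \<ge> 0" "\<And>n x. x \<in> U \<Longrightarrow> norm (e n x) \<le> E * (\<mu>\<^sup>2) ^ n" by auto
  from geom_bounded_bound[OF h0] obtain H
    where H: "H \<ge> 0" "\<And>x. x \<in> U \<Longrightarrow> norm (h 0 x) \<le> H" by auto
  have pos: "\<mu> - \<mu>\<^sup>2 > 0" using mu by (simp add: power2_eq_square)
  define D where "D = B * E / (\<mu> - \<mu>\<^sup>2)"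
  have D0: "D \<ge> 0" unfolding D_def using B_nonneg E(1) pos by simp
  have DE: "B * E = D * (\<mu> - \<mu>\<^sup>2)" unfolding D_def using pos by simp
  have key: "N (h n x) \<le> B * H * \<mu> ^ n + D * (\<mu> ^ n - (\<mu>\<^sup>2) ^ n)" if x: "x \<in> U" for n x
  proof (induction n)
    case 0
    have "N (h 0 x) \<le> B * H"
      using N_le_norm[of "h 0 x"] mult_left_mono[OF H(2)[OF x] B_nonneg] by linarith
    then show ?case by simp
  next
    case (Suc n)
    have "(f ^^ n) x \<in> U" by (rule orbit_U[OF x])
    with UW have W: "(f ^^ n) x \<in> W" and U': "(f ^^ n) x \<in> U" by auto
    have "h (Suc n) x = frechet_derivative f (at ((f ^^ n) x)) (h n x) + e n x"
      using rec[OF x] frechet_derivative_sum_Basis[OF smooth_on_differentiable[OF smooth_f W], of "h n x"]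
      by simp
    then have "N (h (Suc n) x) \<le> N (frechet_derivative f (at ((f ^^ n) x)) (h n x)) + N (e n x)"
      using N_add by simp
    also have "\<dots> \<le> \<mu> * N (h n x) + B * (E * (\<mu>\<^sup>2) ^ n)"
      using N_Df[OF U'] N_le_norm[of "e n x"] mult_left_mono[OF E(2)[OF x, of n] B_nonneg]
      by (meson add_mono order_trans)
    also have "\<dots> \<le> \<mu> * (B * H * \<mu> ^ n + D * (\<mu> ^ n - (\<mu>\<^sup>2) ^ n)) + (B * E) * (\<mu>\<^sup>2) ^ n"
      using mult_left_mono[OF Suc.IH, of \<mu>] mu by simp
    also have "\<dots> = B * H * \<mu> ^ Suc n + D * (\<mu> ^ Suc n - (\<mu>\<^sup>2) ^ Suc n)"
      unfolding DE by (simp add: algebra_simps)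
    finally show ?case .
  qed
  show ?thesis
  proof (rule geom_bounded_0I[where C="B * H + D"])
    fix n x assume x: "x \<in> U"
    have "norm (h n x) \<le> B * H * \<mu> ^ n + D * (\<mu> ^ n - (\<mu>\<^sup>2) ^ n)"
      using norm_le_N key[OF x] by (rule order_trans)
    also have "\<dots> \<le> B * H * \<mu> ^ n + D * \<mu> ^ n"
      using D0 by (intro add_left_mono mult_left_mono) auto
    finally show "norm (h n x) \<le> (B * H + D) * \<mu> ^ n" by (simp add: distrib_right)
  qed
qed

text \<open>Differentiating the recursion for \<open>h\<close> gives a recursion of the same form for the directional
  derivatives of \<open>h\<close>, whose inhomogeneous term still decays like \<open>\<mu>\<^sup>2\<^sup>n\<close>, since it is a sum of
  products of two factors that decay like \<open>\<mu>\<^sup>n\<close>.\<close>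

lemma linear_recursion:
  assumes "\<And>n. smooth_on U (h n)"
    "\<And>n x. x \<in> U \<Longrightarrow> h (Suc n) x =
      (\<Sum>b\<in>Basis. (h n x \<bullet> b) *\<^sub>R frechet_derivative f (at ((f ^^ n) x)) b) + e n x"
    "geom_bounded k \<mu> U (\<lambda>n. f ^^ n)"
    "geom_bounded k (\<mu>\<^sup>2) U e" "geom_bounded k 1 U (\<lambda>n. h 0)"
  shows "geom_bounded k \<mu> U h"
  using assms
proof (induction k arbitrary: h e)
  case 0
  then show ?case by (intro linear_recursion_base) auto
next
  case (Suc k)
  note lower = Suc.prems(3-5)[THEN geom_bounded_Suc_lower]
  have h: "geom_bounded k \<mu> U h" by (rule Suc.IH[OF Suc.prems(1,2) lower])
  let ?F = "\<lambda>b n x. frechet_derivative f (at ((f ^^ n) x)) b"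
  have smF: "smooth_on W (\<lambda>y. frechet_derivative f (at y) b)" for b
    by (rule smooth_on_frechet_derivative[OF smooth_f])
  have "geom_bounded k \<mu> U (\<lambda>n x. frechet_derivative (h n) (at x) u)" for u
  proof (rule Suc.IH)
    let ?e = "\<lambda>n x. (\<Sum>b\<in>Basis. (h n x \<bullet> b) *\<^sub>R frechet_derivative (?F b n) (at x) u)
        + frechet_derivative (e n) (at x) u"
    show "smooth_on U (\<lambda>x. frechet_derivative (h n) (at x) u)" for n
      by (rule smooth_on_frechet_derivative[OF Suc.prems(1)])
    show "geom_bounded k \<mu> U (\<lambda>n. f ^^ n)" by (rule lower)
    show "geom_bounded k 1 U (\<lambda>n x. frechet_derivative (h 0) (at x) u)"
      by (rule geom_bounded_frechet[OF Suc.prems(5)])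
    have "geom_bounded k (\<mu> * 1) U (\<lambda>n x. frechet_derivative (?F b n) (at x) u)" for b
      by (rule comp_orbit_deriv[OF smF Suc.prems(3) geom_bounded_comp_orbit[OF smooth_on_frechet_derivative[OF smF] lower(1)]]) simp
    then have "geom_bounded k (\<mu> * \<mu>) U (\<lambda>n x. (\<Sum>b\<in>Basis. (h n x \<bullet> b) *\<^sub>R frechet_derivative (?F b n) (at x) u))"
      using mu h
      by (intro geom_bounded_sum geom_bounded_scaleR open_U
          geom_bounded_bounded_linear[OF open_U _ bounded_linear_inner_left]) auto
    then show "geom_bounded k (\<mu>\<^sup>2) U ?e"
      using geom_bounded_frechet[OF Suc.prems(4)]
      by (intro geom_bounded_add open_U) (auto simp: power2_eq_square)
    fix n x assume x: "x \<in> U"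
    have hd: "(h n has_derivative frechet_derivative (h n) (at x)) (at x)"
      by (rule smooth_on_has_derivative[OF Suc.prems(1) x])
    have hF: "(?F b n has_derivative frechet_derivative (?F b n) (at x)) (at x)" for b
      using has_derivative_comp_orbit[OF smF x] by (intro differentiable_frechet) (auto simp: differentiable_def)
    have "((\<lambda>x. (\<Sum>b\<in>Basis. (h n x \<bullet> b) *\<^sub>R ?F b n x) + e n x) has_derivative
       (\<lambda>u. (\<Sum>b\<in>Basis. (h n x \<bullet> b) *\<^sub>R frechet_derivative (?F b n) (at x) u
          + (frechet_derivative (h n) (at x) u \<bullet> b) *\<^sub>R ?F b n x) + frechet_derivative (e n) (at x) u)) (at x)"
      by (intro has_derivative_add has_derivative_sum has_derivative_scaleR
          bounded_linear.has_derivative[OF bounded_linear_inner_left] hd hF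
          geom_bounded_has_derivative[OF Suc.prems(4) x])
    then have "(h (Suc n) has_derivative
       (\<lambda>u. (\<Sum>b\<in>Basis. (h n x \<bullet> b) *\<^sub>R frechet_derivative (?F b n) (at x) u
          + (frechet_derivative (h n) (at x) u \<bullet> b) *\<^sub>R ?F b n x) + frechet_derivative (e n) (at x) u)) (at x)"
      by (rule has_derivative_transform_within_open[OF _ open_U x]) (simp add: Suc.prems(2))
    from frechet_derivative_eq[OF this]
    show "frechet_derivative (h (Suc n)) (at x) u =
      (\<Sum>b\<in>Basis. (frechet_derivative (h n) (at x) u \<bullet> b) *\<^sub>R ?F b n x) + ?e n x"
      by (simp add: sum.distrib)
  qed
  moreover have "h n differentiable (at x)" if "x \<in> U" for n x
    by (rule smooth_on_differentiable[OF Suc.prems(1) that])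
  ultimately show ?case using geom_bounded_D0[OF h] by simp
qed

lemma frechet_derivative_orbit_Suc:
  assumes "x \<in> U"
  shows "frechet_derivative (f ^^ Suc n) (at x) v =
    frechet_derivative f (at ((f ^^ n) x)) (frechet_derivative (f ^^ n) (at x) v)"
proof -
  have "(f ^^ n) x \<in> W" using orbit_U[OF assms] UW by blast
  from diff_chain_at[OF smooth_on_has_derivative[OF smooth_orbit assms] smooth_on_has_derivative[OF smooth_f this]]
  show ?thesis by (simp add: frechet_derivative_eq)
qed

text \<open>By the chain rule the directional derivatives of the iterates satisfy the homogeneous
  recursion, that is \<open>e = 0\<close>. Its coefficients are derivatives of \<open>f\<close>
  along the orbit; the bounds of order \<open>k\<close> for the orbit control them to order
  \<open>k\<close> and thus yield the bounds of order \<open>k + 1\<close>.\<close>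

lemma orbit_geom_bounded: "geom_bounded k \<mu> U (\<lambda>n. f ^^ n)"
proof (induction k)
  case 0
  show ?case by (rule orbit_geom_bounded_0)
next
  case (Suc k)
  have "geom_bounded k \<mu> U (\<lambda>n x. frechet_derivative (f ^^ n) (at x) v)" for v
  proof (rule linear_recursion[where e="\<lambda>n x. 0"])
    show "smooth_on U (\<lambda>x. frechet_derivative (f ^^ n) (at x) v)" for n
      by (rule smooth_on_frechet_derivative[OF smooth_orbit])
    show "frechet_derivative (f ^^ Suc n) (at x) v =
       (\<Sum>b\<in>Basis. (frechet_derivative (f ^^ n) (at x) v \<bullet> b) *\<^sub>R frechet_derivative f (at ((f ^^ n) x)) b) + 0"
      if x: "x \<in> U" for n x
    proof -
      have "(f ^^ n) x \<in> W" using orbit_U[OF x] UW by blast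
      from frechet_derivative_sum_Basis[OF smooth_on_differentiable[OF smooth_f this]]
      show ?thesis unfolding frechet_derivative_orbit_Suc[OF x] add_0_right .
    qed
    have "frechet_derivative (f ^^ 0) (at x) v = v" for x
      by (simp add: id_def frechet_derivative_eq[OF has_derivative_ident])
    then show "geom_bounded k 1 U (\<lambda>n x. frechet_derivative (f ^^ 0) (at x) v)"
      by (simp add: geom_bounded_const_1)
  qed (rule Suc geom_bounded_0_fun)+
  moreover have "(f ^^ n) differentiable (at x)" if "x \<in> U" for n x
    by (rule smooth_on_differentiable[OF smooth_orbit that])
  ultimately show ?case using orbit_geom_bounded_0 by simp
qed

end

text \<open>The condition \<open>\<mu>\<^sup>2 < \<kappa>\<close> makes the corrections \<open>L\<^sup>-\<^sup>n\<^sup>-\<^sup>1 (R (f\<^sup>n x))\<close> summable, where the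
  remainder \<open>R = f - L\<close> vanishes to second order at \<open>0\<close>.\<close>

locale conformal_contraction = contracting_map f U W K N \<mu> B
  for f :: "'a::euclidean_space \<Rightarrow> 'a" and U W K N \<mu> B +
  fixes L L' :: "'a \<Rightarrow> 'a" and \<kappa> C :: real
  assumes Df_0: "(f has_derivative L) (at 0)"
    and linear_L': "linear L'" and L'_L: "L' (L v) = v" and L_L': "L (L' v) = v"
    and lam: "0 < \<kappa>" "\<mu>\<^sup>2 < \<kappa>"
    and C_nonneg: "0 \<le> C"
    and L_bound: "norm ((L ^^ n) v) \<le> C * \<kappa> ^ n * norm v"
    and L'_bound: "norm ((L' ^^ n) v) \<le> C * (1 / \<kappa>) ^ n * norm v"
begin

lemma linear_L: "linear L" using Df_0 by (rule has_derivative_linear)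

lemmas linear_iterates = linear_funpow[OF linear_L] linear_funpow[OF linear_L']

lemmas inverse_iterates = funpow_left_inverse[of L' L, OF L'_L] funpow_left_inverse[of L L', OF L_L']

section \<open>The linearizing map\<close>

definition R where "R y = f y - L y"
definition correction where "correction n x = (L' ^^ Suc n) (R ((f ^^ n) x))"
text \<open>The limit of \<open>(L' ^^ n) ((f ^^ n) x)\<close>. By \<open>partial_sums\<close> the
  corrections are the increments of this sequence, and the form of a series makes it accessible to
  differentiation term by term.\<close>

definition psi where "psi x = x + (\<Sum>n. correction n x)"

lemma R_smooth: "smooth_on W R"
proof -
  have "smooth_on W (\<lambda>x. f x + - L x)"
    by (intro smooth_on_add open_W smooth_f smooth_on_linear bounded_linear_minus
        linear_conv_bounded_linear[THEN iffD1] linear_L)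
  then show ?thesis by (simp add: R_def[abs_def])
qed

lemma R_0: "R 0 = 0" "frechet_derivative R (at 0) v = 0"
proof -
  show "R 0 = 0" by (simp add: R_def f_0 linear_0[OF linear_L])
  have "(R has_derivative (\<lambda>v. L v - L v)) (at 0)"
    unfolding R_def[abs_def]
    by (intro has_derivative_diff Df_0 bounded_linear_imp_has_derivative
        linear_conv_bounded_linear[THEN iffD1] linear_L)
  from frechet_derivative_eq[OF this] show "frechet_derivative R (at 0) v = 0" by simp
qed

lemma ratio: "0 \<le> \<mu>\<^sup>2 / \<kappa>" "\<mu>\<^sup>2 / \<kappa> < 1" using lam by auto

lemma correction_geom_bounded: "geom_bounded k (\<mu>\<^sup>2 / \<kappa>) U correction"
proof -
  have "geom_bounded k (1 / \<kappa> * \<mu>\<^sup>2) U (\<lambda>n x. (L' ^^ Suc n) (R ((f ^^ n) x)))"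
  \<comment> \<open>The exponent \<open>Suc n\<close> in \<open>correction\<close> costs one factor
    \<open>1 / \<kappa>\<close> compared with \<open>n\<close>, hence
    \<open>K = C / \<kappa>\<close>.\<close>
  proof (rule geom_bounded_linear[OF open_U, where K="C / \<kappa>"
        and T="\<lambda>n. L' ^^ Suc n" and g="\<lambda>n x. R ((f ^^ n) x)"])
    show "geom_bounded k (\<mu>\<^sup>2) U (\<lambda>n x. R ((f ^^ n) x))"
      by (rule geom_bounded_comp_orbit_vanish2[OF R_smooth orbit_geom_bounded R_0])
    show "bounded_linear (L' ^^ Suc n)" for n
      using linear_iterates(2) linear_conv_bounded_linear by blast
    show "norm ((L' ^^ Suc n) v) \<le> C / \<kappa> * (1 / \<kappa>) ^ n * norm v" for n v
      using L'_bound[of "Suc n" v] by simp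
  qed (use lam C_nonneg in auto)
  then show ?thesis by (simp add: correction_def[abs_def])
qed

lemma partial_sums: "(L' ^^ n) ((f ^^ n) x) = x + (\<Sum>i<n. correction i x)"
proof (induction n)
  case (Suc n)
  have "(L' ^^ Suc n) ((f ^^ Suc n) x) = (L' ^^ Suc n) (L ((f ^^ n) x) + R ((f ^^ n) x))"
    by (simp add: R_def)
  also have "\<dots> = (L' ^^ n) (L' (L ((f ^^ n) x))) + correction n x"
    unfolding linear_add[OF linear_iterates(2)] correction_def by (simp add: funpow_swap1)
  finally show ?case using Suc by (simp add: L'_L algebra_simps)
qed simp

lemma psi_limit: "x \<in> U \<Longrightarrow> (\<lambda>n. (L' ^^ n) ((f ^^ n) x)) \<longlonglongrightarrow> psi x"
  unfolding partial_sums psi_def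
  by (intro tendsto_add tendsto_const summable_LIMSEQ
      geom_bounded_summable[OF ratio correction_geom_bounded[of 0]])

lemma psi_smooth: "smooth_on U psi"
  unfolding smooth_on_def psi_def[abs_def]
  by (intro allI Ck_on_add open_U Ck_on_linear bounded_linear_ident
      geom_bounded_series_Ck_on[OF open_U convex_U ratio correction_geom_bounded])

lemma psi_has_derivative:
  "x \<in> U \<Longrightarrow> (psi has_derivative (\<lambda>v. v + (\<Sum>n. frechet_derivative (correction n) (at x) v))) (at x)"
  unfolding psi_def[abs_def]
  by (intro has_derivative_add has_derivative_ident
      geom_bounded_series_has_derivative[OF open_U convex_U ratio correction_geom_bounded[of "Suc 0"]])

text \<open>Limit and derivative commute because the series may be differentiated term by term. This
  is what allows the Finsler function to be followed along the iterates.\<close>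

lemma psi_derivative_limit:
  assumes "x \<in> U"
  shows "(\<lambda>n. (L' ^^ n) (frechet_derivative (f ^^ n) (at x) v)) \<longlonglongrightarrow> frechet_derivative psi (at x) v"
proof -
  have "(L' ^^ n) (frechet_derivative (f ^^ n) (at x) v)
      = v + (\<Sum>i<n. frechet_derivative (correction i) (at x) v)" for n
  proof -
    have "((\<lambda>x. (L' ^^ n) ((f ^^ n) x)) has_derivative
        (\<lambda>v. (L' ^^ n) (frechet_derivative (f ^^ n) (at x) v))) (at x)"
      using linear_iterates(2)[of n] unfolding linear_conv_bounded_linear
      by (rule bounded_linear.has_derivative) (rule smooth_on_has_derivative[OF smooth_orbit assms])
    moreover have "((\<lambda>x. x + (\<Sum>i<n. correction i x)) has_derivative
        (\<lambda>v. v + (\<Sum>i<n. frechet_derivative (correction i) (at x) v))) (at x)"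
      by (intro has_derivative_add has_derivative_ident has_derivative_sum
          geom_bounded_has_derivative[OF correction_geom_bounded assms])
    ultimately show ?thesis
      unfolding partial_sums by (metis (no_types) has_derivative_unique)
  qed
  moreover have "(\<lambda>n. v + (\<Sum>i<n. frechet_derivative (correction i) (at x) v))
      \<longlonglongrightarrow> v + (\<Sum>n. frechet_derivative (correction n) (at x) v)"
    by (intro tendsto_add tendsto_const summable_LIMSEQ
        geom_bounded_summable[OF ratio geom_bounded_frechet[OF correction_geom_bounded[of "Suc 0"]] assms])
  ultimately show ?thesis
    unfolding frechet_derivative_eq[OF psi_has_derivative[OF assms]] by simp
qed

text \<open>Replacing \<open>x\<close> by \<open>f x\<close> advances the approximating sequence by
  one index, up to an application of \<open>L\<close>.\<close>

lemma psi_f: 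
  assumes "x \<in> U"
  shows "psi (f x) = L (psi x)"
proof -
  have "f x \<in> U" using assms f_U by auto
  from psi_limit[OF this] have 1: "(\<lambda>n. (L' ^^ n) ((f ^^ n) (f x))) \<longlonglongrightarrow> psi (f x)" .
  have "(\<lambda>n. L ((L' ^^ Suc n) ((f ^^ Suc n) x))) \<longlonglongrightarrow> L (psi x)"
    using LIMSEQ_Suc[OF psi_limit[OF assms]] linear_L unfolding linear_conv_bounded_linear
    by (rule bounded_linear.tendsto[rotated])
  moreover have "L ((L' ^^ Suc n) ((f ^^ Suc n) x)) = (L' ^^ n) ((f ^^ n) (f x))" for n
    unfolding funpow.simps(2)[of n L'] funpow_Suc_right[of n f] by (simp add: L_L')
  ultimately show ?thesis using LIMSEQ_unique[OF 1] by simp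
qed

lemma orbit_0: "(f ^^ n) 0 = 0"
  by (induction n) (auto simp: f_0)

lemma psi_0: "psi 0 = 0"
  using LIMSEQ_unique[OF psi_limit[OF zero_U]]
  by (simp add: orbit_0 linear_0[OF linear_iterates(2)])

text \<open>At the fixed point the iterates have derivative \<open>L ^^ n\<close>, which
  \<open>L' ^^ n\<close> cancels exactly. This normalization makes \<open>psi\<close> locally
  invertible.\<close>

lemma psi_derivative_0: "frechet_derivative psi (at 0) v = v"
proof -
  have "frechet_derivative (f ^^ n) (at 0) v = (L ^^ n) v" for n
  proof (induction n)
    case 0
    show ?case by (simp add: id_def frechet_derivative_eq[OF has_derivative_ident])
  next
    case (Suc n)
    then show ?case
      unfolding frechet_derivative_orbit_Suc[OF zero_U] orbit_0 frechet_derivative_eq[OF Df_0] by simp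
  qed
  then show ?thesis
    using LIMSEQ_unique[OF psi_derivative_limit[OF zero_U, of v]] by (simp add: inverse_iterates)
qed

text \<open>\<open>G\<close> stands for the Finsler function in bundle coordinates. Invariance and
  homogeneity give \<open>G (x, v)\<close> the same value at all points \<open>(f ^^ n) x\<close>
  with vectors \<open>z n\<close>. Over 0 the vectors \<open>z n\<close> and \<open>w n\<close> have
  equal \<open>G\<close>, as \<open>z n\<close> is the rescaled image of \<open>w n\<close> under
  \<open>L ^^ n\<close>, and \<open>w n\<close> converges to the derivative of \<open>psi\<close>.
  The \<open>z n\<close> are merely bounded, so both evaluations are compared along a subsequence on
  which \<open>z\<close> converges.\<close>

lemma homogeneous_pullback:
  fixes G :: "'a \<times> 'a \<Rightarrow> real"
  assumes cont: "continuous_on (W \<times> UNIV) G"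
    and hom: "\<And>x v l. x \<in> U \<Longrightarrow> l \<ge> 0 \<Longrightarrow> G (x, l *\<^sub>R v) = l * G (x, v)"
    and inv: "\<And>x v. x \<in> U \<Longrightarrow> G (f x, frechet_derivative f (at x) v) = \<kappa> * G (x, v)"
    and x: "x \<in> U"
  shows "G (x, v) = G (0, frechet_derivative psi (at x) v)"
proof -
  define w where "w n = (L' ^^ n) (frechet_derivative (f ^^ n) (at x) v)" for n
  define z where "z n = (1 / \<kappa>) ^ n *\<^sub>R frechet_derivative (f ^^ n) (at x) v" for n
  have w: "w \<longlonglongrightarrow> frechet_derivative psi (at x) v"
    unfolding w_def by (rule psi_derivative_limit[OF x])
  have Lw: "(L ^^ n) (w n) = frechet_derivative (f ^^ n) (at x) v" for n
    unfolding w_def by (rule inverse_iterates)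
  have 1: "G ((f ^^ n) x, frechet_derivative (f ^^ n) (at x) v) = \<kappa> ^ n * G (x, v)" for n
  proof (induction n)
    case 0
    show ?case by (simp add: id_def frechet_derivative_eq[OF has_derivative_ident])
  next
    case (Suc n)
    then show ?case
      unfolding frechet_derivative_orbit_Suc[OF x] using inv[OF orbit_U[OF x, of n]] by simp
  qed
  have 2: "G ((f ^^ n) x, z n) = G (x, v)" for n
    unfolding z_def using hom[OF orbit_U[OF x], of "(1 / \<kappa>) ^ n"] 1 lam by (simp add: power_one_over)
  have 3: "G (0, (L ^^ n) u) = \<kappa> ^ n * G (0, u)" for n u
  proof (induction n)
    case (Suc n)
    then show ?case using inv[OF zero_U] by (simp add: f_0 frechet_derivative_eq[OF Df_0])
  qed simp
  have 4: "G (0, z n) = G (0, w n)" for n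
    unfolding z_def using hom[OF zero_U, of "(1 / \<kappa>) ^ n"] 3[of n "w n"] lam by (simp add: Lw power_one_over)
  obtain M where M: "M > 0" "\<And>n. norm (w n) \<le> M"
    using convergent_imp_Bseq[OF convergentI[OF w]] by (auto simp: Bseq_def)
  have "norm (z n) \<le> C * M" for n
  proof -
    have "norm (z n) \<le> (1 / \<kappa>) ^ n * (C * \<kappa> ^ n * norm (w n))"
      unfolding z_def norm_scaleR using L_bound[of n "w n"] lam
      by (intro mult_mono) (auto simp: Lw)
    also have "\<dots> = C * norm (w n)" using lam by (simp add: power_one_over)
    also have "\<dots> \<le> C * M" using M(2) C_nonneg by (intro mult_left_mono) auto
    finally show ?thesis .
  qed
  then have "bounded (range z)" by (auto simp: bounded_iff)
  from bounded_imp_convergent_subsequence[OF this]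
  obtain l r where r: "strict_mono r" "(z \<circ> r) \<longlonglongrightarrow> l" by auto
  have G: "isCont G (0, u)" for u
    using cont zero_U UW open_W continuous_on_eq_continuous_at[of "W \<times> UNIV" G]
    by (auto simp: open_Times)
  have orb: "(\<lambda>n. (f ^^ r n) x) \<longlonglongrightarrow> 0"
    using LIMSEQ_subseq_LIMSEQ[OF orbit_tendsto_0[OF x] r(1)] by (simp add: o_def)
  have "(\<lambda>n. G ((f ^^ r n) x, (z \<circ> r) n)) \<longlonglongrightarrow> G (0, l)"
    by (rule isCont_tendsto_compose[OF G tendsto_Pair[OF orb r(2)]])
  then have "(\<lambda>n. G (x, v)) \<longlonglongrightarrow> G (0, l)" by (simp add: 2)
  then have xl: "G (x, v) = G (0, l)" by (simp add: LIMSEQ_const_iff)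
  have "(\<lambda>n. G (0, (z \<circ> r) n)) \<longlonglongrightarrow> G (0, l)"
    by (rule isCont_tendsto_compose[OF G tendsto_Pair[OF tendsto_const r(2)]])
  then have "(\<lambda>n. G (0, (w \<circ> r) n)) \<longlonglongrightarrow> G (0, l)" by (simp add: 4)
  moreover have "(\<lambda>n. G (0, (w \<circ> r) n)) \<longlonglongrightarrow> G (0, frechet_derivative psi (at x) v)"
    by (rule isCont_tendsto_compose[OF G tendsto_Pair[OF tendsto_const LIMSEQ_subseq_LIMSEQ[OF w r(1)]]])
  ultimately show ?thesis using xl LIMSEQ_unique by metis
qed

end

section \<open>Smoothness of inverse functions\<close>

text \<open>In finite dimension convergence on a basis is convergence in operator norm;
  \<open>e\<close> is shared equally among the basis vectors.\<close>

lemma eventually_linear_family_close: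
  fixes A :: "'a::topological_space \<Rightarrow> 'b::euclidean_space \<Rightarrow> 'c::real_normed_vector"
  assumes "\<And>b. b \<in> Basis \<Longrightarrow> ((\<lambda>y. A y b) \<longlongrightarrow> T b) F"
    "\<forall>\<^sub>F y in F. linear (A y)" "linear T" "e > 0"
  shows "\<forall>\<^sub>F y in F. \<forall>v. norm (A y v - T v) \<le> e * norm v"
proof -
  let ?n = "real (DIM('b))"
  have n: "?n > 0" by simp
  have "\<forall>\<^sub>F y in F. norm (A y b - T b) < e / ?n" if "b \<in> Basis" for b
    using tendstoD[OF assms(1)[OF that], of "e / ?n"] assms(4) n by (simp add: dist_norm)
  then have "\<forall>\<^sub>F y in F. \<forall>b\<in>Basis. norm (A y b - T b) < e / ?n"
    by (simp add: eventually_ball_finite)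
  with assms(2) show ?thesis
  proof eventually_elim
    case (elim y)
    have "linear (\<lambda>v. A y v - T v)" using elim(1) assms(3) by (rule linear_compose_sub)
    then have "norm (A y v - T v) \<le> (\<Sum>b\<in>(Basis::'b set). e / ?n) * norm v" for v
      by (rule norm_linear_Basis_bound) (use elim(2) in \<open>auto intro: less_imp_le\<close>)
    then show ?case by simp
  qed
qed

text \<open>Stands for the smoothness of matrix inversion, without matrices or determinants.
  Everything rests on the resolvent identity \<open>inverse_difference\<close>.\<close>

locale inverse_families =
  fixes V :: "'a::euclidean_space set" and A I :: "'a \<Rightarrow> 'b::euclidean_space \<Rightarrow> 'b"
  assumes open_V: "open V"
    and linear_A: "y \<in> V \<Longrightarrow> linear (A y)" and linear_I: "y \<in> V \<Longrightarrow> linear (I y)"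
    and A_I: "y \<in> V \<Longrightarrow> A y (I y v) = v" and I_A: "y \<in> V \<Longrightarrow> I y (A y v) = v"
begin

lemma eventually_V: "x \<in> V \<Longrightarrow> \<forall>\<^sub>F y in at x. y \<in> V"
  using open_V by (simp add: eventually_at_in_open')

lemma inverse_locally_bounded:
  assumes "\<And>v. continuous_on V (\<lambda>y. A y v)" "x \<in> V"
  shows "\<exists>M. M > 0 \<and> (\<forall>\<^sub>F y in at x. \<forall>v. norm (I y v) \<le> M * norm v)"
proof -
  obtain m where m: "m > 0" "\<And>v. norm (I x v) \<le> m * norm v"
    using linear_bounded_pos[OF linear_I[OF assms(2)]] by blast
  have "((\<lambda>y. A y b) \<longlongrightarrow> A x b) (at x)" for b
    using assms open_V by (simp add: continuous_on_eq_continuous_at isCont_def)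
  \<comment> \<open>\<open>A x\<close> expands norms by at least the factor 1/m. A perturbation by
    half of that leaves the lower bound 1/(2m) for \<open>A y\<close>, hence the bound
    \<open>2 * m\<close> for \<open>I y\<close>.\<close>
  then have "\<forall>\<^sub>F y in at x. \<forall>v. norm (A y v - A x v) \<le> 1 / (2 * m) * norm v"
    using m(1) linear_A assms(2)
    by (intro eventually_linear_family_close eventually_mono[OF eventually_V[OF assms(2)]]) auto
  with eventually_V[OF assms(2)] have "\<forall>\<^sub>F y in at x. \<forall>v. norm (I y v) \<le> (2 * m) * norm v"
  proof eventually_elim
    case (elim y)
    show ?case
    proof
      fix v
      let ?u = "I y v"
      have "norm ?u = norm (I x (A x ?u))" by (simp add: I_A[OF assms(2)])
      also have "\<dots> \<le> m * norm (A x ?u)" by (rule m)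
      also have "norm (A x ?u) \<le> norm (A y ?u) + norm (A y ?u - A x ?u)"
        by (metis add.commute norm_minus_commute norm_triangle_sub)
      also have "\<dots> \<le> norm v + 1 / (2 * m) * norm ?u"
        using elim(2)[rule_format, of ?u] elim(1) by (simp add: A_I)
      finally have "norm ?u \<le> m * (norm v + 1 / (2 * m) * norm ?u)" using m(1) by simp
      also have "\<dots> = m * norm v + norm ?u / 2" using m(1) by (simp add: field_simps)
      finally show "norm ?u \<le> 2 * m * norm v" by simp
    qed
  qed
  then show ?thesis using m(1) by (intro exI[of _ "2 * m"]) simp
qed

lemma inverse_difference:
  assumes "x \<in> V" "y \<in> V"
  shows "I y v - I x v = - I y (A y (I x v) - A x (I x v))"
  using assms by (simp add: linear_diff[OF linear_I] A_I I_A)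

lemma inverse_continuous:
  assumes "\<And>v. continuous_on V (\<lambda>y. A y v)"
  shows "continuous_on V (\<lambda>y. I y v)"
proof (rule continuous_at_imp_continuous_on, rule ballI)
  fix x assume x: "x \<in> V"
  obtain M where M: "M > 0" "\<forall>\<^sub>F y in at x. \<forall>v. norm (I y v) \<le> M * norm v"
    using inverse_locally_bounded[OF assms x] by blast
  have A: "((\<lambda>y. A y b) \<longlongrightarrow> A x b) (at x)" for b
    using assms x open_V by (simp add: continuous_on_eq_continuous_at isCont_def)
  have "((\<lambda>y. I y v - I x v) \<longlongrightarrow> 0) (at x)"
  proof (rule Lim_null_comparison)
    show "\<forall>\<^sub>F y in at x. norm (I y v - I x v) \<le> M * norm (A y (I x v) - A x (I x v))"
      using M(2) eventually_V[OF x]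
      by eventually_elim (simp add: inverse_difference[OF x])
    show "((\<lambda>y. M * norm (A y (I x v) - A x (I x v))) \<longlongrightarrow> 0) (at x)"
      using A by (intro tendsto_mult_right_zero tendsto_norm_zero) (simp add: LIM_zero_iff)
  qed
  then show "continuous (at x) (\<lambda>y. I y v)"
    by (simp add: isCont_def LIM_zero_iff)
qed

text \<open>The derivative of the inverse is - I D I. By the resolvent identity the error splits
  into two terms: \<open>I y\<close> applied to the differentiation error of \<open>A\<close> at the
  fixed vector \<open>I x v\<close>, and \<open>I y - I x\<close> applied to
  \<open>D (y - x)\<close>. The first is small because \<open>I\<close> is locally bounded, the
  second because \<open>I\<close> is continuous on each basis vector.\<close>

lemma inverse_has_derivative:
  assumes "\<And>v. continuous_on V (\<lambda>y. A y v)" "x \<in> V"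
    "((\<lambda>y. A y (I x v)) has_derivative D) (at x)"
  shows "((\<lambda>y. I y v) has_derivative (\<lambda>u. - I x (D u))) (at x)"
  unfolding has_derivative_iff_norm
proof
  have bl: "bounded_linear (I x)" using linear_I[OF assms(2)] by (simp add: linear_conv_bounded_linear)
  have D: "bounded_linear D" using assms(3) by (rule has_derivative_bounded_linear)
  show "bounded_linear (\<lambda>u. - I x (D u))"
    by (intro bounded_linear_minus bounded_linear_compose[OF bl D])
  obtain M where M: "M > 0" "\<forall>\<^sub>F y in at x. \<forall>v. norm (I y v) \<le> M * norm v"
    using inverse_locally_bounded[OF assms(1,2)] by blast
  obtain K where K: "K > 0" "\<And>u. norm (D u) \<le> norm u * K"
    using bounded_linear.pos_bounded[OF D] by blast
  let ?r = "\<lambda>y. norm (A y (I x v) - A x (I x v) - D (y - x)) / norm (y - x)"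
  let ?s = "\<lambda>y. \<Sum>b\<in>Basis. norm (I y b - I x b)"
  show "((\<lambda>y. norm (I y v - I x v - - I x (D (y - x))) / norm (y - x)) \<longlongrightarrow> 0) (at x)"
  proof (rule Lim_null_comparison)
    show "((\<lambda>y. M * ?r y + ?s y * K) \<longlongrightarrow> 0) (at x)"
    proof (intro tendsto_add_zero tendsto_mult_right_zero tendsto_mult_left_zero)
      show "(?r \<longlongrightarrow> 0) (at x)" using assms(3) by (simp add: has_derivative_iff_norm)
      have "((\<lambda>y. norm (I y b - I x b)) \<longlongrightarrow> 0) (at x)" for b
        using inverse_continuous[OF assms(1)] assms(2) open_V
        by (intro tendsto_norm_zero) (simp add: LIM_zero_iff continuous_on_eq_continuous_at isCont_def)
      then show "(?s \<longlongrightarrow> 0) (at x)" by (intro tendsto_null_sum)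
    qed
    have "\<forall>\<^sub>F y in at x. y \<noteq> x" by (simp add: eventually_at_filter)
    with M(2) eventually_V[OF assms(2)]
    show "\<forall>\<^sub>F y in at x. norm (norm (I y v - I x v - - I x (D (y - x))) / norm (y - x)) \<le> M * ?r y + ?s y * K"
    proof eventually_elim
      case (elim y)
      let ?z = "A y (I x v) - A x (I x v) - D (y - x)"
      have pos: "norm (y - x) > 0" using elim by simp
      have "I y v - I x v - - I x (D (y - x)) = - I y ?z - (I y (D (y - x)) - I x (D (y - x)))"
        using inverse_difference[OF assms(2) elim(2), of v]
        by (simp add: linear_diff[OF linear_I[OF elim(2)]])
      then have "norm (I y v - I x v - - I x (D (y - x)))
          \<le> norm (I y ?z) + norm (I y (D (y - x)) - I x (D (y - x)))"
        by (metis norm_minus_cancel norm_triangle_ineq4)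
      also have "\<dots> \<le> M * norm ?z + ?s y * (norm (y - x) * K)"
      proof (intro add_mono)
        show "norm (I y ?z) \<le> M * norm ?z" using elim(1) by blast
        have "norm (I y (D (y - x)) - I x (D (y - x))) \<le> ?s y * norm (D (y - x))"
          by (rule norm_linear_Basis_bound[OF linear_compose_sub[OF linear_I[OF elim(2)] linear_I[OF assms(2)]]]) simp
        also have "\<dots> \<le> ?s y * (norm (y - x) * K)"
          using K(2) by (intro mult_left_mono sum_nonneg) auto
        finally show "norm (I y (D (y - x)) - I x (D (y - x))) \<le> ?s y * (norm (y - x) * K)" .
      qed
      finally show ?case using pos by (simp add: field_simps)
    qed
  qed
qed

text \<open>The derivative of \<open>I\<close> is a polynomial expression in \<open>I\<close> and
  the derivatives of \<open>A\<close>, so each order of regularity of \<open>I\<close> yields the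
  next. The double expansion \<open>?E\<close> keeps all arguments of \<open>I\<close> and of the
  derivatives of \<open>A\<close> fixed.\<close>

lemma inverse_Ck_on:
  assumes "\<And>v. Ck_on k V (\<lambda>y. A y v)"
  shows "Ck_on k V (\<lambda>y. I y v)"
  using assms
proof (induction k arbitrary: v)
  case 0
  then show ?case using inverse_continuous by simp
next
  case (Suc k)
  have cont: "continuous_on V (\<lambda>y. A y v)" for v
    by (rule Ck_on_imp_continuous_on[OF Suc.prems])
  have I: "Ck_on k V (\<lambda>y. I y v)" for v
    by (rule Suc.IH[OF Ck_on_Suc_lower[OF Suc.prems]])
  let ?D = "\<lambda>b y u. frechet_derivative (\<lambda>y. A y b) (at y) u"
  let ?E = "\<lambda>y u. \<Sum>b\<in>Basis. (I y v \<bullet> b) *\<^sub>R (\<Sum>c\<in>Basis. (?D b y u \<bullet> c) *\<^sub>R I y c)"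
  show ?case
  proof (rule Ck_on_SucI[OF open_V])
    fix x assume x: "x \<in> V"
    have "((\<lambda>y. \<Sum>b\<in>Basis. (I x v \<bullet> b) *\<^sub>R A y b) has_derivative
        (\<lambda>u. \<Sum>b\<in>Basis. (I x v \<bullet> b) *\<^sub>R ?D b x u)) (at x)"
      by (intro has_derivative_sum has_derivative_scaleR_right Ck_on_has_derivative[OF Suc.prems x])
    then have "((\<lambda>y. A y (I x v)) has_derivative (\<lambda>u. \<Sum>b\<in>Basis. (I x v \<bullet> b) *\<^sub>R ?D b x u)) (at x)"
      by (rule has_derivative_transform_within_open[OF _ open_V x])
        (rule linear_euclidean_sum[OF linear_A, symmetric])
    from inverse_has_derivative[OF cont x this]
    have "((\<lambda>y. I y v) has_derivative (\<lambda>u. - I x (\<Sum>b\<in>Basis. (I x v \<bullet> b) *\<^sub>R ?D b x u))) (at x)" .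
    moreover have "I x (\<Sum>b\<in>Basis. (I x v \<bullet> b) *\<^sub>R ?D b x u) = ?E x u" for u
      unfolding linear_sum[OF linear_I[OF x]] linear_scale[OF linear_I[OF x]]
      by (intro sum.cong refl arg_cong2[where f=scaleR] linear_euclidean_sum linear_I x)
    ultimately show "((\<lambda>y. I y v) has_derivative (\<lambda>u. - ?E x u)) (at x)" by simp
  next
    fix u
    show "Ck_on k V (\<lambda>y. - ?E y u)"
      using Suc.prems
      by (intro Ck_on_bounded_linear[OF open_V bounded_linear_minus[OF bounded_linear_ident]]
          Ck_on_sum[OF open_V] Ck_on_scaleR[OF open_V] I
          Ck_on_bounded_linear[OF open_V bounded_linear_inner_left]) auto
  qed
qed

end

text \<open>The inverse function theorem gives a differentiable \<open>g\<close> whose derivative at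
  \<open>y\<close> inverts that of \<open>f\<close> at \<open>g y\<close>. If \<open>g\<close> is of
  class C^k, so is the latter family, hence also its inverse, and \<open>g\<close> is of class
  C^(k+1).\<close>

lemma smooth_inverse_function:
  fixes f :: "'a::euclidean_space \<Rightarrow> 'a"
  assumes "open U" "smooth_on U f" "x \<in> U" "\<And>v. frechet_derivative f (at x) v = v"
  shows "\<exists>U' V g. open U' \<and> U' \<subseteq> U \<and> x \<in> U' \<and> open V \<and> f x \<in> V \<and> homeomorphism U' V f g \<and> smooth_on V g"
proof -
  let ?D = "\<lambda>x. Blinfun (frechet_derivative f (at x))"
  have bl: "bounded_linear (frechet_derivative f (at x))" if "x \<in> U" for x
    using smooth_on_has_derivative[OF assms(2) that] by (rule has_derivative_bounded_linear)
  have app: "blinfun_apply (?D x) = frechet_derivative f (at x)" if "x \<in> U" for x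
    using bounded_linear_Blinfun_apply[OF bl[OF that]] .
  have "continuous_on U ?D"
  proof (rule continuous_on_blinfun_componentwise)
    fix b :: 'a
    have "continuous_on U (\<lambda>x. frechet_derivative f (at x) b)"
      by (rule smooth_on_continuous_on[OF smooth_on_frechet_derivative[OF assms(2)]])
    then show "continuous_on U (\<lambda>x. ?D x b)"
      by (rule continuous_on_eq) (simp add: app)
  qed
  moreover have "(f has_derivative ?D x) (at x)" if "x \<in> U" for x
    unfolding app[OF that] by (rule smooth_on_has_derivative[OF assms(2) that])
  moreover have "id_blinfun o\<^sub>L ?D x = id_blinfun"
    by (rule blinfun_eqI) (simp add: app[OF assms(3)] assms(4))
  ultimately obtain U' V g g' where g: "open U'" "U' \<subseteq> U" "x \<in> U'" "open V" "f x \<in> V"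
    "homeomorphism U' V f g" "\<And>y. y \<in> V \<Longrightarrow> (g has_derivative g' y) (at y)"
    "\<And>y. y \<in> V \<Longrightarrow> g' y = inv (?D (g y))" "\<And>y. y \<in> V \<Longrightarrow> bij (?D (g y))"
    using inverse_function_theorem[OF assms(1) _ _ assms(3), of f ?D id_blinfun] by metis
  have gU: "g y \<in> U" if "y \<in> V" for y
    using g(2,6) that unfolding homeomorphism_def by blast
  let ?A = "\<lambda>y. frechet_derivative f (at (g y))"
  have g': "g' y = inv (?A y)" "bij (?A y)" if "y \<in> V" for y
    using g(8,9)[OF that] app[OF gU[OF that]] by simp_all
  interpret inverse_families V ?A g'
  proof (rule inverse_families.intro)
    fix y and v :: 'a assume y: "y \<in> V"
    show "linear (?A y)" using bl[OF gU[OF y]] by (rule bounded_linear.linear)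
    show "linear (g' y)" using g(7)[OF y] by (rule has_derivative_linear)
    show "?A y (g' y v) = v" using g'[OF y] by (simp add: bij_is_surj surj_f_inv_f)
    show "g' y (?A y v) = v" using g'[OF y] by (simp add: bij_is_inj inv_f_f)
  qed (rule g)
  have "Ck_on k V g" for k
  proof (induction k)
    case 0
    then show ?case using g(6) by (simp add: homeomorphism_def)
  next
    case (Suc k)
    have "Ck_on k V (\<lambda>y. frechet_derivative f (at (g y)) v)" for v
      using Ck_on_compose[OF g(4) assms(1) _ Suc, of "\<lambda>x. frechet_derivative f (at x) v"]
        smooth_on_frechet_derivative[OF assms(2), of v] gU
      by (auto simp: smooth_on_def o_def)
    then show ?case by (intro Ck_on_SucI[OF g(4) g(7)] inverse_Ck_on)
  qed
  then show ?thesis using g by (intro exI[of _ U'] exI[of _ V] exI[of _ g]) (simp add: smooth_on_def)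
qed

section \<open>Adapted norms\<close>

text \<open>\<open>N v\<close> is the sum over n < m of \<mu>^(-n) times the norm of
  \<open>(L ^^ n) v\<close>. Applying \<open>L\<close> shifts this sum: up to the factor
  \<open>\<mu>\<close> it loses the term \<open>norm v\<close> and gains the term of index
  \<open>m\<close>, which is no larger once \<open>m\<close> is large enough.\<close>

lemma adapted_norm_exists:
  fixes L :: "'a::euclidean_space \<Rightarrow> 'a"
  assumes L: "linear L" and bd: "\<And>n v. norm ((L ^^ n) v) \<le> C * \<kappa> ^ n * norm v"
    and C: "C \<ge> 0" and k: "0 < \<kappa>" "\<kappa> < \<mu>"
  shows "\<exists>N B. (\<forall>v. norm v \<le> N v) \<and> (\<forall>v. N v \<le> B * norm v) \<and> (\<forall>v w. N (v + w) \<le> N v + N w) \<and>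
     (\<forall>a v. N (a *\<^sub>R v) = \<bar>a\<bar> * N v) \<and> (\<forall>v. N (L v) \<le> \<mu> * N v)"
proof -
  have mu: "\<mu> > 0" using k by simp
  have "(\<lambda>n. C * (\<kappa> / \<mu>) ^ n) \<longlonglongrightarrow> 0"
    using k mu by (intro tendsto_mult_right_zero LIMSEQ_power_zero) auto
  then have "\<forall>\<^sub>F n in sequentially. C * (\<kappa> / \<mu>) ^ n < 1 \<and> 0 < n"
    by (intro eventually_conj eventually_gt_at_top order_tendstoD(2)) auto
  \<comment> \<open>The first condition makes the term of index \<open>m\<close> at most
    \<open>norm v\<close>; \<open>0 < m\<close> keeps the summand \<open>norm v\<close> in
    \<open>N v\<close>.\<close>
  then obtain m where m: "C * (\<kappa> / \<mu>) ^ m < 1" "0 < m"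
    by (auto simp: eventually_sequentially)
  define a where "a n v = (1 / \<mu>) ^ n * norm ((L ^^ n) v)" for n v
  define N where "N v = (\<Sum>n<m. a n v)" for v
  have lin: "linear (L ^^ n)" for n by (rule linear_funpow[OF L])
  have a0: "a 0 v = norm v" for v by (simp add: a_def)
  have apos: "a n v \<ge> 0" for n v using mu by (simp add: a_def)
  have 1: "norm v \<le> N v" for v
    unfolding N_def a0[symmetric] using m(2) apos by (intro member_le_sum) auto
  have am: "a m v \<le> norm v" for v
  proof -
    have "a m v \<le> (1 / \<mu>) ^ m * (C * \<kappa> ^ m * norm v)"
      unfolding a_def using mu bd by (intro mult_left_mono) auto
    also have "\<dots> = (C * (\<kappa> / \<mu>) ^ m) * norm v" by (simp add: power_divide)
    also have "\<dots> \<le> 1 * norm v" using m(1) by (intro mult_right_mono) auto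
    finally show ?thesis by simp
  qed
  have 2: "N v \<le> (\<Sum>n<m. (1 / \<mu>) ^ n * (C * \<kappa> ^ n)) * norm v" for v
    unfolding N_def a_def sum_distrib_right
    using bd mu by (intro sum_mono) (simp add: mult.assoc mult_left_mono)
  have 3: "N (v + w) \<le> N v + N w" for v w
    unfolding N_def a_def sum.distrib[symmetric] distrib_left[symmetric] linear_add[OF lin]
    using mu by (intro sum_mono mult_left_mono norm_triangle_ineq) auto
  have 4: "N (c *\<^sub>R v) = \<bar>c\<bar> * N v" for c v
    unfolding N_def a_def linear_scale[OF lin] by (simp add: sum_distrib_left algebra_simps)
  have 5: "N (L v) \<le> \<mu> * N v" for v
  proof -
    have "N (L v) = (\<Sum>n<m. \<mu> * a (Suc n) v)"
      unfolding N_def a_def using mu by (intro sum.cong) (auto simp: funpow_swap1)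
    also have "\<dots> = \<mu> * (N v + a m v - a 0 v)"
      using sum.lessThan_Suc_shift[of "\<lambda>n. a n v" m] by (simp add: N_def sum_distrib_left[symmetric])
    also have "\<dots> \<le> \<mu> * N v"
      using am[of v] mu by (intro mult_left_mono) (auto simp: a0)
    finally show ?thesis .
  qed
  show ?thesis using 1 2 3 4 5 by blast
qed

text \<open>Two rates are used: \<open>L\<close> contracts \<open>N\<close> by
  \<open>\<mu>0\<close>, and the gap up to \<open>\<mu>\<close> absorbs the deviation of
  \<open>f\<close> and of its derivative from \<open>L\<close> near 0.\<close>

lemma conformal_contraction_exists:
  fixes f :: "'a::euclidean_space \<Rightarrow> 'a"
  assumes W: "open W" "0 \<in> W" and f: "smooth_on W f" "f 0 = 0" "(f has_derivative L) (at 0)"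
    and L': "linear L'" "\<And>v. L' (L v) = v" "\<And>v. L (L' v) = v"
    and k: "0 < \<kappa>" "\<kappa> < 1" and C: "C \<ge> 0"
    and bd: "\<And>n v. norm ((L ^^ n) v) \<le> C * \<kappa> ^ n * norm v"
      "\<And>n v. norm ((L' ^^ n) v) \<le> C * (1 / \<kappa>) ^ n * norm v"
  shows "\<exists>U K N \<mu> B. conformal_contraction f U W K N \<mu> B L L' \<kappa> C"
proof -
  have "\<kappa>\<^sup>2 < \<kappa>" using k by (simp add: power2_eq_square)
  then have "\<kappa> < sqrt \<kappa>" by (rule real_less_rsqrt)
  \<comment> \<open>The upper bound ensures \<mu>^2 < \<kappa>, as the series of corrections
    requires; the lower bound leaves space for \<open>\<mu>0\<close>.\<close>
  then obtain \<mu> where mu: "\<kappa> < \<mu>" "\<mu> < sqrt \<kappa>" using dense by blast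
  obtain \<mu>0 where mu0: "\<kappa> < \<mu>0" "\<mu>0 < \<mu>" using dense[OF mu(1)] by blast
  have mu2: "\<mu>\<^sup>2 < \<kappa>" using power_strict_mono[OF mu(2), of 2] mu k by simp
  have "sqrt \<kappa> < 1" using k by simp
  then have mu1: "0 < \<mu>" "\<mu> < 1" using mu k by linarith+
  have L: "linear L" using f(3) by (rule has_derivative_linear)
  obtain N B where N: "\<And>v. norm v \<le> N v" "\<And>v. N v \<le> B * norm v" "\<And>v w. N (v + w) \<le> N v + N w"
    "\<And>a v. N (a *\<^sub>R v) = \<bar>a\<bar> * N v" "\<And>v. N (L v) \<le> \<mu>0 * N v"
    using adapted_norm_exists[OF L bd(1) C k(1) mu0(1)] by blast
  obtain b :: 'a where b: "b \<in> Basis" using nonempty_Basis by blast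
  have B1: "B \<ge> 1" using N(1)[of b] N(2)[of b] b by simp
  \<comment> \<open>The gap between the rates, divided by \<open>B\<close> because errors are
    measured in the Euclidean norm and have to be converted to \<open>N\<close>.\<close>
  define e where "e = (\<mu> - \<mu>0) / B"
  have e: "e > 0" "B * e = \<mu> - \<mu>0" unfolding e_def using B1 mu0 by auto
  have "((\<lambda>x. frechet_derivative f (at x) v) \<longlongrightarrow> frechet_derivative f (at 0) v) (nhds 0)" for v
    using smooth_on_continuous_on[OF smooth_on_frechet_derivative[OF f(1), of v]] W
    unfolding tendsto_at_iff_tendsto_nhds[of "\<lambda>x. frechet_derivative f (at x) v" 0, symmetric]
    by (simp add: continuous_on_eq_continuous_at isCont_def)
  then have "((\<lambda>x. frechet_derivative f (at x) v) \<longlongrightarrow> L v) (nhds 0)" for v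
    unfolding frechet_derivative_eq[OF f(3)] .
  moreover have evW: "\<forall>\<^sub>F x in nhds 0. x \<in> W" using W by (rule eventually_nhds_in_open)
  moreover have "linear (frechet_derivative f (at x))" if "x \<in> W" for x
    using smooth_on_has_derivative[OF f(1) that] by (rule has_derivative_linear)
  ultimately have "\<forall>\<^sub>F x in nhds 0. \<forall>v. norm (frechet_derivative f (at x) v - L v) \<le> e * norm v"
    using L e(1) by (intro eventually_linear_family_close eventually_mono[OF evW]) auto
  with evW have "\<forall>\<^sub>F x in nhds 0. x \<in> W \<and> (\<forall>v. norm (frechet_derivative f (at x) v - L v) \<le> e * norm v)"
    by (rule eventually_conj)
  then obtain d0 where d0: "d0 > 0" "\<And>x. dist x 0 < d0 \<Longrightarrow> x \<in> W"
    "\<And>x v. dist x 0 < d0 \<Longrightarrow> norm (frechet_derivative f (at x) v - L v) \<le> e * norm v"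
    unfolding eventually_nhds_metric by blast
  \<comment> \<open>Half the radius, so that the closed ball, which serves as the compact set
    \<open>K\<close>, still satisfies the estimates.\<close>
  define d where "d = d0 / 2"
  have d: "d > 0" "\<And>x. x \<in> cball 0 d \<Longrightarrow> x \<in> W"
    "\<And>x v. x \<in> cball 0 d \<Longrightarrow> norm (frechet_derivative f (at x) v - L v) \<le> e * norm v"
    using d0 by (auto simp: d_def)
  \<comment> \<open>A ball of \<open>N\<close> and not a Euclidean one: only \<open>N\<close> is
    known to decrease under \<open>f\<close>, which makes \<open>U\<close> invariant.\<close>
  define U where "U = {x. N x < d}"
  have N0: "N 0 = 0" using N(1)[of 0] N(2)[of 0] by simp
  have UK: "U \<subseteq> cball 0 d" unfolding U_def by (auto intro!: less_imp_le[OF le_less_trans[OF N(1)]])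
  have Bv: "N v \<le> (\<mu> - \<mu>0) * norm w" if "norm v \<le> e * norm w" for v w
  proof -
    have "N v \<le> B * (e * norm w)" using N(2)[of v] mult_left_mono[OF that, of B] B1 by linarith
    then show ?thesis by (simp add: e(2) flip: mult.assoc)
  qed
  have step: "N z \<le> \<mu> * N v" if "norm (z - L v) \<le> e * norm v" for z v
  proof -
    have "N z \<le> N (L v) + N (z - L v)" using N(3)[of "L v" "z - L v"] by simp
    also have "\<dots> \<le> \<mu>0 * N v + (\<mu> - \<mu>0) * N v"
      using N(5)[of v] Bv[OF that] mult_left_mono[OF N(1)[of v], of "\<mu> - \<mu>0"] mu0 by linarith
    finally show ?thesis by (simp add: algebra_simps)
  qed
  have Df: "N (frechet_derivative f (at x) v) \<le> \<mu> * N v" if "x \<in> cball 0 d" for x v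
    using step d(3)[OF that] .
  have fN: "N (f x) \<le> \<mu> * N x" if "x \<in> cball 0 d" for x
  proof (rule step)
    show "norm (f x - L x) \<le> e * norm x"
    proof (rule has_derivative_seg_bound[OF convex_cball _ _ _ _ that])
      show "((\<lambda>x. f x - L x) has_derivative (\<lambda>v. frechet_derivative f (at y) v - L v)) (at y)"
        if "y \<in> cball 0 d" for y
        using L unfolding linear_conv_bounded_linear
        by (intro has_derivative_diff smooth_on_has_derivative[OF f(1)] d(2) that bounded_linear_imp_has_derivative)
    qed (use d f(2) linear_0[OF L] in auto)
  qed
  have contN: "continuous_on UNIV N"
  proof (rule continuous_at_imp_continuous_on, rule ballI)
    fix x
    have "((\<lambda>y. N y - N x) \<longlongrightarrow> 0) (at x)"
    proof (rule Lim_null_comparison)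
      show "\<forall>\<^sub>F y in at x. norm (N y - N x) \<le> B * norm (y - x)"
      proof (rule always_eventually, rule allI)
        fix y
        have "N (x - y) = N (y - x)" using N(4)[of "-1" "y - x"] by simp
        then show "norm (N y - N x) \<le> B * norm (y - x)"
          using N(3)[of x "y - x"] N(3)[of y "x - y"] N(2)[of "y - x"] by simp
      qed
      show "((\<lambda>y. B * norm (y - x)) \<longlongrightarrow> 0) (at x)"
        by (intro tendsto_mult_right_zero tendsto_norm_zero) (simp add: LIM_zero_iff)
    qed
    then show "continuous (at x) N" by (simp add: isCont_def LIM_zero_iff)
  qed
  have "conformal_contraction f U W (cball 0 d) N \<mu> B L L' \<kappa> C"
  proof
    show "open U" unfolding U_def using contN by (intro open_Collect_less continuous_on_const) auto
    show "convex U"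
      unfolding convex_def U_def
    proof (intro ballI allI impI CollectI, elim CollectE)
      fix x y and u v :: real
      assume a: "N x < d" "N y < d" "0 \<le> u" "0 \<le> v" "u + v = 1"
      have "N (u *\<^sub>R x + v *\<^sub>R y) \<le> u * N x + v * N y"
        using N(3)[of "u *\<^sub>R x" "v *\<^sub>R y"] a by (simp add: N(4))
      also have "\<dots> < d" using a by (intro convex_bound_lt) auto
      finally show "N (u *\<^sub>R x + v *\<^sub>R y) < d" .
    qed
    show "0 \<in> U" using d(1) N0 by (simp add: U_def)
    show "f ` U \<subseteq> U"
    proof clarify
      fix x assume x: "x \<in> U"
      have "N (f x) \<le> \<mu> * N x" using fN UK x by blast
      also have "\<dots> \<le> 1 * N x" using mu1 order_trans[OF norm_ge_zero N(1)] by (intro mult_right_mono) auto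
      finally show "f x \<in> U" using x by (simp add: U_def)
    qed
  qed (use UK d W f L' k C bd mu1 mu2 N Df fN linear_add[OF L'(1)] linear_scale[OF L'(1)] in auto)
  then show ?thesis by blast
qed

section \<open>Smooth maps between manifolds\<close>

abbreviation (input) vec_atlas :: "('e::euclidean_space, 'e) chart set" where
  "vec_atlas \<equiv> vector_space_atlas"

section \<open>Charts and atlases\<close>

lemma chart_inv_left: "is_chart c \<Longrightarrow> p \<in> fst c \<Longrightarrow> chart_inv c (snd c p) = p"
  unfolding is_chart_def homeomorphism_def by blast

lemma chart_inv_right: "is_chart c \<Longrightarrow> x \<in> snd c ` fst c \<Longrightarrow> snd c (chart_inv c x) = x"
  unfolding is_chart_def homeomorphism_def by blast

lemma chart_inv_in: "is_chart c \<Longrightarrow> x \<in> snd c ` fst c \<Longrightarrow> chart_inv c x \<in> fst c"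
  unfolding is_chart_def homeomorphism_def by blast

lemma chart_open: "is_chart c \<Longrightarrow> open (fst c)" "is_chart c \<Longrightarrow> open (snd c ` fst c)"
  unfolding is_chart_def by blast+

lemma chart_continuous:
  "is_chart c \<Longrightarrow> continuous_on (fst c) (snd c)"
  "is_chart c \<Longrightarrow> continuous_on (snd c ` fst c) (chart_inv c)"
  unfolding is_chart_def homeomorphism_def by blast+

lemma chart_open_image:
  assumes "is_chart c" "open W" "W \<subseteq> fst c"
  shows "open (snd c ` W)"
proof -
  have "openin (top_of_set (snd c ` fst c)) (snd c ` W)"
    using assms unfolding is_chart_def
    by (intro homeomorphism_imp_open_map[where T="snd c ` fst c"]) (auto simp: openin_open_eq)
  then show ?thesis using chart_open(2)[OF assms(1)] by (simp add: openin_open_eq)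
qed

lemma smooth_atlas_chart: "smooth_atlas A \<Longrightarrow> c \<in> A \<Longrightarrow> is_chart c"
  unfolding smooth_atlas_def by blast

lemma chart_at:
  assumes "smooth_atlas A"
  shows "chart_at A p \<in> A" "p \<in> fst (chart_at A p)"
proof -
  have "\<exists>c. c \<in> A \<and> p \<in> fst c" using assms unfolding smooth_atlas_def by blast
  from someI_ex[OF this] show "chart_at A p \<in> A" "p \<in> fst (chart_at A p)"
    unfolding chart_at_def by blast+
qed

lemma chart_inv_vec: "chart_inv (UNIV, id) = id"
  by (simp add: chart_inv_def fun_eq_iff)

lemma smooth_atlas_vec: "smooth_atlas (vec_atlas :: ('e::euclidean_space, 'e) chart set)"
proof -
  have "smooth_on UNIV (id :: 'e \<Rightarrow> 'e)"
    unfolding id_def by (rule smooth_on_linear[OF open_UNIV bounded_linear_ident])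
  then show ?thesis
    by (simp add: smooth_atlas_def vector_space_atlas_def is_chart_def homeomorphism_def chart_inv_vec
        continuous_on_id')
qed

section \<open>Smooth maps: locality, composition, charts\<close>

lemma smooth_map_on_domain_open:
  assumes "smooth_atlas A" "smooth_atlas B" "open S" "smooth_map_on A B S f" "c \<in> A" "d \<in> B"
  shows "open (S \<inter> fst c \<inter> f -` fst d)" "open (snd c ` (S \<inter> fst c \<inter> f -` fst d))"
proof -
  note c = smooth_atlas_chart[OF assms(1,5)] and d = smooth_atlas_chart[OF assms(2,6)]
  have "open (S \<inter> f -` fst d)"
    using assms(3,4) chart_open(1)[OF d] unfolding smooth_map_on_def
    by (auto simp: continuous_on_open_vimage Int_commute)
  then have "open ((S \<inter> f -` fst d) \<inter> fst c)" using chart_open(1)[OF c] by (rule open_Int)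
  then show 1: "open (S \<inter> fst c \<inter> f -` fst d)" by (simp add: Int_ac)
  show "open (snd c ` (S \<inter> fst c \<inter> f -` fst d))"
    by (rule chart_open_image[OF c 1]) auto
qed

lemma smooth_map_onD:
  "smooth_map_on A B S f \<Longrightarrow> c \<in> A \<Longrightarrow> d \<in> B \<Longrightarrow>
     smooth_on (snd c ` (S \<inter> fst c \<inter> f -` fst d)) (snd d \<circ> f \<circ> chart_inv c)"
  "smooth_map_on A B S f \<Longrightarrow> continuous_on S f"
  unfolding smooth_map_on_def by blast+

lemma smooth_map_on_subset:
  assumes "smooth_map_on A B S f" "T \<subseteq> S"
  shows "smooth_map_on A B T f"
  unfolding smooth_map_on_def
proof (intro conjI ballI)
  show "continuous_on T f" using continuous_on_subset[OF smooth_map_onD(2)[OF assms(1)] assms(2)] .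
  fix c d assume "c \<in> A" "d \<in> B"
  from smooth_map_onD(1)[OF assms(1) this]
  show "smooth_on (snd c ` (T \<inter> fst c \<inter> f -` fst d)) (snd d \<circ> f \<circ> chart_inv c)"
    by (rule smooth_on_subset) (use assms(2) in auto)
qed

lemma smooth_map_on_local:
  fixes A :: "('m::t2_space, 'e::euclidean_space) chart set"
  assumes "smooth_atlas A" "smooth_atlas B"
    "\<And>p. p \<in> S \<Longrightarrow> \<exists>T. open T \<and> p \<in> T \<and> smooth_map_on A B T f"
  shows "smooth_map_on A B S f"
  unfolding smooth_map_on_def
proof (intro conjI ballI)
  show "continuous_on S f"
  proof (rule continuous_at_imp_continuous_on, rule ballI)
    fix p assume "p \<in> S"
    from assms(3)[OF this] obtain T where T: "open T" "p \<in> T" "smooth_map_on A B T f" by blast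
    from smooth_map_onD(2)[OF T(3)] show "continuous (at p) f"
      using T(1,2) by (simp add: continuous_on_eq_continuous_at)
  qed
  fix c d assume cd: "c \<in> A" "d \<in> B"
  note c = smooth_atlas_chart[OF assms(1) cd(1)]
  show "smooth_on (snd c ` (S \<inter> fst c \<inter> f -` fst d)) (snd d \<circ> f \<circ> chart_inv c)"
  proof (rule smooth_on_local)
    fix x assume "x \<in> snd c ` (S \<inter> fst c \<inter> f -` fst d)"
    then obtain p where p: "p \<in> S" "p \<in> fst c" "f p \<in> fst d" "x = snd c p" by auto
    from assms(3)[OF p(1)] obtain T where T: "open T" "p \<in> T" "smooth_map_on A B T f" by blast
    show "\<exists>X. open X \<and> x \<in> X \<and> smooth_on X (snd d \<circ> f \<circ> chart_inv c)"
      using smooth_map_on_domain_open(2)[OF assms(1,2) T(1,3) cd] smooth_map_onD(1)[OF T(3) cd] p T(2)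
      by (intro exI[of _ "snd c ` (T \<inter> fst c \<inter> f -` fst d)"]) auto
  qed
qed

lemma smooth_map_on_cong:
  assumes "smooth_atlas A" "smooth_atlas B" "open S" "\<And>p. p \<in> S \<Longrightarrow> f p = g p" "smooth_map_on A B S f"
  shows "smooth_map_on A B S g"
  unfolding smooth_map_on_def
proof (intro conjI ballI)
  show "continuous_on S g"
    using smooth_map_onD(2)[OF assms(5)] assms(4) by (rule continuous_on_eq)
  fix c d assume cd: "c \<in> A" "d \<in> B"
  note c = smooth_atlas_chart[OF assms(1) cd(1)]
  have eq: "S \<inter> fst c \<inter> g -` fst d = S \<inter> fst c \<inter> f -` fst d" using assms(4) by auto
  have "smooth_on (snd c ` (S \<inter> fst c \<inter> f -` fst d)) (snd d \<circ> g \<circ> chart_inv c) \<longleftrightarrow>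
     smooth_on (snd c ` (S \<inter> fst c \<inter> f -` fst d)) (snd d \<circ> f \<circ> chart_inv c)"
    by (rule smooth_on_cong[OF smooth_map_on_domain_open(2)[OF assms(1,2,3,5) cd]])
      (auto simp: chart_inv_left[OF c] assms(4))
  then show "smooth_on (snd c ` (S \<inter> fst c \<inter> g -` fst d)) (snd d \<circ> g \<circ> chart_inv c)"
    using smooth_map_onD(1)[OF assms(5) cd] by (simp add: eq)
qed

text \<open>No single chart of \<open>B\<close> need cover the image of a chart of \<open>A\<close>.
  Smoothness is therefore checked near each point, through the chart selected at its image.\<close>

lemma smooth_map_on_compose:
  assumes at: "smooth_atlas A" "smooth_atlas B" "smooth_atlas C"
    and S: "open S" "smooth_map_on A B S f" and T: "open T" "smooth_map_on B C T g" and fS: "f ` S \<subseteq> T"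
  shows "smooth_map_on A C S (g \<circ> f)"
  unfolding smooth_map_on_def
proof (intro conjI ballI)
  show cont: "continuous_on S (g \<circ> f)"
    using continuous_on_compose[OF smooth_map_onD(2)[OF S(2)] continuous_on_subset[OF smooth_map_onD(2)[OF T(2)] fS]] .
  fix c e assume ce: "c \<in> A" "e \<in> C"
  note c = smooth_atlas_chart[OF at(1) ce(1)]
  show "smooth_on (snd c ` (S \<inter> fst c \<inter> (g \<circ> f) -` fst e)) (snd e \<circ> (g \<circ> f) \<circ> chart_inv c)"
  proof (rule smooth_on_local)
    fix x assume "x \<in> snd c ` (S \<inter> fst c \<inter> (g \<circ> f) -` fst e)"
    then obtain p where p: "p \<in> S" "p \<in> fst c" "g (f p) \<in> fst e" "x = snd c p" by auto
    define d where "d = chart_at B (f p)"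
    have d: "d \<in> B" "f p \<in> fst d" "is_chart d"
      using chart_at[OF at(2)] smooth_atlas_chart[OF at(2)] by (auto simp: d_def)
    have "open (S \<inter> (g \<circ> f) -` fst e)"
      using cont chart_open(1)[OF smooth_atlas_chart[OF at(3) ce(2)]]
      unfolding continuous_on_open_vimage[OF S(1)] by (simp only: Int_commute)
    then have "open ((S \<inter> (g \<circ> f) -` fst e) \<inter> (S \<inter> fst c \<inter> f -` fst d))"
      using smooth_map_on_domain_open(1)[OF at(1,2) S ce(1) d(1)] by (rule open_Int)
    then have O: "open (snd c ` ((S \<inter> (g \<circ> f) -` fst e) \<inter> (S \<inter> fst c \<inter> f -` fst d)))" (is "open ?X")
      by (rule chart_open_image[OF c]) auto
    have "smooth_on ?X ((snd e \<circ> g \<circ> chart_inv d) \<circ> (snd d \<circ> f \<circ> chart_inv c))"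
    proof (rule smooth_on_compose[OF O smooth_map_on_domain_open(2)[OF at(2,3) T d(1) ce(2)] smooth_map_onD(1)[OF T(2) d(1) ce(2)]])
      show "smooth_on ?X (snd d \<circ> f \<circ> chart_inv c)"
        by (rule smooth_on_subset[OF smooth_map_onD(1)[OF S(2) ce(1) d(1)]]) auto
      show "(snd d \<circ> f \<circ> chart_inv c) ` ?X \<subseteq> snd d ` (T \<inter> fst d \<inter> g -` fst e)"
        using fS by (auto simp: chart_inv_left[OF c])
    qed
    moreover have "smooth_on ?X ((snd e \<circ> g \<circ> chart_inv d) \<circ> (snd d \<circ> f \<circ> chart_inv c)) \<longleftrightarrow>
        smooth_on ?X (snd e \<circ> (g \<circ> f) \<circ> chart_inv c)"
      by (rule smooth_on_cong[OF O]) (auto simp: chart_inv_left[OF c] chart_inv_left[OF d(3)])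
    ultimately show "\<exists>X. open X \<and> x \<in> X \<and> smooth_on X (snd e \<circ> (g \<circ> f) \<circ> chart_inv c)"
      using O p d(2) by (intro exI[of _ ?X]) auto
  qed
qed

lemma smooth_map_on_vec_iff: "smooth_map_on vec_atlas vec_atlas S f \<longleftrightarrow> smooth_on S f"
  by (auto simp: smooth_map_on_def vector_space_atlas_def chart_inv_vec smooth_on_continuous_on)

lemma smooth_map_on_chart:
  assumes "smooth_atlas A" "c \<in> A"
  shows "smooth_map_on A vec_atlas (fst c) (snd c)"
proof -
  have "smooth_on (snd d ` (fst c \<inter> fst d)) (snd c \<circ> chart_inv d)" if "d \<in> A" for d
    using assms that unfolding smooth_atlas_def by (metis Int_commute)
  then show ?thesis
    using chart_continuous(1)[OF smooth_atlas_chart[OF assms]]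
    by (simp add: smooth_map_on_def vector_space_atlas_def)
qed

lemma smooth_map_on_chart_inv:
  assumes "smooth_atlas A" "c \<in> A"
  shows "smooth_map_on vec_atlas A (snd c ` fst c) (chart_inv c)"
proof -
  note c = smooth_atlas_chart[OF assms]
  have "smooth_on (snd c ` fst c \<inter> chart_inv c -` fst d) (snd d \<circ> chart_inv c)" if "d \<in> A" for d
  proof (rule smooth_on_subset)
    show "smooth_on (snd c ` (fst c \<inter> fst d)) (snd d \<circ> chart_inv c)"
      using assms that unfolding smooth_atlas_def by blast
  qed (auto simp: chart_inv_left[OF c])
  then show ?thesis
    using chart_continuous(2)[OF c]
    by (simp add: smooth_map_on_def vector_space_atlas_def chart_inv_vec)
qed

lemma smooth_map_on_id:
  assumes "smooth_atlas A"
  shows "smooth_map_on A A S id"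
  unfolding smooth_map_on_def
proof (intro conjI ballI)
  fix c d assume cd: "c \<in> A" "d \<in> A"
  have "smooth_on (snd c ` (fst c \<inter> fst d)) (snd d \<circ> chart_inv c)"
    using assms cd unfolding smooth_atlas_def by blast
  then show "smooth_on (snd c ` (S \<inter> fst c \<inter> id -` fst d)) (snd d \<circ> id \<circ> chart_inv c)"
    by (simp add: id_def o_def) (rule smooth_on_subset, auto)
qed (rule continuous_on_id')

lemma smooth_map_on_funpow:
  assumes "smooth_atlas A" "smooth_map_on A A UNIV f"
  shows "smooth_map_on A A UNIV (f ^^ n)"
proof (induction n)
  case 0
  show ?case unfolding funpow.simps by (rule smooth_map_on_id[OF assms(1)])
next
  case (Suc n)
  show ?case unfolding funpow.simps
    by (rule smooth_map_on_compose[OF assms(1,1,1) _ Suc _ assms(2)]) auto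
qed

lemma smooth_map_on_has_derivative:
  assumes "smooth_map_on A B S f" "p \<in> S" "c \<in> A" "p \<in> fst c" "d \<in> B" "f p \<in> fst d"
  shows "((snd d \<circ> f \<circ> chart_inv c) has_derivative
    frechet_derivative (snd d \<circ> f \<circ> chart_inv c) (at (snd c p))) (at (snd c p))"
  by (rule smooth_on_has_derivative[OF smooth_map_onD(1)[OF assms(1,3,5)]]) (use assms in auto)

section \<open>Tangent maps and velocities\<close>

lemma fst_tangent_map [simp]: "fst (tangent_map A B f u) = f (fst u)"
  by (simp add: tangent_map_def Let_def)

lemma tangent_map_cong:
  fixes A :: "('m::topological_space, 'e::euclidean_space) chart set"
    and B :: "('n, 'f::euclidean_space) chart set"
  assumes "smooth_atlas A" "open S" "fst u \<in> S" "\<And>p. p \<in> S \<Longrightarrow> f p = g p"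
  shows "tangent_map A B f u = tangent_map A B g u"
proof -
  let ?c = "chart_at A (fst u)"
  have c: "is_chart ?c" "fst u \<in> fst ?c" using smooth_atlas_chart[OF assms(1)] chart_at[OF assms(1)] by blast+
  have O: "open (snd ?c ` (S \<inter> fst ?c))"
    using assms(2) chart_open(1)[OF c(1)] by (intro chart_open_image[OF c(1)]) auto
  have "frechet_derivative (d \<circ> f \<circ> chart_inv ?c) (at (snd ?c (fst u)))
      = frechet_derivative (d \<circ> g \<circ> chart_inv ?c) (at (snd ?c (fst u)))" for d :: "'n \<Rightarrow> 'f"
    by (rule frechet_derivative_cong_open[OF O]) (use assms c in \<open>auto simp: chart_inv_left\<close>)
  then show ?thesis using assms(3,4) by (simp add: tangent_map_def Let_def)
qed

text \<open>Functoriality holds in spite of the arbitrary selection of charts: the chart selected at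
  \<open>f p\<close> represents both the result of the first tangent map and the argument of the
  second.\<close>

lemma tangent_map_compose:
  assumes at: "smooth_atlas A" "smooth_atlas B" "smooth_atlas C"
    and S: "open S" "smooth_map_on A B S f" and T: "smooth_map_on B C T g"
    and u: "fst u \<in> S" "f (fst u) \<in> T"
  shows "tangent_map A C (g \<circ> f) u = tangent_map B C g (tangent_map A B f u)"
proof -
  define p c d e where defs: "p = fst u" "c = chart_at A p" "d = chart_at B (f p)" "e = chart_at C (g (f p))"
  have c: "c \<in> A" "p \<in> fst c" "is_chart c" and d: "d \<in> B" "f p \<in> fst d" "is_chart d"
    and e: "e \<in> C" "g (f p) \<in> fst e" "is_chart e"
    using chart_at[OF at(1)] chart_at[OF at(2)] chart_at[OF at(3)] smooth_atlas_chart[OF at(1)]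
      smooth_atlas_chart[OF at(2)] smooth_atlas_chart[OF at(3)] by (simp_all add: defs)
  let ?X = "snd c ` (S \<inter> fst c \<inter> f -` fst d)"
  let ?f = "snd d \<circ> f \<circ> chart_inv c" and ?g = "snd e \<circ> g \<circ> chart_inv d"
  have O: "open ?X" by (rule smooth_map_on_domain_open(2)[OF at(1,2) S c(1) d(1)])
  have x: "snd c p \<in> ?X" using u(1) c d by (auto simp: defs(1))
  have fx: "?f (snd c p) = snd d (f p)" by (simp add: chart_inv_left[OF c(3,2)])
  have df: "(?f has_derivative frechet_derivative ?f (at (snd c p))) (at (snd c p))"
    by (rule smooth_map_on_has_derivative[OF S(2)]) (use u c d in \<open>auto simp: defs(1)\<close>)
  have dg: "(?g has_derivative frechet_derivative ?g (at (snd d (f p)))) (at (?f (snd c p)))"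
    unfolding fx by (rule smooth_map_on_has_derivative[OF T]) (use u d e in \<open>auto simp: defs(1)\<close>)
  have "frechet_derivative (snd e \<circ> (g \<circ> f) \<circ> chart_inv c) (at (snd c p)) =
      frechet_derivative (?g \<circ> ?f) (at (snd c p))"
    by (rule frechet_derivative_cong_open[OF O x])
      (auto simp: chart_inv_left[OF c(3)] chart_inv_left[OF d(3)])
  also have "\<dots> = frechet_derivative ?g (at (snd d (f p))) \<circ> frechet_derivative ?f (at (snd c p))"
    by (rule frechet_derivative_eq[OF diff_chain_at[OF df dg]])
  finally show ?thesis
    by (simp add: tangent_map_def Let_def defs[symmetric])
qed

lemma tangent_map_id:
  assumes "smooth_atlas A"
  shows "tangent_map A A id u = u"
proof -
  let ?c = "chart_at A (fst u)"
  have c: "is_chart ?c" "fst u \<in> fst ?c" using smooth_atlas_chart[OF assms(1)] chart_at[OF assms(1)] by blast+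
  have "frechet_derivative (snd ?c \<circ> id \<circ> chart_inv ?c) (at (snd ?c (fst u)))
      = frechet_derivative (\<lambda>x. x) (at (snd ?c (fst u)))"
    by (rule frechet_derivative_cong_open[OF chart_open(2)[OF c(1)]])
      (use c in \<open>auto simp: chart_inv_left\<close>)
  then show ?thesis by (simp add: tangent_map_def Let_def frechet_derivative_eq[OF has_derivative_ident])
qed

lemma tangent_map_vec: "tangent_map vec_atlas vec_atlas f (x, v) = (f x, frechet_derivative f (at x) v)"
  by (simp add: tangent_map_def chart_inv_vec)

lemma tangent_map_scaleR:
  assumes "smooth_atlas A" "smooth_atlas B" "smooth_map_on A B S f" "p \<in> S"
  shows "tangent_map A B f (p, l *\<^sub>R v) = (f p, l *\<^sub>R snd (tangent_map A B f (p, v)))"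
proof -
  have "linear (frechet_derivative (snd (chart_at B (f p)) \<circ> f \<circ> chart_inv (chart_at A p)) (at (snd (chart_at A p) p)))"
    by (rule has_derivative_linear[OF smooth_map_on_has_derivative[OF assms(3,4)]])
      (intro chart_at assms(1,2))+
  then show ?thesis by (simp add: tangent_map_def Let_def linear_scale)
qed

lemma velocity_eq_tangent_map:
  assumes "smooth_atlas A" "smooth_map_on vec_atlas A S \<gamma>" "t \<in> S"
  shows "velocity A \<gamma> t = tangent_map vec_atlas A \<gamma> (t, 1)"
proof -
  let ?c = "chart_at A (\<gamma> t)"
  have "(UNIV, id) \<in> (vec_atlas :: (real, real) chart set)" by (simp add: vector_space_atlas_def)
  from smooth_map_on_has_derivative[OF assms(2,3) this _ chart_at[OF assms(1)]]
  have "(snd ?c \<circ> \<gamma>) differentiable (at t)"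
    by (auto simp: chart_inv_vec differentiable_def)
  from frechet_derivative_eq_vector_derivative[OF this]
  show ?thesis by (simp add: velocity_def tangent_map_def Let_def chart_inv_vec)
qed

lemma velocity_compose:
  assumes "smooth_atlas A" "smooth_atlas B" "open S" "smooth_map_on vec_atlas A S \<gamma>" "t \<in> S"
    "smooth_map_on A B UNIV f"
  shows "velocity B (f \<circ> \<gamma>) t = tangent_map A B f (velocity A \<gamma> t)"
proof -
  have "smooth_map_on vec_atlas B S (f \<circ> \<gamma>)"
    by (rule smooth_map_on_compose[OF smooth_atlas_vec assms(1,2,3,4) _ assms(6)]) auto
  then have "velocity B (f \<circ> \<gamma>) t = tangent_map vec_atlas B (f \<circ> \<gamma>) (t, 1)"
    by (rule velocity_eq_tangent_map[OF assms(2) _ assms(5)])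
  also have "\<dots> = tangent_map A B f (tangent_map vec_atlas A \<gamma> (t, 1))"
    by (rule tangent_map_compose[OF smooth_atlas_vec assms(1,2,3,4,6)]) (use assms(5) in auto)
  finally show ?thesis by (simp add: velocity_eq_tangent_map[OF assms(1,4,5)])
qed

section \<open>Convergence of orbits\<close>

lemma smooth_curve_compose:
  assumes "smooth_atlas A" "smooth_atlas B" "smooth_curve A a b \<gamma>" "smooth_map_on A B UNIV f"
  shows "smooth_curve B a b (f \<circ> \<gamma>)"
proof -
  from assms(3) obtain e \<eta> where e: "e > 0" "smooth_map_on vec_atlas A {a - e<..<b + e} \<eta>"
    "\<forall>t\<in>{a..b}. \<gamma> t = \<eta> t" unfolding smooth_curve_def by blast
  have "smooth_map_on vec_atlas B {a - e<..<b + e} (f \<circ> \<eta>)"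
    by (rule smooth_map_on_compose[OF smooth_atlas_vec assms(1,2) _ e(2) _ assms(4)]) auto
  then show ?thesis unfolding smooth_curve_def using e
    by (intro exI[of _ e] conjI exI[of _ "f \<circ> \<eta>"]) auto
qed

lemma smooth_curve_shift:
  assumes "smooth_atlas A" "smooth_curve A a b \<gamma>"
  shows "smooth_curve A (a + c) (b + c) (\<lambda>t. \<gamma> (t - c))"
proof -
  from assms(2) obtain e \<eta> where e: "e > 0" "smooth_map_on vec_atlas A {a - e<..<b + e} \<eta>"
    "\<forall>t\<in>{a..b}. \<gamma> t = \<eta> t" unfolding smooth_curve_def by blast
  have sh: "smooth_on {a + c - e<..<b + c + e} (\<lambda>t. t + - c)"
    by (intro smooth_on_add smooth_on_linear smooth_on_const bounded_linear_ident open_greaterThanLessThan)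
  have "smooth_map_on vec_atlas A {a + c - e<..<b + c + e} (\<eta> \<circ> (\<lambda>t. t + - c))"
    by (rule smooth_map_on_compose[OF smooth_atlas_vec smooth_atlas_vec assms(1) _ _ _ e(2)])
      (use sh in \<open>auto simp: smooth_map_on_vec_iff\<close>)
  then show ?thesis unfolding smooth_curve_def using e
    by (intro exI[of _ e] conjI exI[of _ "\<eta> \<circ> (\<lambda>t. t + - c)"]) auto
qed

lemma smooth_curve_cong:
  "(\<And>t. t \<in> {a..b} \<Longrightarrow> \<gamma> t = \<delta> t) \<Longrightarrow> smooth_curve A a b \<gamma> \<Longrightarrow> smooth_curve A a b \<delta>"
  unfolding smooth_curve_def by (metis (no_types, lifting))

lemma smooth_curve_interior:
  assumes "smooth_atlas A" "smooth_curve A a b \<gamma>"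
  shows "smooth_map_on vec_atlas A {a<..<b} \<gamma>"
proof -
  from assms(2) obtain e \<eta> where e: "e > 0" "smooth_map_on vec_atlas A {a - e<..<b + e} \<eta>"
    "\<forall>t\<in>{a..b}. \<gamma> t = \<eta> t" unfolding smooth_curve_def by blast
  show ?thesis
  proof (rule smooth_map_on_cong[OF smooth_atlas_vec assms(1)])
    show "smooth_map_on vec_atlas A {a<..<b} \<eta>"
      by (rule smooth_map_on_subset[OF e(2)]) (use e(1) in auto)
  qed (use e(3) in auto)
qed

text \<open>A smooth curve must extend beyond its interval. For parameters between -1 and 2 the
  prolonged segment stays within r + 2 (2r) of \<open>x0\<close>, which explains the factor
  5.\<close>

lemma smooth_curve_chart_segment:
  assumes "smooth_atlas A" "c \<in> A" "ball x0 (5 * r) \<subseteq> snd c ` fst c" "x \<in> ball x0 r" "y \<in> ball x0 r"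
  shows "smooth_curve A 0 1 (\<lambda>t. chart_inv c (x + t *\<^sub>R (y - x)))"
proof -
  let ?l = "\<lambda>t::real. t *\<^sub>R (y - x) + x"
  have l: "smooth_on {0 - 1<..<1 + 1} ?l"
    by (intro smooth_on_add smooth_on_linear smooth_on_const bounded_linear_scaleR_left open_greaterThanLessThan)
  have "?l t \<in> snd c ` fst c" if t: "\<bar>t\<bar> < 2" for t
  proof -
    have xy: "norm (x0 - x) < r" "norm (y - x) < 2 * r"
      using assms(4,5) norm_triangle_ineq[of "y - x0" "x0 - x"] by (auto simp: dist_norm norm_minus_commute)
    have "norm (x0 - ?l t) \<le> norm (x0 - x) + norm (t *\<^sub>R (y - x))"
      using norm_triangle_ineq4[of "x0 - x" "t *\<^sub>R (y - x)"] by (simp add: algebra_simps)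
    also have "norm (t *\<^sub>R (y - x)) \<le> 2 * (2 * r)"
      unfolding norm_scaleR using t xy(2) by (intro mult_mono) auto
    finally have "x0 + (?l t - x0) \<in> ball x0 (5 * r)" using xy(1) by (simp add: dist_norm)
    then show ?thesis using assms(3) by auto
  qed
  then have "?l ` {0 - 1<..<1 + 1} \<subseteq> snd c ` fst c" by force
  then have "smooth_map_on vec_atlas A {0 - 1<..<1 + 1} (chart_inv c \<circ> ?l)"
    using l chart_open(2)[OF smooth_atlas_chart[OF assms(1,2)]]
    by (intro smooth_map_on_compose[OF smooth_atlas_vec smooth_atlas_vec assms(1) _ _ _ smooth_map_on_chart_inv[OF assms(1,2)]])
      (auto simp: smooth_map_on_vec_iff)
  then show ?thesis unfolding smooth_curve_def
    by (intro exI[of _ 1] conjI exI[of _ "chart_inv c \<circ> ?l"]) (auto simp: add.commute)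
qed

definition joined_by_curve where
  "joined_by_curve A p q \<longleftrightarrow> (\<exists>\<sigma>. smooth_curve A 0 1 \<sigma> \<and> \<sigma> 0 = p \<and> \<sigma> 1 = q)"

text \<open>Chains of smooth curves suffice, as lengths are taken over piecewise smooth curves.
  Transitivity is then free, and connectedness reduces the claim to small coordinate balls.\<close>

lemma joined_by_curves:
  fixes A :: "('m::{t2_space,second_countable_topology}, 'e::euclidean_space) chart set"
  assumes "smooth_manifold A"
  shows "(joined_by_curve A)\<^sup>*\<^sup>* p q"
proof -
  have A: "smooth_atlas A" and conn: "connected (UNIV :: 'm set)"
    using assms by (auto simp: smooth_manifold_def)
  show ?thesis
  proof (rule connected_equivalence_relation_gen[OF conn, where P="\<lambda>_. True"])
    fix a :: 'm
    define c where "c = chart_at A a"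
    have c: "c \<in> A" "a \<in> fst c" "is_chart c"
      using chart_at[OF A] smooth_atlas_chart[OF A] by (auto simp: c_def)
    obtain e where e: "e > 0" "ball (snd c a) e \<subseteq> snd c ` fst c"
      using chart_open(2)[OF c(3)] c(2) unfolding open_contains_ball by blast
    define r where "r = e / 5"
    have r: "r > 0" "ball (snd c a) (5 * r) \<subseteq> snd c ` fst c" using e by (auto simp: r_def)
    let ?T = "fst c \<inter> snd c -` ball (snd c a) r"
    have "open ?T"
      using chart_continuous(1)[OF c(3)] unfolding continuous_on_open_vimage[OF chart_open(1)[OF c(3)]]
      by (simp only: Int_commute open_ball)
    moreover have "joined_by_curve A x y" if "x \<in> ?T" "y \<in> ?T" for x y
      unfolding joined_by_curve_def
      using smooth_curve_chart_segment[OF A c(1) r(2), of "snd c x" "snd c y"] that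
      by (intro exI[of _ "\<lambda>t. chart_inv c (snd c x + t *\<^sub>R (snd c y - snd c x))"])
        (auto simp: chart_inv_left[OF c(3)])
    ultimately show "\<exists>T. openin (top_of_set UNIV) T \<and> a \<in> T \<and>
        (\<forall>x\<in>T. \<forall>y\<in>T. True \<and> True \<longrightarrow> (joined_by_curve A)\<^sup>*\<^sup>* x y)"
      using c(2) r(1) by (intro exI[of _ ?T]) auto
  qed auto
qed

text \<open>The chain from \<open>q\<close> to \<open>\<phi> q\<close> and all its images are put on
  one curve with unit pieces: piece \<open>i\<close> is piece \<open>i mod n\<close> of the chain,
  moved by the power \<open>i div n\<close> of \<open>\<phi>\<close>. Thus \<open>\<phi>\<close>
  acts as the shift by \<open>n\<close>, and paths between orbit points are restrictions of one
  curve.\<close>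

lemma equivariant_curve:
  assumes A: "smooth_atlas A" and \<phi>: "smooth_map_on A A UNIV \<phi>"
    and f: "f 0 = q" "f n = \<phi> q" "\<And>i. i < n \<Longrightarrow> joined_by_curve A (f i) (f (Suc i))" and n: "n > 0"
  shows "\<exists>\<Gamma>. (\<forall>i::nat. smooth_curve A (real i) (real i + 1) \<Gamma>) \<and>
     (\<forall>t\<ge>0. \<Gamma> (t + real n) = \<phi> (\<Gamma> t)) \<and> \<Gamma> 0 = q"
proof -
  have "\<forall>i. \<exists>\<sigma>. i < n \<longrightarrow> smooth_curve A 0 1 \<sigma> \<and> \<sigma> 0 = f i \<and> \<sigma> 1 = f (Suc i)"
    using f(3) unfolding joined_by_curve_def by blast
  from choice[OF this] obtain \<sigma>
    where \<sigma>: "\<And>i. i < n \<Longrightarrow> smooth_curve A 0 1 (\<sigma> i) \<and> \<sigma> i 0 = f i \<and> \<sigma> i 1 = f (Suc i)" by blast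
  define \<rho> where "\<rho> i = (\<phi> ^^ (i div n)) \<circ> \<sigma> (i mod n)" for i
  define \<Gamma> where "\<Gamma> t = \<rho> (nat \<lfloor>t\<rfloor>) (t - real (nat \<lfloor>t\<rfloor>))" for t
  have mod: "i mod n < n" for i using n by simp
  have sm: "smooth_curve A 0 1 (\<rho> i)" for i
    unfolding \<rho>_def using \<sigma>[OF mod] by (intro smooth_curve_compose[OF A A] smooth_map_on_funpow[OF A \<phi>]) blast
  have glue: "\<rho> i 1 = \<rho> (Suc i) 0" for i
  proof (cases "Suc (i mod n) = n")
    \<comment> \<open>At the end of a block the next piece is the first one, moved once more by
      \<open>\<phi>\<close>; they fit because \<open>f n = \<phi> (f 0)\<close>.\<close>
    case True
    then have "Suc i mod n = 0" "Suc i div n = Suc (i div n)" by (simp_all add: mod_Suc div_Suc)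
    then show ?thesis using \<sigma>[OF mod[of i]] \<sigma>[OF n] f(1,2) True
      by (simp add: \<rho>_def funpow_swap1)
  next
    case False
    then have "Suc i mod n = Suc (i mod n)" "Suc i div n = i div n" by (simp_all add: mod_Suc div_Suc)
    then show ?thesis using \<sigma>[OF mod[of i]] \<sigma>[OF mod[of "Suc i"]] by (simp add: \<rho>_def)
  qed
  have "smooth_curve A (real i) (real i + 1) \<Gamma>" for i
  proof (rule smooth_curve_cong)
    show "smooth_curve A (real i) (real i + 1) (\<lambda>t. \<rho> i (t - real i))"
      using smooth_curve_shift[OF A sm[of i], of "real i"] by (simp add: add.commute)
    fix t assume t: "t \<in> {real i..real i + 1}"
    show "\<rho> i (t - real i) = \<Gamma> t"
    \<comment> \<open>At the right end point the floor already selects the next piece, whose value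
      agrees by \<open>glue\<close>.\<close>
    proof (cases "t = real i + 1")
      case True
      then have "nat \<lfloor>t\<rfloor> = Suc i" by (simp add: nat_add_distrib)
      then show ?thesis using True glue by (simp add: \<Gamma>_def)
    next
      case False
      then have "\<lfloor>t\<rfloor> = int i" using t by (intro floor_unique) auto
      then show ?thesis by (simp add: \<Gamma>_def)
    qed
  qed
  moreover have "\<Gamma> (t + real n) = \<phi> (\<Gamma> t)" if "t \<ge> 0" for t
  proof -
    have "nat \<lfloor>t + real n\<rfloor> = nat \<lfloor>t\<rfloor> + n"
      using that floor_add_int[of t "int n"] by (simp add: nat_add_distrib)
    then show ?thesis using n by (simp add: \<Gamma>_def \<rho>_def)
  qed
  moreover have "\<Gamma> 0 = q" using \<sigma>[OF n] f(1) n by (simp add: \<Gamma>_def \<rho>_def)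
  ultimately show ?thesis by blast
qed

text \<open>If \<open>h\<close> is not integrable on the whole interval, the left hand side is \<open>0\<close>.\<close>

lemma integral_le_sum_unit_intervals:
  fixes h :: "real \<Rightarrow> real"
  assumes "\<And>t. h t \<ge> 0" "a \<le> b"
  shows "integral {real a..real b} h \<le> (\<Sum>i\<in>{a..<b}. integral {real i..real i + 1} h)"
  using assms(2)
proof (induction b rule: dec_induct)
  case base
  then show ?case by simp
next
  case (step b)
  have pos: "integral {x..y} h \<ge> 0" for x y
    using assms(1) by (cases "h integrable_on {x..y}") (auto intro: integral_nonneg simp: not_integrable_integral)
  show ?case
  proof (cases "h integrable_on {real a..real (Suc b)}")
    case True
    have "integral {real a..real b} h + integral {real b..real (Suc b)} h = integral {real a..real (Suc b)} h"
      by (rule Henstock_Kurzweil_Integration.integral_combine) (use step True in auto)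
    then show ?thesis using step by (simp add: add.commute)
  next
    case False
    then show ?thesis using pos by (simp add: not_integrable_integral sum_nonneg)
  qed
qed

section \<open>Lengths, quasi-distance and Cauchy orbits\<close>

lemma curve_length_nonneg:
  assumes "\<And>u. F u \<ge> 0"
  shows "curve_length A F a b \<gamma> \<ge> 0"
proof (cases "(F \<circ> velocity A \<gamma>) integrable_on {a..b}")
  case True
  then show ?thesis unfolding curve_length_def by (rule integral_nonneg) (simp add: assms)
qed (simp add: curve_length_def not_integrable_integral)

lemma quasi_distance_le:
  assumes "\<And>u. F u \<ge> 0" "piecewise_smooth_curve A a b \<gamma>"
  shows "quasi_distance A F (\<gamma> a) (\<gamma> b) \<le> curve_length A F a b \<gamma>"
  unfolding quasi_distance_def
proof (rule cInf_lower)
  show "bdd_below {curve_length A F a' b' \<gamma>' |a' b' \<gamma>'.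
      piecewise_smooth_curve A a' b' \<gamma>' \<and> \<gamma>' a' = \<gamma> a \<and> \<gamma>' b' = \<gamma> b}"
    using curve_length_nonneg[of F, OF assms(1)] by (intro bdd_belowI[of _ 0]) auto
qed (use assms(2) in auto)

lemma smooth_map_on_const:
  assumes "smooth_atlas A" "smooth_atlas B"
  shows "smooth_map_on A B S (\<lambda>_. q)"
  unfolding smooth_map_on_def by (auto simp: o_def intro: smooth_on_const)

text \<open>Piecewise smooth curves have \<open>a < b\<close>, so equal indices in the Cauchy
  condition are not covered by restrictions of an orbit curve. The constant curve settles
  them.\<close>

lemma quasi_distance_refl_le:
  assumes "smooth_atlas A" "\<And>u. F u \<ge> 0" "\<And>p. F (p, 0) = 0"
  shows "quasi_distance A F p p \<le> 0"
proof -
  have "smooth_curve A 0 1 (\<lambda>_. p)"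
    unfolding smooth_curve_def using smooth_map_on_const[OF smooth_atlas_vec assms(1)] by (intro exI[of _ 1]) auto
  then have "piecewise_smooth_curve A 0 1 (\<lambda>_. p)"
    unfolding piecewise_smooth_curve_def by (intro conjI exI[of _ 1] exI[of _ real]) auto
  from quasi_distance_le[of F, OF assms(2) this] have "quasi_distance A F p p \<le> curve_length A F 0 1 (\<lambda>_. p)" .
  also have "\<dots> = 0"
    by (simp add: curve_length_def velocity_def o_def assms(3))
  finally show ?thesis .
qed

lemma sum_lessThan_shift:
  fixes f :: "nat \<Rightarrow> real"
  shows "sum f {..<n + m} = sum f {..<n} + (\<Sum>i<m. f (i + n))"
  by (induction m) (auto simp: add.commute)

text \<open>Confined to the open interval, since at the end points of a smooth piece the curve need
  not be differentiable. For lengths these points are negligible.\<close>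

lemma velocity_equivariant:
  assumes A: "smooth_atlas A" and \<phi>: "smooth_map_on A A UNIV \<phi>"
    and sm: "smooth_curve A a b \<Gamma>" and eq: "\<And>t. t \<in> {a<..<b} \<Longrightarrow> \<Gamma> (t + c) = \<phi> (\<Gamma> t)" and t: "t \<in> {a<..<b}"
  shows "velocity A \<Gamma> (t + c) = tangent_map A A \<phi> (velocity A \<Gamma> t)"
proof -
  note int = smooth_curve_interior[OF A sm]
  let ?S = "{a + c<..<b + c}" and ?s = "\<lambda>t. t - c"
  have s: "smooth_on X ?s" if "open X" for X
    using smooth_on_add[OF that smooth_on_linear[OF that bounded_linear_ident] smooth_on_const[of X "- c"]]
    by simp
  have \<phi>\<Gamma>: "smooth_map_on vec_atlas A {a<..<b} (\<phi> \<circ> \<Gamma>)"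
    by (rule smooth_map_on_compose[OF smooth_atlas_vec A A _ int _ \<phi>]) auto
  have comp: "smooth_map_on vec_atlas A ?S ((\<phi> \<circ> \<Gamma>) \<circ> ?s)"
    by (rule smooth_map_on_compose[OF smooth_atlas_vec smooth_atlas_vec A _ _ _ \<phi>\<Gamma>])
      (auto simp: smooth_map_on_vec_iff s)
  have ps: "((\<phi> \<circ> \<Gamma>) \<circ> ?s) s = \<Gamma> s" if "s \<in> ?S" for s
    using eq[of "s - c"] that by auto
  have \<Gamma>S: "smooth_map_on vec_atlas A ?S \<Gamma>"
    by (rule smooth_map_on_cong[OF smooth_atlas_vec A open_greaterThanLessThan ps comp])
  have "velocity A \<Gamma> (t + c) = tangent_map vec_atlas A \<Gamma> (t + c, 1)"
    by (rule velocity_eq_tangent_map[OF A \<Gamma>S]) (use t in auto)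
  also have "\<dots> = tangent_map vec_atlas A ((\<phi> \<circ> \<Gamma>) \<circ> ?s) (t + c, 1)"
    by (rule tangent_map_cong[OF smooth_atlas_vec, of ?S]) (use t ps in auto)
  also have "\<dots> = tangent_map vec_atlas A (\<phi> \<circ> \<Gamma>) (tangent_map vec_atlas vec_atlas ?s (t + c, 1))"
    by (rule tangent_map_compose[OF smooth_atlas_vec smooth_atlas_vec A _ _ \<phi>\<Gamma>, of ?S])
      (use t in \<open>auto simp: smooth_map_on_vec_iff s\<close>)
  also have "tangent_map vec_atlas vec_atlas ?s (t + c, 1) = (t, 1)"
  proof -
    have "(?s has_derivative (\<lambda>h. h)) (at (t + c))"
      by (auto intro!: derivative_eq_intros)
    then show ?thesis by (simp add: tangent_map_vec frechet_derivative_eq)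
  qed
  also have "tangent_map vec_atlas A (\<phi> \<circ> \<Gamma>) (t, 1) = velocity A (\<phi> \<circ> \<Gamma>) t"
    by (rule velocity_eq_tangent_map[OF A \<phi>\<Gamma> t, symmetric])
  also have "\<dots> = tangent_map A A \<phi> (velocity A \<Gamma> t)"
    by (rule velocity_compose[OF A A _ int t \<phi>]) auto
  finally show ?thesis .
qed

text \<open>On the equivariant curve the shift by \<open>n\<close> multiplies the speed by
  \<open>\<kappa>\<close>. The sums \<open>T j\<close> of the lengths of the first \<open>j\<close>
  blocks are thus partial sums of a geometric series, and their differences bound the
  quasi-distances.\<close>

lemma contraction_orbit_forward_Cauchy:
  fixes A :: "('m::{t2_space,second_countable_topology}, 'e::euclidean_space) chart set"
  assumes M: "finsler_manifold A F"
    and \<phi>: "smooth_map_on A A UNIV \<phi>" "F \<circ> tangent_map A A \<phi> = (\<lambda>u. \<kappa> * F u)"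
    and k: "0 < \<kappa>" "\<kappa> < 1"
  shows "forward_Cauchy A F (\<lambda>n. (\<phi> ^^ n) q)"
proof -
  have A: "smooth_atlas A" and man: "smooth_manifold A" and F0: "\<And>u. F u \<ge> 0"
    using M by (auto simp: finsler_manifold_def smooth_manifold_def finsler_function_def)
  have Fz: "F (p, 0) = 0" for p
    using M unfolding finsler_manifold_def finsler_function_def by (metis mult_zero_left order_refl scaleR_zero_left)
  have refl: "quasi_distance A F p p \<le> 0" for p
    by (rule quasi_distance_refl_le[OF A]) (rule F0 Fz)+
  obtain n where "((joined_by_curve A) ^^ n) q (\<phi> q)"
    using joined_by_curves[OF man, of q "\<phi> q"] by (auto simp: rtranclp_power)
  then obtain f where f: "f 0 = q" "f n = \<phi> q" "\<And>i. i < n \<Longrightarrow> joined_by_curve A (f i) (f (Suc i))"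
    by (auto simp: relpowp_fun_conv)
  show ?thesis
  \<comment> \<open>An empty chain means that \<open>q\<close> is fixed; there is then no block of
    positive parameter length to shift by.\<close>
  proof (cases "n = 0")
    case True
    then have "\<phi> q = q" using f by simp
    then have "(\<phi> ^^ n) q = q" for n by (induction n) auto
    then show ?thesis using refl le_less_trans unfolding forward_Cauchy_def by fastforce
  next
    case False
    then have n: "n > 0" by simp
    from equivariant_curve[OF A \<phi>(1) f n] obtain \<Gamma>
      where \<Gamma>: "\<And>i::nat. smooth_curve A (real i) (real i + 1) \<Gamma>" "\<And>t. t \<ge> 0 \<Longrightarrow> \<Gamma> (t + real n) = \<phi> (\<Gamma> t)" "\<Gamma> 0 = q"
      by blast
    have orbit: "\<Gamma> (real (j * n)) = (\<phi> ^^ j) q" for j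
    proof (induction j)
      case (Suc j)
      have "\<Gamma> (real (Suc j * n)) = \<Gamma> (real (j * n) + real n)" by (simp add: algebra_simps)
      also have "\<dots> = \<phi> (\<Gamma> (real (j * n)))" by (rule \<Gamma>(2)) simp
      finally show ?case using Suc by simp
    qed (simp add: \<Gamma>)
    define h where "h = F \<circ> velocity A \<Gamma>"
    \<comment> \<open>The value is 0 if \<open>h\<close> is not integrable on the interval;
      \<open>l_shift\<close> and \<open>dist\<close> are valid with this default as well.\<close>
    define l where "l i = integral {real i..real i + 1} h" for i :: nat
    have h0: "h t \<ge> 0" for t using F0 by (simp add: h_def)
    have l0: "l i \<ge> 0" for i
      using curve_length_nonneg[of F, OF F0] by (simp add: l_def h_def curve_length_def[symmetric])
    have l_shift: "l (i + n) = \<kappa> * l i" for i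
    proof -
      have "(h \<circ> (+) (real n)) t = \<kappa> * h t" if "t \<in> {real i..real i + 1} - {real i, real i + 1}" for t
      proof -
        have "velocity A \<Gamma> (t + real n) = tangent_map A A \<phi> (velocity A \<Gamma> t)"
          by (rule velocity_equivariant[OF A \<phi>(1) \<Gamma>(1)[of i]]) (use that \<Gamma>(2) in auto)
        then show ?thesis using fun_cong[OF \<phi>(2), of "velocity A \<Gamma> t"] by (simp add: h_def add.commute)
      qed
      then have "integral {real i..real i + 1} (\<lambda>t. \<kappa> * h t) = integral {real i..real i + 1} (h \<circ> (+) (real n))"
        by (intro integral_spike[of "{real i, real i + 1}"]) auto
      also have "\<dots> = l (i + n)"
        unfolding integral_shift_Icc_real l_def by (simp add: algebra_simps)
      finally show ?thesis by (simp add: l_def)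
    qed
    define T where "T j = sum l {..<j * n}" for j
    have T: "T j = T 1 * (1 - \<kappa> ^ j) / (1 - \<kappa>)" for j
    proof (induction j)
      case (Suc j)
      have "T (Suc j) = T 1 + \<kappa> * T j"
        by (simp add: T_def sum_lessThan_shift l_shift sum_distrib_left)
      then show ?case unfolding Suc using k by (simp add: field_simps)
    qed (simp add: T_def)
    have "(\<lambda>j. T 1 * (1 - \<kappa> ^ j) / (1 - \<kappa>)) \<longlonglongrightarrow> T 1 * (1 - 0) / (1 - \<kappa>)"
      using k by (intro tendsto_intros LIMSEQ_power_zero) auto
    then have "Cauchy T" unfolding T[symmetric] by (rule LIMSEQ_imp_Cauchy)
    have dist: "quasi_distance A F ((\<phi> ^^ i) q) ((\<phi> ^^ j) q) \<le> T j - T i" if "i < j" for i j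
    proof -
      have ij: "i * n < j * n" using that n by simp
      have "piecewise_smooth_curve A (real (i * n)) (real (j * n)) \<Gamma>"
        unfolding piecewise_smooth_curve_def
      proof (intro conjI exI[of _ "j * n - i * n"] exI[of _ "\<lambda>k. real (i * n + k)"] allI impI)
        fix k show "smooth_curve A (real (i * n + k)) (real (i * n + Suc k)) \<Gamma>"
          using \<Gamma>(1)[of "i * n + k"] by (simp add: add_ac)
      qed (use ij in \<open>auto simp del: of_nat_mult\<close>)
      from quasi_distance_le[of F, OF F0 this]
      have "quasi_distance A F ((\<phi> ^^ i) q) ((\<phi> ^^ j) q) \<le> integral {real (i * n)..real (j * n)} h"
        by (simp only: orbit curve_length_def h_def)
      also have "\<dots> \<le> (\<Sum>k\<in>{i * n..<j * n}. l k)"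
        unfolding l_def by (rule integral_le_sum_unit_intervals[OF h0]) (use ij in simp)
      also have "\<dots> = T j - T i"
      proof -
        have "{..<j * n} = {..<i * n} \<union> {i * n..<j * n}"
          by (rule ivl_disj_un_one(2)[OF less_imp_le[OF ij], symmetric])
        then show ?thesis unfolding T_def by (simp add: sum.union_disjoint ivl_disj_int)
      qed
      finally show ?thesis .
    qed
    show ?thesis
      unfolding forward_Cauchy_def
    proof (intro allI impI)
      fix e :: real assume e: "e > 0"
      from CauchyD[OF \<open>Cauchy T\<close> e] obtain N where N: "\<And>i j. N \<le> i \<Longrightarrow> N \<le> j \<Longrightarrow> norm (T i - T j) < e" by blast
      show "\<exists>N. \<forall>i j. N \<le> i \<and> i \<le> j \<longrightarrow> quasi_distance A F ((\<phi> ^^ i) q) ((\<phi> ^^ j) q) < e"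
      proof (intro exI[of _ N] allI impI)
        fix i j assume ij: "N \<le> i \<and> i \<le> j"
        show "quasi_distance A F ((\<phi> ^^ i) q) ((\<phi> ^^ j) q) < e"
        proof (cases "i = j")
          case True
          then show ?thesis using le_less_trans[OF refl e] by simp
        next
          case False
          then show ?thesis using dist[of i j] N[of j i] ij by simp
        qed
      qed
    qed
  qed
qed

lemma contraction_orbit_converges:
  fixes A :: "('m::{t2_space,second_countable_topology}, 'e::euclidean_space) chart set"
  assumes M: "finsler_manifold A F" "forward_complete A F"
    and \<phi>: "smooth_map_on A A UNIV \<phi>" "F \<circ> tangent_map A A \<phi> = (\<lambda>u. \<kappa> * F u)"
    and k: "0 < \<kappa>" "\<kappa> < 1"
  shows "\<exists>l. \<phi> l = l \<and> (\<lambda>n. (\<phi> ^^ n) q) \<longlonglongrightarrow> l"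
proof -
  obtain l where l: "(\<lambda>n. (\<phi> ^^ n) q) \<longlonglongrightarrow> l"
    using M(2) contraction_orbit_forward_Cauchy[OF M(1) \<phi> k] unfolding forward_complete_def by blast
  have "isCont \<phi> l"
    using smooth_map_onD(2)[OF \<phi>(1)] by (simp add: continuous_on_eq_continuous_at)
  from isCont_tendsto_compose[OF this l] have "(\<lambda>n. (\<phi> ^^ Suc n) q) \<longlonglongrightarrow> \<phi> l" by simp
  then have "\<phi> l = l" using LIMSEQ_unique LIMSEQ_Suc[OF l] by blast
  with l show ?thesis by blast
qed

section \<open>Fixed points of contracting homotheties\<close>

lemma finsler_functionD:
  assumes "finsler_function A F"
  shows "0 \<le> F u" "continuous_on_TM A F" "smooth_on_slit_TM A F"
    "l \<ge> 0 \<Longrightarrow> F (q, l *\<^sub>R v) = l * F (q, v)"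
    "v \<noteq> 0 \<Longrightarrow> (\<And>y. metric_tensor F (q, v) x y = 0) \<Longrightarrow> x = 0"
  using assms unfolding finsler_function_def by blast+

text \<open>Vectors at \<open>p\<close> are coordinates in the chart selected at \<open>p\<close>,
  so over \<open>p\<close> the bundle chart induced by it is the identity. Regularity of
  \<open>F\<close> in bundle charts thereby becomes regularity of \<open>F\<close> on the fibre over
  \<open>p\<close>.\<close>

lemma tangent_map_chart_inv_at:
  assumes "smooth_atlas A"
  shows "tangent_map vec_atlas A (chart_inv (chart_at A p)) (snd (chart_at A p) p, w) = (p, w)"
proof -
  let ?c = "chart_at A p"
  have c: "is_chart ?c" "p \<in> fst ?c" using smooth_atlas_chart[OF assms] chart_at[OF assms] by blast+
  have "frechet_derivative (snd ?c \<circ> chart_inv ?c) (at (snd ?c p)) = frechet_derivative (\<lambda>x. x) (at (snd ?c p))"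
    by (rule frechet_derivative_cong_open[OF chart_open(2)[OF c(1)]]) (use c in \<open>auto simp: chart_inv_right\<close>)
  then show ?thesis
    using chart_inv_left[OF c]
    by (simp add: tangent_map_def Let_def chart_inv_vec frechet_derivative_eq[OF has_derivative_ident])
qed

lemma finsler_has_directional_derivative:
  assumes "smooth_atlas A" "finsler_function A F" "v \<noteq> 0"
  shows "\<exists>D. ((\<lambda>s. F (p, v + s *\<^sub>R y)) has_real_derivative D) (at 0)"
proof -
  let ?c = "chart_at A p"
  let ?H = "F \<circ> tangent_map vec_atlas A (chart_inv ?c)"
  have c: "?c \<in> A" "p \<in> fst ?c" using chart_at[OF assms(1)] by blast+
  have "smooth_on ((snd ?c ` fst ?c) \<times> (UNIV - {0})) ?H"
    using finsler_functionD(3)[OF assms(2)] c(1) unfolding smooth_on_slit_TM_def by blast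
  then have "?H differentiable (at (snd ?c p, v))"
    by (rule smooth_on_differentiable) (use c assms(3) in auto)
  then obtain D where "(?H has_derivative D) (at (snd ?c p, v + 0 *\<^sub>R y))"
    by (auto simp: differentiable_def)
  moreover have "((\<lambda>s. (snd ?c p, v + s *\<^sub>R y)) has_derivative (\<lambda>s. (0, s *\<^sub>R y))) (at 0)"
    by (auto intro!: derivative_eq_intros)
  ultimately have "((?H \<circ> (\<lambda>s. (snd ?c p, v + s *\<^sub>R y))) has_derivative (D \<circ> (\<lambda>s. (0, s *\<^sub>R y)))) (at 0)"
    by (intro diff_chain_at)
  moreover have "?H \<circ> (\<lambda>s. (snd ?c p, v + s *\<^sub>R y)) = (\<lambda>s. F (p, v + s *\<^sub>R y))"
    using tangent_map_chart_inv_at[OF assms(1)] by (simp add: fun_eq_iff)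
  ultimately show ?thesis
    using has_derivative_imp_has_field_derivative
    by (metis differentiable_def real_differentiable_def)
qed

text \<open>If \<open>F\<close> vanished at \<open>v\<close>, then \<open>F\<^sup>2\<close> would be minimal there, and by homogeneity \<open>v\<close> would
  lie in the kernel of the metric tensor at \<open>v\<close>.\<close>

lemma finsler_positive:
  assumes "smooth_atlas A" "finsler_function A F" "v \<noteq> 0"
  shows "F (p, v) > 0"
proof (rule ccontr)
  assume "\<not> F (p, v) > 0"
  then have F0: "F (p, v) = 0" using finsler_functionD(1)[OF assms(2), of "(p, v)"] by simp
  have "metric_tensor F (p, v) v y = 0" for y
  proof -
    obtain D where D: "((\<lambda>s. F (p, v + s *\<^sub>R y)) has_real_derivative D) (at 0)"
      using finsler_has_directional_derivative[OF assms] by blast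
    have q: "((\<lambda>s. (F (p, v + s *\<^sub>R y))\<^sup>2) has_real_derivative 0) (at 0)"
      by (rule DERIV_cong[OF DERIV_power[OF D, of 2]]) (simp add: F0)
    have inner: "deriv (\<lambda>s. (F (p, v + t *\<^sub>R v + s *\<^sub>R y))\<^sup>2) 0 = 0" if t: "\<bar>t\<bar> < 1" for t
    proof -
      have pos: "1 + t > 0" using t by linarith
      have "F (p, v + t *\<^sub>R v + s *\<^sub>R y) = (1 + t) * F (p, v + (s / (1 + t)) *\<^sub>R y)" for s
      proof -
        have "v + t *\<^sub>R v + s *\<^sub>R y = (1 + t) *\<^sub>R (v + (s / (1 + t)) *\<^sub>R y)"
          using pos by (simp add: scaleR_add_right scaleR_add_left)
        then show ?thesis using finsler_functionD(4)[OF assms(2)] pos by simp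
      qed
      then have eq: "(\<lambda>s. (F (p, v + t *\<^sub>R v + s *\<^sub>R y))\<^sup>2) =
          (\<lambda>s. (1 + t)\<^sup>2 * (F (p, v + (s / (1 + t)) *\<^sub>R y))\<^sup>2)"
        by (simp add: power_mult_distrib)
      have "((\<lambda>s. s / (1 + t)) has_real_derivative 1 / (1 + t)) (at 0)"
        using pos by (auto intro!: derivative_eq_intros)
      moreover have "((\<lambda>s. (F (p, v + s *\<^sub>R y))\<^sup>2) has_real_derivative 0) (at (0 / (1 + t)))"
        using q by simp
      ultimately have "((\<lambda>s. (F (p, v + (s / (1 + t)) *\<^sub>R y))\<^sup>2) has_real_derivative 0 * (1 / (1 + t))) (at 0)"
        by (rule DERIV_chain2[rotated])
      from DERIV_cmult[OF this, of "(1 + t)\<^sup>2"] show ?thesis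
        unfolding eq by (intro DERIV_imp_deriv) simp
    qed
    have "((\<lambda>t. deriv (\<lambda>s. (F (p, v + t *\<^sub>R v + s *\<^sub>R y))\<^sup>2) 0) has_real_derivative 0) (at 0)"
      by (rule has_field_derivative_transform_within_open[OF DERIV_const[of 0], of "{-1<..<1}"])
        (use inner in auto)
    then have "deriv (\<lambda>t. deriv (\<lambda>s. (F (p, v + t *\<^sub>R v + s *\<^sub>R y))\<^sup>2) 0) 0 = 0"
      by (rule DERIV_imp_deriv)
    then show ?thesis by (simp add: metric_tensor_def vertical_lift_def)
  qed
  from finsler_functionD(5)[OF assms(2,3) this] assms(3) show False by simp
qed

section \<open>The homothety in a chart centred at a fixed point\<close>

locale homothety_fixed_point =
  fixes A :: "('m::{t2_space,second_countable_topology}, 'e::euclidean_space) chart set"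
    and F :: "('m, 'e) tangent_bundle \<Rightarrow> real" and \<phi> :: "'m \<Rightarrow> 'm" and \<kappa> :: real and p :: 'm
  assumes atlas: "smooth_atlas A" and finsler: "finsler_function A F"
    and smooth_phi: "smooth_map_on A A UNIV \<phi>"
    and F_phi: "F (tangent_map A A \<phi> u) = \<kappa> * F u"
    and kappa: "0 < \<kappa>" "\<kappa> < 1"
    and fixed: "\<phi> p = p"
begin

definition c where "c = chart_at A p"
definition V where "V = {y. snd c p + y \<in> snd c ` fst c}"
definition k where "k q = snd c q - snd c p"
definition kinv where "kinv y = chart_inv c (snd c p + y)"

lemma c: "c \<in> A" "p \<in> fst c" "is_chart c"
  using chart_at[OF atlas] smooth_atlas_chart[OF atlas] by (simp_all add: c_def)

lemma translation_smooth: "open S \<Longrightarrow> smooth_on S (\<lambda>y. a + y)"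
  by (intro smooth_on_add smooth_on_const smooth_on_linear bounded_linear_ident)

lemma open_V: "open V"
proof -
  have "V = (\<lambda>y. snd c p + y) -` (snd c ` fst c)" by (auto simp: V_def)
  then show ?thesis using chart_open(2)[OF c(3)] by (auto intro!: open_vimage continuous_intros)
qed

lemma zero_V: "0 \<in> V" using c(2) by (simp add: V_def)

lemma k_p [simp]: "k p = 0" by (simp add: k_def)

lemma kinv_k [simp]: "q \<in> fst c \<Longrightarrow> kinv (k q) = q"
  by (simp add: k_def kinv_def chart_inv_left[OF c(3)])

lemma k_kinv [simp]: "y \<in> V \<Longrightarrow> k (kinv y) = y"
  by (simp add: k_def kinv_def V_def chart_inv_right[OF c(3)])

lemma k_V: "q \<in> fst c \<Longrightarrow> k q \<in> V" by (simp add: k_def V_def)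

lemma kinv_c: "y \<in> V \<Longrightarrow> kinv y \<in> fst c"
  by (simp add: kinv_def V_def chart_inv_in[OF c(3)])

lemma kinv_0 [simp]: "kinv 0 = p" using kinv_k[OF c(2)] by simp

lemma smooth_k: "smooth_map_on A vec_atlas (fst c) k"
proof -
  have "smooth_map_on vec_atlas vec_atlas UNIV (\<lambda>y. - snd c p + y)"
    unfolding smooth_map_on_vec_iff by (rule translation_smooth[OF open_UNIV])
  then have "smooth_map_on A vec_atlas (fst c) ((\<lambda>y. - snd c p + y) \<circ> snd c)"
    by (rule smooth_map_on_compose[OF atlas smooth_atlas_vec smooth_atlas_vec chart_open(1)[OF c(3)]
          smooth_map_on_chart[OF atlas c(1)] open_UNIV]) simp
  moreover have "(\<lambda>y. - snd c p + y) \<circ> snd c = k" by (auto simp: k_def)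
  ultimately show ?thesis by simp
qed

lemma smooth_translation: "smooth_map_on vec_atlas vec_atlas V (\<lambda>y. snd c p + y)"
  by (simp add: smooth_map_on_vec_iff translation_smooth open_V)

lemma kinv_eq: "kinv = chart_inv c \<circ> (\<lambda>y. snd c p + y)"
  by (auto simp: kinv_def)

lemma smooth_kinv: "smooth_map_on vec_atlas A V kinv"
  unfolding kinv_eq
  by (rule smooth_map_on_compose[OF smooth_atlas_vec smooth_atlas_vec atlas open_V smooth_translation
        chart_open(2)[OF c(3)] smooth_map_on_chart_inv[OF atlas c(1)]]) (auto simp: V_def)

lemma tangent_kinv:
  assumes "y \<in> V"
  shows "tangent_map vec_atlas A kinv (y, w) = tangent_map vec_atlas A (chart_inv c) (snd c p + y, w)"
proof -
  have "((\<lambda>y. snd c p + y) has_derivative (\<lambda>h. h)) (at y)" by (auto intro!: derivative_eq_intros)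
  then have "tangent_map vec_atlas vec_atlas (\<lambda>y. snd c p + y) (y, w) = (snd c p + y, w)"
    by (simp add: tangent_map_vec frechet_derivative_eq)
  then show ?thesis
    unfolding kinv_eq using assms
    by (subst tangent_map_compose[OF smooth_atlas_vec smooth_atlas_vec atlas open_V smooth_translation
          smooth_map_on_chart_inv[OF atlas c(1)]]) (auto simp: V_def)
qed

lemma tangent_kinv_k:
  assumes "fst u \<in> fst c"
  shows "tangent_map vec_atlas A kinv (tangent_map A vec_atlas k u) = u"
proof -
  have "tangent_map vec_atlas A kinv (tangent_map A vec_atlas k u) = tangent_map A A (kinv \<circ> k) u"
    by (rule tangent_map_compose[OF atlas smooth_atlas_vec atlas chart_open(1)[OF c(3)] smooth_k smooth_kinv, symmetric])
      (use assms k_V in auto)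
  also have "\<dots> = tangent_map A A id u"
    by (rule tangent_map_cong[OF atlas chart_open(1)[OF c(3)]]) (use assms in auto)
  finally show ?thesis by (simp add: tangent_map_id[OF atlas])
qed

text \<open>\<open>F\<close> in the bundle coordinates of the centred chart. Since the chart is the
  one selected at \<open>p\<close>, its restriction to the fibre over 0 is literally the Minkowski
  norm at \<open>p\<close>, see \<open>G_0\<close>.\<close>

definition G where "G = F \<circ> tangent_map vec_atlas A kinv"

lemma G_continuous: "continuous_on (V \<times> UNIV) G"
proof -
  have "continuous_on ((snd c ` fst c) \<times> UNIV) (F \<circ> tangent_map vec_atlas A (chart_inv c))"
    using finsler_functionD(2)[OF finsler] c(1) unfolding continuous_on_TM_def by blast
  then have "continuous_on ((\<lambda>z. (snd c p + fst z, snd z)) ` (V \<times> UNIV)) (F \<circ> tangent_map vec_atlas A (chart_inv c))"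
    by (rule continuous_on_subset) (auto simp: V_def)
  moreover have "continuous_on (V \<times> UNIV) (\<lambda>z. (snd c p + fst z, snd z))"
    by (intro continuous_intros)
  ultimately have "continuous_on (V \<times> UNIV) ((F \<circ> tangent_map vec_atlas A (chart_inv c)) \<circ> (\<lambda>z. (snd c p + fst z, snd z)))"
    by (rule continuous_on_compose[rotated])
  then show ?thesis
    by (rule continuous_on_eq) (auto simp: G_def tangent_kinv)
qed

lemma G_0: "G (0, w) = F (p, w)"
  using tangent_kinv[OF zero_V, of w] tangent_map_chart_inv_at[OF atlas, of p w] by (simp add: G_def c_def)

lemma G_homogeneous: "x \<in> V \<Longrightarrow> l \<ge> 0 \<Longrightarrow> G (x, l *\<^sub>R v) = l * G (x, v)"
  using tangent_map_scaleR[OF smooth_atlas_vec atlas smooth_kinv, of x l v] finsler_functionD(4)[OF finsler]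
  by (simp add: G_def) (metis fst_conv fst_tangent_map prod.collapse)

definition f where "f = k \<circ> \<phi> \<circ> kinv"
definition W where "W = V \<inter> kinv -` (\<phi> -` fst c)"

lemma phi_continuous: "continuous_on UNIV \<phi>"
  by (rule smooth_map_onD(2)[OF smooth_phi])

lemma open_phi_vimage: "open S \<Longrightarrow> open (\<phi> -` S)"
  by (rule open_vimage[OF _ phi_continuous])

lemma open_W: "open W"
proof -
  have "open (kinv -` (\<phi> -` fst c) \<inter> V)"
    using smooth_map_onD(2)[OF smooth_kinv] open_phi_vimage[OF chart_open(1)[OF c(3)]]
    unfolding continuous_on_open_vimage[OF open_V] by blast
  then show ?thesis by (simp add: W_def Int_commute)
qed

lemma zero_W: "0 \<in> W" using zero_V c(2) by (simp add: W_def fixed)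

lemma f_0: "f 0 = 0" by (simp add: f_def fixed)

lemma smooth_phi_kinv: "smooth_map_on vec_atlas A W (\<phi> \<circ> kinv)"
  by (rule smooth_map_on_compose[OF smooth_atlas_vec atlas atlas open_W _ open_UNIV smooth_phi])
    (auto intro: smooth_map_on_subset[OF smooth_kinv] simp: W_def)

lemma smooth_f: "smooth_on W f"
proof -
  have "smooth_map_on vec_atlas vec_atlas W (k \<circ> (\<phi> \<circ> kinv))"
    by (rule smooth_map_on_compose[OF smooth_atlas_vec atlas smooth_atlas_vec open_W smooth_phi_kinv
          chart_open(1)[OF c(3)] smooth_k]) (auto simp: W_def)
  then show ?thesis by (simp add: smooth_map_on_vec_iff f_def o_assoc)
qed

lemma G_f:
  assumes "x \<in> W"
  shows "G (f x, frechet_derivative f (at x) v) = \<kappa> * G (x, v)"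
proof -
  let ?u = "tangent_map vec_atlas A kinv (x, v)"
  have "(f x, frechet_derivative f (at x) v) = tangent_map vec_atlas vec_atlas (k \<circ> (\<phi> \<circ> kinv)) (x, v)"
    by (simp add: tangent_map_vec f_def o_assoc)
  also have "\<dots> = tangent_map A vec_atlas k (tangent_map vec_atlas A (\<phi> \<circ> kinv) (x, v))"
    by (rule tangent_map_compose[OF smooth_atlas_vec atlas smooth_atlas_vec open_W smooth_phi_kinv smooth_k])
      (use assms in \<open>auto simp: W_def\<close>)
  also have "tangent_map vec_atlas A (\<phi> \<circ> kinv) (x, v) = tangent_map A A \<phi> ?u"
    by (rule tangent_map_compose[OF smooth_atlas_vec atlas atlas open_V smooth_kinv smooth_phi])
      (use assms in \<open>auto simp: W_def\<close>)
  finally have "G (f x, frechet_derivative f (at x) v)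
      = F (tangent_map vec_atlas A kinv (tangent_map A vec_atlas k (tangent_map A A \<phi> ?u)))"
    by (simp add: G_def)
  also have "\<dots> = F (tangent_map A A \<phi> ?u)"
    using assms by (subst tangent_kinv_k) (auto simp: W_def)
  finally show ?thesis by (simp add: F_phi G_def)
qed

definition L where "L = frechet_derivative f (at 0)"

lemma f_has_derivative: "(f has_derivative L) (at 0)"
  unfolding L_def by (rule smooth_on_has_derivative[OF smooth_f zero_W])

lemma F_L: "F (p, L v) = \<kappa> * F (p, v)"
  using G_f[OF zero_W, of v] by (simp add: f_0 G_0 L_def)

lemma linear_L: "linear L" using f_has_derivative by (rule has_derivative_linear)

lemma F_pos: "v \<noteq> 0 \<Longrightarrow> F (p, v) > 0"
  by (rule finsler_positive[OF atlas finsler])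

lemma F_scale: "l \<ge> 0 \<Longrightarrow> F (p, l *\<^sub>R v) = l * F (p, v)"
  by (rule finsler_functionD(4)[OF finsler])

text \<open>Extrema on the compact unit sphere, the minimum being positive by \<open>F_pos\<close>.
  The rescaling to the sphere uses positive factors, so nonreversible \<open>F\<close> is
  covered.\<close>

lemma F_equivalent_norm:
  "\<exists>a b. 0 < a \<and> 0 < b \<and> (\<forall>v. a * norm v \<le> F (p, v) \<and> F (p, v) \<le> b * norm v)"
proof -
  let ?S = "sphere (0::'e) 1"
  have "continuous_on UNIV (G \<circ> (\<lambda>w. (0, w)))"
    by (intro continuous_on_compose continuous_intros continuous_on_subset[OF G_continuous]) (use zero_V in auto)
  then have "continuous_on UNIV (\<lambda>w. F (p, w))" by (simp add: o_def G_0)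
  then have cont: "continuous_on ?S (\<lambda>w. F (p, w))" by (rule continuous_on_subset) simp
  have ne: "?S \<noteq> {}" by simp
  obtain a where a: "a \<in> ?S" "\<And>w. w \<in> ?S \<Longrightarrow> F (p, a) \<le> F (p, w)"
    using continuous_attains_inf[OF compact_sphere ne cont] by blast
  obtain b where b: "b \<in> ?S" "\<And>w. w \<in> ?S \<Longrightarrow> F (p, w) \<le> F (p, b)"
    using continuous_attains_sup[OF compact_sphere ne cont] by blast
  have "F (p, a) * norm v \<le> F (p, v) \<and> F (p, v) \<le> F (p, b) * norm v" for v
  proof (cases "v = 0")
    case True
    then show ?thesis using F_scale[of 0 v] by simp
  next
    case False
    let ?w = "(1 / norm v) *\<^sub>R v"
    have w: "?w \<in> ?S" using False by simp
    have "F (p, v) = norm v * F (p, ?w)" using F_scale[of "norm v" ?w] False by simp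
    then show ?thesis using a(2)[OF w] b(2)[OF w] by (simp add: mult.commute mult_left_mono)
  qed
  moreover have "a \<noteq> 0" "b \<noteq> 0" using a(1) b(1) by auto
  ultimately show ?thesis using F_pos[of a] F_pos[of b] by blast
qed

lemma inverse_L_exists: "\<exists>L'. linear L' \<and> (\<forall>v. L' (L v) = v) \<and> (\<forall>v. L (L' v) = v)"
proof -
  have "inj L"
    unfolding linear_injective_0[OF linear_L]
  proof (intro allI impI)
    fix v assume "L v = 0"
    then have "\<kappa> * F (p, v) = 0" using F_L[of v] F_scale[of 0 0] by simp
    then show "v = 0" using kappa F_pos[of v] by force
  qed
  from linear_injective_isomorphism[OF linear_L this] show ?thesis by blast
qed

text \<open>Scaling by \<open>r\<close> is exact for \<open>F (p, _)\<close>, so the distortion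
  \<open>b / a\<close> against the Euclidean norm is paid once, independently of \<open>n\<close>.
  It applies to \<open>L\<close> with \<open>\<kappa>\<close> and to its inverse with
  \<open>1 / \<kappa>\<close>.\<close>

lemma conformal_bound:
  assumes "\<And>v. F (p, T v) = r * F (p, v)" "r > 0" "0 < a" "0 < b"
    "\<And>v. a * norm v \<le> F (p, v)" "\<And>v. F (p, v) \<le> b * norm v"
  shows "norm ((T ^^ n) v) \<le> b / a * r ^ n * norm v"
proof -
  have "F (p, (T ^^ n) v) = r ^ n * F (p, v)" by (induction n) (auto simp: assms(1))
  then have "a * norm ((T ^^ n) v) \<le> r ^ n * F (p, v)" using assms(5)[of "(T ^^ n) v"] by simp
  also have "\<dots> \<le> r ^ n * (b * norm v)" using assms(2,6) by (intro mult_left_mono) auto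
  finally show ?thesis using assms(3) by (simp add: field_simps)
qed

lemma conformal_contraction_at_fixed_point:
  "\<exists>U K N \<mu> B L' C. conformal_contraction f U W K N \<mu> B L L' \<kappa> C"
proof -
  obtain L' where L': "linear L'" "\<And>v. L' (L v) = v" "\<And>v. L (L' v) = v"
    using inverse_L_exists by blast
  obtain a b where ab: "0 < a" "0 < b" "\<And>v. a * norm v \<le> F (p, v)" "\<And>v. F (p, v) \<le> b * norm v"
    using F_equivalent_norm by blast
  have "F (p, L' v) = 1 / \<kappa> * F (p, v)" for v
    using F_L[of "L' v"] kappa by (simp add: L'(3) field_simps)
  then have "norm ((L' ^^ n) v) \<le> b / a * (1 / \<kappa>) ^ n * norm v" for n v
    using kappa ab by (intro conformal_bound) auto
  moreover have "norm ((L ^^ n) v) \<le> b / a * \<kappa> ^ n * norm v" for n v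
    using kappa ab F_L by (intro conformal_bound) auto
  ultimately show ?thesis
    using conformal_contraction_exists[OF open_W zero_W smooth_f f_0 f_has_derivative L' kappa, of "b / a"] ab
    by (metis divide_nonneg_nonneg less_imp_le)
qed

end

text \<open>A linearization of \<open>\<phi>\<close> on the neighbourhood \<open>P\<close> of the fixed point \<open>p\<close>, which restricts
  to a diffeomorphism of the smaller neighbourhood \<open>P'\<close> onto \<open>Y\<close> with inverse \<open>\<theta>\<close>.\<close>

locale linearized_homothety = homothety_fixed_point A F \<phi> \<kappa> p
  for A :: "('m::{t2_space,second_countable_topology}, 'e::euclidean_space) chart set" and F \<phi> \<kappa> p +
  fixes P P' :: "'m set" and h :: "'m \<Rightarrow> 'e" and Y :: "'e set" and \<theta> :: "'e \<Rightarrow> 'm"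
    and L L' :: "'e \<Rightarrow> 'e"
  assumes open_P: "open P" and phi_P: "\<phi> ` P \<subseteq> P" and P_limit: "q \<in> P \<Longrightarrow> (\<lambda>n. (\<phi> ^^ n) q) \<longlonglongrightarrow> p"
    and smooth_h: "smooth_map_on A vec_atlas P h" and h_phi: "q \<in> P \<Longrightarrow> h (\<phi> q) = L (h q)"
    and linear_LL': "linear L" "linear L'" and LL': "L' (L v) = v" "L (L' v) = v"
    and L_limit: "(\<lambda>n. (L ^^ n) v) \<longlonglongrightarrow> 0"
    and F_L: "F (p, L v) = \<kappa> * F (p, v)"
    and F_h: "fst u \<in> P \<Longrightarrow> F (p, snd (tangent_map A vec_atlas h u)) = F u"
    and open_P': "open P'" and P'_P: "P' \<subseteq> P" and p_P': "p \<in> P'" and open_Y: "open Y" and zero_Y: "0 \<in> Y"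
    and theta_h: "q \<in> P' \<Longrightarrow> \<theta> (h q) = q" and theta_P': "y \<in> Y \<Longrightarrow> \<theta> y \<in> P'" and h_theta: "y \<in> Y \<Longrightarrow> h (\<theta> y) = y"
    and smooth_theta: "smooth_map_on vec_atlas A Y \<theta>"

section \<open>Local linearization and the basin of a fixed point\<close>

context homothety_fixed_point
begin

text \<open>Forward invariance is inherited from \<open>U\<close> and so holds for \<open>P\<close>,
  where \<open>h\<close> is available along whole orbits. \<open>P'\<close> comes from the inverse
  function theorem and serves for invertibility.\<close>

lemma linearization_exists:
  "\<exists>P P' h Y \<theta> L'. linearized_homothety A F \<phi> \<kappa> p P P' h Y \<theta> L L'"
proof -
  obtain U K N \<mu> B L' C where cc: "conformal_contraction f U W K N \<mu> B L L' \<kappa> C"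
    using conformal_contraction_at_fixed_point by blast
  interpret C: conformal_contraction f U W K N \<mu> B L L' \<kappa> C by (rule cc)
  define P where "P = fst c \<inter> k -` U"
  have UV: "U \<subseteq> V" using C.UW by (auto simp: W_def)
  have k_cont: "continuous_on (fst c) k" by (rule smooth_map_onD(2)[OF smooth_k])
  have open_preimage: "open (fst c \<inter> k -` X)" if "open X" for X
    using k_cont that unfolding continuous_on_open_vimage[OF chart_open(1)[OF c(3)]] by (simp only: Int_commute)
  have PU: "k q \<in> U" "q \<in> fst c" if "q \<in> P" for q using that by (auto simp: P_def)
  have phi_P: "\<phi> q \<in> P" "k (\<phi> q) = f (k q)" if "q \<in> P" for q
  proof -
    have W: "k q \<in> W" using PU(1)[OF that] C.UW by blast
    show eq: "k (\<phi> q) = f (k q)" using PU(2)[OF that] by (simp add: f_def)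
    have "f (k q) \<in> U" using C.f_U PU(1)[OF that] by blast
    then show "\<phi> q \<in> P" using W PU(2)[OF that] by (simp add: P_def eq W_def)
  qed
  have iter: "(\<phi> ^^ n) q \<in> P \<and> k ((\<phi> ^^ n) q) = (f ^^ n) (k q)" if "q \<in> P" for n q
    using that by (induction n) (auto simp: phi_P)
  have psi_smooth: "smooth_map_on vec_atlas vec_atlas U C.psi"
    by (simp add: smooth_map_on_vec_iff C.psi_smooth)
  have open_P: "open P" unfolding P_def by (rule open_preimage[OF C.open_U])
  have k_P: "smooth_map_on A vec_atlas P k"
    by (rule smooth_map_on_subset[OF smooth_k]) (auto simp: P_def)
  let ?h = "C.psi \<circ> k"
  have smooth_h: "smooth_map_on A vec_atlas P ?h"
    by (rule smooth_map_on_compose[OF atlas smooth_atlas_vec smooth_atlas_vec open_P k_P C.open_U psi_smooth])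
      (use PU in auto)
  obtain U' Y g where U': "open U'" "U' \<subseteq> U" "0 \<in> U'" "open Y" "0 \<in> Y"
    "homeomorphism U' Y C.psi g" "smooth_on Y g"
    using smooth_inverse_function[OF C.open_U C.psi_smooth C.zero_U C.psi_derivative_0] C.psi_0 by metis
  have gU: "g y \<in> U'" "C.psi (g y) = y" if "y \<in> Y" for y
    using U'(6) that unfolding homeomorphism_def by auto
  have g_psi: "g (C.psi x) = x" if "x \<in> U'" for x
    using U'(6) that unfolding homeomorphism_def by auto
  show ?thesis
  proof (intro exI, unfold linearized_homothety_def, intro conjI)
    show "homothety_fixed_point A F \<phi> \<kappa> p" by (rule homothety_fixed_point_axioms)
    show "linearized_homothety_axioms A F \<phi> \<kappa> p P (fst c \<inter> k -` U') ?h Y (kinv \<circ> g) L L'"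
    proof (rule linearized_homothety_axioms.intro)
      show "open P" by (rule open_P)
      show "\<phi> ` P \<subseteq> P" using phi_P by auto
      show "(\<lambda>n. (\<phi> ^^ n) q) \<longlonglongrightarrow> p" if q: "q \<in> P" for q
      proof -
        have "isCont kinv 0"
          using smooth_map_onD(2)[OF smooth_kinv] open_V zero_V by (simp add: continuous_on_eq_continuous_at)
        from isCont_tendsto_compose[OF this C.orbit_tendsto_0[OF PU(1)[OF q]]]
        have "(\<lambda>n. kinv ((f ^^ n) (k q))) \<longlonglongrightarrow> p" by simp
        moreover have "kinv ((f ^^ n) (k q)) = (\<phi> ^^ n) q" for n
          using iter[OF q, of n] kinv_k[OF PU(2)] by metis
        ultimately show ?thesis by simp
      qed
      show "smooth_map_on A vec_atlas P ?h" by (rule smooth_h)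
      show "?h (\<phi> q) = L (?h q)" if "q \<in> P" for q
        using C.psi_f[OF PU(1)[OF that]] phi_P(2)[OF that] by simp
      show "linear L" "linear L'" by (rule linear_L, rule C.linear_L')
      show "L' (L v) = v" "L (L' v) = v" for v by (rule C.L'_L, rule C.L_L')
      show "(\<lambda>n. (L ^^ n) v) \<longlonglongrightarrow> 0" for v
      proof (rule Lim_null_comparison)
        show "\<forall>\<^sub>F n in sequentially. norm ((L ^^ n) v) \<le> C * \<kappa> ^ n * norm v"
          by (intro always_eventually allI C.L_bound)
        show "(\<lambda>n. C * \<kappa> ^ n * norm v) \<longlonglongrightarrow> 0"
          using kappa by (intro tendsto_mult_left_zero tendsto_mult_right_zero LIMSEQ_power_zero) auto
      qed
      show "F (p, L v) = \<kappa> * F (p, v)" for v by (rule F_L)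
      show "F (p, snd (tangent_map A vec_atlas ?h u)) = F u" if u: "fst u \<in> P" for u
      proof -
        obtain w where w: "tangent_map A vec_atlas k u = (k (fst u), w)"
          by (metis fst_tangent_map prod.collapse)
        have "tangent_map A vec_atlas ?h u = tangent_map vec_atlas vec_atlas C.psi (tangent_map A vec_atlas k u)"
          by (rule tangent_map_compose[OF atlas smooth_atlas_vec smooth_atlas_vec open_P k_P psi_smooth u])
            (rule PU(1)[OF u])
        then have "F (p, snd (tangent_map A vec_atlas ?h u)) = G (0, frechet_derivative C.psi (at (k (fst u))) w)"
          by (simp add: w tangent_map_vec G_0)
        also have "\<dots> = G (k (fst u), w)"
        proof (rule C.homogeneous_pullback[symmetric])
          show "continuous_on (W \<times> UNIV) G"
            by (rule continuous_on_subset[OF G_continuous]) (auto simp: W_def)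
          show "G (x, l *\<^sub>R v) = l * G (x, v)" if "x \<in> U" "0 \<le> l" for x v l
            using G_homogeneous that UV by blast
          show "G (f x, frechet_derivative f (at x) v) = \<kappa> * G (x, v)" if "x \<in> U" for x v
            using G_f that C.UW by blast
        qed (rule PU(1)[OF u])
        also have "\<dots> = F u"
          using tangent_kinv_k[OF PU(2)[OF u]] by (simp add: G_def w)
        finally show ?thesis .
      qed
      show "open (fst c \<inter> k -` U')" by (rule open_preimage[OF U'(1)])
      show "fst c \<inter> k -` U' \<subseteq> P" using U'(2) by (auto simp: P_def)
      show "p \<in> fst c \<inter> k -` U'" using c(2) U'(3) by simp
      show "open Y" "0 \<in> Y" by (rule U')+
      show "(kinv \<circ> g) (?h q) = q" if "q \<in> fst c \<inter> k -` U'" for q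
        using that g_psi by simp
      show "(kinv \<circ> g) y \<in> fst c \<inter> k -` U'" "?h ((kinv \<circ> g) y) = y" if "y \<in> Y" for y
        using gU[OF that] UV U'(2) by (auto simp: kinv_c subset_iff)
      show "smooth_map_on vec_atlas A Y (kinv \<circ> g)"
        by (rule smooth_map_on_compose[OF smooth_atlas_vec smooth_atlas_vec atlas U'(4) _ open_V smooth_kinv])
          (use U'(2,7) gU UV in \<open>auto simp: smooth_map_on_vec_iff\<close>)
    qed
  qed
qed

lemma attracting_neighbourhood:
  "\<exists>P. open P \<and> p \<in> P \<and> (\<forall>q\<in>P. (\<lambda>n. (\<phi> ^^ n) q) \<longlonglongrightarrow> p)"
proof -
  obtain P P' h Y \<theta> L' where "linearized_homothety A F \<phi> \<kappa> p P P' h Y \<theta> L L'"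
    using linearization_exists by blast
  then interpret linearized_homothety A F \<phi> \<kappa> p P P' h Y \<theta> L L' .
  show ?thesis using open_P P_limit p_P' P'_P by (intro exI[of _ P]) auto
qed

text \<open>Convergence is decided by the tail of an orbit: a point of the basin has an iterate in
  the attracting neighbourhood, and the preimage of that neighbourhood under this iterate lies in
  the basin.\<close>

lemma basin_open: "open {q. (\<lambda>n. (\<phi> ^^ n) q) \<longlonglongrightarrow> p}"
proof (rule Topological_Spaces.openI)
  fix q assume "q \<in> {q. (\<lambda>n. (\<phi> ^^ n) q) \<longlonglongrightarrow> p}"
  then have q: "(\<lambda>n. (\<phi> ^^ n) q) \<longlonglongrightarrow> p" by simp
  obtain P where P: "open P" "p \<in> P" "\<And>q. q \<in> P \<Longrightarrow> (\<lambda>n. (\<phi> ^^ n) q) \<longlonglongrightarrow> p"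
    using attracting_neighbourhood by blast
  obtain n where n: "(\<phi> ^^ n) q \<in> P"
    using topological_tendstoD[OF q P(1,2)] by (auto simp: eventually_sequentially)
  have "open ((\<phi> ^^ n) -` P)"
    by (rule open_vimage[OF P(1) smooth_map_onD(2)[OF smooth_map_on_funpow[OF atlas smooth_phi]]])
  moreover have "(\<lambda>m. (\<phi> ^^ m) q') \<longlonglongrightarrow> p" if "(\<phi> ^^ n) q' \<in> P" for q'
  proof -
    have "(\<lambda>m. (\<phi> ^^ (m + n)) q') \<longlonglongrightarrow> p" using P(3)[OF that] by (simp add: funpow_add)
    then show ?thesis by (rule LIMSEQ_offset)
  qed
  ultimately show "\<exists>T. open T \<and> q \<in> T \<and> T \<subseteq> {q. (\<lambda>n. (\<phi> ^^ n) q) \<longlonglongrightarrow> p}"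
    using n by (intro exI[of _ "(\<phi> ^^ n) -` P"]) auto
qed

end

text \<open>Connectedness is applied to the relation of converging to a common fixed point. It is
  transitive because limits are unique, and it relates all points of a basin, which is open.\<close>

lemma contraction_unique_limit:
  fixes A :: "('m::{t2_space,second_countable_topology}, 'e::euclidean_space) chart set"
  assumes M: "finsler_manifold A F" "forward_complete A F"
    and \<phi>: "smooth_map_on A A UNIV \<phi>" "F \<circ> tangent_map A A \<phi> = (\<lambda>u. \<kappa> * F u)"
    and k: "0 < \<kappa>" "\<kappa> < 1"
  shows "\<exists>p. \<phi> p = p \<and> (\<forall>q. (\<lambda>n. (\<phi> ^^ n) q) \<longlonglongrightarrow> p)"
proof -
  have A: "smooth_atlas A" "finsler_function A F" and conn: "connected (UNIV :: 'm set)"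
    using M(1) by (auto simp: finsler_manifold_def smooth_manifold_def)
  have limit: "\<exists>l. \<phi> l = l \<and> (\<lambda>n. (\<phi> ^^ n) q) \<longlonglongrightarrow> l" for q
    by (rule contraction_orbit_converges[OF M \<phi> k])
  have hom: "homothety_fixed_point A F \<phi> \<kappa> l" if "\<phi> l = l" for l
    using A \<phi>(1) fun_cong[OF \<phi>(2)] k that by unfold_locales auto
  let ?R = "\<lambda>q q'. \<exists>l. \<phi> l = l \<and> (\<lambda>n. (\<phi> ^^ n) q) \<longlonglongrightarrow> l \<and> (\<lambda>n. (\<phi> ^^ n) q') \<longlonglongrightarrow> l"
  have R: "?R q q'" for q q'
  proof (rule connected_equivalence_relation_gen[OF conn, where P="\<lambda>_. True"])
    show "?R x z" if "?R x y" "?R y z" for x y z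
      using that LIMSEQ_unique by metis
    fix a :: 'm
    obtain l where l: "\<phi> l = l" "(\<lambda>n. (\<phi> ^^ n) a) \<longlonglongrightarrow> l" using limit by blast
    have "open {q. (\<lambda>n. (\<phi> ^^ n) q) \<longlonglongrightarrow> l}"
      by (rule homothety_fixed_point.basin_open[OF hom[OF l(1)]])
    with l show "\<exists>T. openin (top_of_set UNIV) T \<and> a \<in> T \<and> (\<forall>x\<in>T. \<forall>y\<in>T. True \<and> True \<longrightarrow> ?R x y)"
      by (intro exI[of _ "{q. (\<lambda>n. (\<phi> ^^ n) q) \<longlonglongrightarrow> l}"]) auto
  qed auto
  fix q0 :: 'm
  obtain p where p: "\<phi> p = p" "(\<lambda>n. (\<phi> ^^ n) q0) \<longlonglongrightarrow> p" using limit by blast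
  have "(\<lambda>n. (\<phi> ^^ n) q) \<longlonglongrightarrow> p" for q
    using R[of q q0] p(2) LIMSEQ_unique by blast
  with p(1) show ?thesis by blast
qed

section \<open>The global linearization\<close>

locale global_homothety = linearized_homothety +
  assumes bij_phi: "bij \<phi>" and smooth_inv_phi: "smooth_map_on A A UNIV (inv \<phi>)"
    and limit: "(\<lambda>n. (\<phi> ^^ n) q) \<longlonglongrightarrow> p"
begin

lemma eventually_iterate_in: "open S \<Longrightarrow> p \<in> S \<Longrightarrow> \<exists>n0. \<forall>n\<ge>n0. (\<phi> ^^ n) q \<in> S"
  using topological_tendstoD[OF limit] by (simp add: eventually_sequentially)

lemma p_P: "p \<in> P" using p_P' P'_P by blast

lemma iterate_P: "q \<in> P \<Longrightarrow> (\<phi> ^^ n) q \<in> P"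
  using phi_P by (induction n) auto

lemma h_iterate: "q \<in> P \<Longrightarrow> h ((\<phi> ^^ n) q) = (L ^^ n) (h q)"
  by (induction n) (simp_all add: h_phi iterate_P)

lemma bounded_linear_iterates: "bounded_linear (L ^^ n)" "bounded_linear (L' ^^ n)"
  using linear_funpow[OF linear_LL'(1)] linear_funpow[OF linear_LL'(2)]
  by (simp_all add: linear_conv_bounded_linear)

lemmas iterates_inverse = funpow_left_inverse[of L' L, OF LL'(1)] funpow_left_inverse[of L L', OF LL'(2)]

lemma phi_inverse: "(\<phi> ^^ n) ((inv \<phi> ^^ n) q) = q" "(inv \<phi> ^^ n) ((\<phi> ^^ n) q) = q"
  by (rule funpow_left_inverse, simp add: bij_phi bij_is_surj surj_f_inv_f)
    (rule funpow_left_inverse, simp add: bij_phi bij_is_inj)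

text \<open>Any time at which the orbit is in \<open>P\<close> gives the same value, see
  \<open>Psi_eq\<close>. So one fixed \<open>n\<close> can be used in a neighbourhood of each point,
  although the selected \<open>n\<close> may jump.\<close>

definition Psi where "Psi q = (let n = (SOME n. (\<phi> ^^ n) q \<in> P) in (L' ^^ n) (h ((\<phi> ^^ n) q)))"

lemma extension_independent:
  assumes "(\<phi> ^^ n) q \<in> P"
  shows "(L' ^^ (m + n)) (h ((\<phi> ^^ (m + n)) q)) = (L' ^^ n) (h ((\<phi> ^^ n) q))"
proof -
  have "(L' ^^ (m + n)) (h ((\<phi> ^^ (m + n)) q)) = (L' ^^ (n + m)) (h ((\<phi> ^^ m) ((\<phi> ^^ n) q)))"
    by (simp add: funpow_add add.commute)
  also have "\<dots> = (L' ^^ n) ((L' ^^ m) ((L ^^ m) (h ((\<phi> ^^ n) q))))"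
    unfolding h_iterate[OF assms] by (simp add: funpow_add)
  finally show ?thesis by (simp add: iterates_inverse)
qed

lemma Psi_eq:
  assumes "(\<phi> ^^ n) q \<in> P"
  shows "Psi q = (L' ^^ n) (h ((\<phi> ^^ n) q))"
proof -
  define m where "m = (SOME n. (\<phi> ^^ n) q \<in> P)"
  have m: "(\<phi> ^^ m) q \<in> P" unfolding m_def by (rule someI[of "\<lambda>n. (\<phi> ^^ n) q \<in> P", OF assms])
  have "Psi q = (L' ^^ m) (h ((\<phi> ^^ m) q))" by (simp add: Psi_def m_def Let_def)
  also have "\<dots> = (L' ^^ n) (h ((\<phi> ^^ n) q))"
    using extension_independent[OF m, of n] extension_independent[OF assms, of m] by (simp add: add.commute)
  finally show ?thesis .
qed

lemma exists_iterate_P: "\<exists>n. (\<phi> ^^ n) q \<in> P"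
  using eventually_iterate_in[OF open_P p_P, of q] by auto

lemma smooth_iterate: "smooth_map_on A A UNIV (\<phi> ^^ n)"
  by (rule smooth_map_on_funpow[OF atlas smooth_phi])

lemma open_iterate_vimage: "open S \<Longrightarrow> open ((\<phi> ^^ n) -` S)"
  by (rule open_vimage[OF _ smooth_map_onD(2)[OF smooth_iterate]])

lemma smooth_h_iterate: "smooth_map_on A vec_atlas ((\<phi> ^^ n) -` P) (h \<circ> (\<phi> ^^ n))"
  by (rule smooth_map_on_compose[OF atlas atlas smooth_atlas_vec open_iterate_vimage[OF open_P]
        smooth_map_on_subset[OF smooth_iterate subset_UNIV] open_P smooth_h]) auto

lemma smooth_linear_iterate:
  "smooth_map_on vec_atlas vec_atlas UNIV (L ^^ n)" "smooth_map_on vec_atlas vec_atlas UNIV (L' ^^ n)"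
  unfolding smooth_map_on_vec_iff by (intro smooth_on_linear open_UNIV bounded_linear_iterates)+

lemma smooth_Psi: "smooth_map_on A vec_atlas UNIV Psi"
proof (rule smooth_map_on_local[OF atlas smooth_atlas_vec])
  fix q
  obtain n where n: "(\<phi> ^^ n) q \<in> P" using exists_iterate_P by blast
  note O = open_iterate_vimage[OF open_P, of n]
  have "smooth_map_on A vec_atlas ((\<phi> ^^ n) -` P) ((L' ^^ n) \<circ> (h \<circ> (\<phi> ^^ n)))"
    by (rule smooth_map_on_compose[OF atlas smooth_atlas_vec smooth_atlas_vec O smooth_h_iterate
          open_UNIV smooth_linear_iterate(2)]) simp
  then have "smooth_map_on A vec_atlas ((\<phi> ^^ n) -` P) Psi"
    by (rule smooth_map_on_cong[OF atlas smooth_atlas_vec O, rotated]) (simp add: Psi_eq)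
  then show "\<exists>T. open T \<and> q \<in> T \<and> smooth_map_on A vec_atlas T Psi"
    using O n by blast
qed

lemma F_iterate: "F (tangent_map A A (\<phi> ^^ n) u) = \<kappa> ^ n * F u"
proof (induction n)
  case 0
  show ?case unfolding funpow.simps tangent_map_id[OF atlas] by simp
next
  case (Suc n)
  have "tangent_map A A (\<phi> \<circ> (\<phi> ^^ n)) u = tangent_map A A \<phi> (tangent_map A A (\<phi> ^^ n) u)"
    by (rule tangent_map_compose[OF atlas atlas atlas open_UNIV smooth_iterate smooth_phi]) auto
  then show ?case unfolding funpow.simps(2) by (simp only: F_phi Suc power_Suc mult.assoc)
qed

lemma F_L_iterate: "F (p, (L ^^ n) v) = \<kappa> ^ n * F (p, v)"
  by (induction n) (auto simp: F_L)

text \<open>The iterate \<open>\<phi> ^^ n\<close> and the power \<open>L ^^ n\<close> scale by the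
  same factor \<open>\<kappa> ^ n\<close>, which cancels and leaves the local statement
  \<open>F_h\<close>.\<close>

lemma F_Psi: "F (p, snd (tangent_map A vec_atlas Psi u)) = F u"
proof -
  obtain n where n: "(\<phi> ^^ n) (fst u) \<in> P" using exists_iterate_P by blast
  let ?w = "snd (tangent_map A vec_atlas h (tangent_map A A (\<phi> ^^ n) u))"
  note O = open_iterate_vimage[OF open_P, of n]
  have "tangent_map A vec_atlas Psi u = tangent_map A vec_atlas ((L' ^^ n) \<circ> (h \<circ> (\<phi> ^^ n))) u"
    by (rule tangent_map_cong[OF atlas O]) (use n in \<open>auto simp: Psi_eq\<close>)
  also have "\<dots> = tangent_map vec_atlas vec_atlas (L' ^^ n) (tangent_map A vec_atlas (h \<circ> (\<phi> ^^ n)) u)"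
    by (rule tangent_map_compose[OF atlas smooth_atlas_vec smooth_atlas_vec O smooth_h_iterate smooth_linear_iterate(2)])
      (use n in auto)
  also have "tangent_map A vec_atlas (h \<circ> (\<phi> ^^ n)) u = tangent_map A vec_atlas h (tangent_map A A (\<phi> ^^ n) u)"
    by (rule tangent_map_compose[OF atlas atlas smooth_atlas_vec open_UNIV smooth_iterate smooth_h])
      (use n in auto)
  finally have "snd (tangent_map A vec_atlas Psi u) = (L' ^^ n) ?w"
    by (metis bounded_linear_imp_has_derivative bounded_linear_iterates(2) frechet_derivative_eq
        prod.collapse snd_conv tangent_map_vec)
  then have "\<kappa> ^ n * F (p, snd (tangent_map A vec_atlas Psi u)) = F (p, ?w)"
    using F_L_iterate[of n "(L' ^^ n) ?w"] by (simp add: iterates_inverse)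
  also have "\<dots> = \<kappa> ^ n * F u"
    using F_h[of "tangent_map A A (\<phi> ^^ n) u"] n by (simp add: F_iterate)
  finally show ?thesis using kappa by simp
qed

lemma inj_Psi: "inj Psi"
proof (rule injI)
  fix q q' assume eq: "Psi q = Psi q'"
  obtain n0 n1 where "\<forall>n\<ge>n0. (\<phi> ^^ n) q \<in> P'" "\<forall>n\<ge>n1. (\<phi> ^^ n) q' \<in> P'"
    using eventually_iterate_in[OF open_P' p_P'] by blast
  then obtain n where n: "(\<phi> ^^ n) q \<in> P'" "(\<phi> ^^ n) q' \<in> P'"
    by (meson max.cobounded1 max.cobounded2)
  have "h ((\<phi> ^^ n) q) = (L ^^ n) (Psi q)" "h ((\<phi> ^^ n) q') = (L ^^ n) (Psi q')"
    using n P'_P by (auto simp: Psi_eq iterates_inverse subset_iff)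
  then have "(\<phi> ^^ n) q = (\<phi> ^^ n) q'" using theta_h[OF n(1)] theta_h[OF n(2)] eq by metis
  then show "q = q'" by (metis phi_inverse(2))
qed

text \<open>The inverse in explicit form: contract \<open>y\<close> into \<open>Y\<close> by
  \<open>L ^^ n\<close>, invert \<open>h\<close> there, and return by the inverse of
  \<open>\<phi> ^^ n\<close>. It yields surjectivity as well as smoothness of the inverse.\<close>

lemma Psi_local_inverse:
  assumes "(L ^^ n) y \<in> Y"
  shows "Psi ((inv \<phi> ^^ n) (\<theta> ((L ^^ n) y))) = y"
proof -
  have "(\<phi> ^^ n) ((inv \<phi> ^^ n) (\<theta> ((L ^^ n) y))) \<in> P"
    using theta_P'[OF assms] P'_P by (auto simp: phi_inverse)
  from Psi_eq[OF this] show ?thesis by (simp add: phi_inverse h_theta[OF assms] iterates_inverse)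
qed

lemma exists_iterate_Y: "\<exists>n. (L ^^ n) y \<in> Y"
  using topological_tendstoD[OF L_limit open_Y zero_Y, of y] by (auto simp: eventually_sequentially)

lemma bij_Psi: "bij Psi"
proof -
  have "y \<in> range Psi" for y
  proof -
    obtain n where "(L ^^ n) y \<in> Y" using exists_iterate_Y by blast
    from Psi_local_inverse[OF this] show ?thesis by (metis rangeI)
  qed
  then show ?thesis using inj_Psi by (auto simp: bij_def)
qed

lemma smooth_inv_Psi: "smooth_map_on vec_atlas A UNIV (inv Psi)"
proof (rule smooth_map_on_local[OF smooth_atlas_vec atlas])
  fix y
  obtain n where n: "(L ^^ n) y \<in> Y" using exists_iterate_Y by blast
  let ?T = "(L ^^ n) -` Y"
  have O: "open ?T"
    using linear_continuous_on[OF bounded_linear_iterates(1)] by (rule open_vimage[OF open_Y])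
  have "smooth_map_on vec_atlas A ?T (\<theta> \<circ> (L ^^ n))"
    by (rule smooth_map_on_compose[OF smooth_atlas_vec smooth_atlas_vec atlas O
          smooth_map_on_subset[OF smooth_linear_iterate(1) subset_UNIV] open_Y smooth_theta]) auto
  then have "smooth_map_on vec_atlas A ?T ((inv \<phi> ^^ n) \<circ> (\<theta> \<circ> (L ^^ n)))"
    by (rule smooth_map_on_compose[OF smooth_atlas_vec atlas atlas O _ open_UNIV
          smooth_map_on_funpow[OF atlas smooth_inv_phi]]) auto
  then have "smooth_map_on vec_atlas A ?T (inv Psi)"
  proof (rule smooth_map_on_cong[OF smooth_atlas_vec atlas O, rotated])
    fix z assume "z \<in> ?T"
    then have "Psi (((inv \<phi> ^^ n) \<circ> (\<theta> \<circ> (L ^^ n))) z) = z" by (simp add: Psi_local_inverse)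
    then show "((inv \<phi> ^^ n) \<circ> (\<theta> \<circ> (L ^^ n))) z = inv Psi z" by (metis inj_Psi inv_f_f)
  qed
  then show "\<exists>T. open T \<and> y \<in> T \<and> smooth_map_on vec_atlas A T (inv Psi)"
    using O n by blast
qed

lemma isometric_tangent_space: "isometric A F vec_atlas (tangent_minkowski F p)"
proof -
  have "tangent_minkowski F p \<circ> tangent_map A vec_atlas Psi = F"
    using F_Psi by (auto simp: fun_eq_iff tangent_minkowski_def split_beta)
  then show ?thesis
    unfolding isometric_def isometry_between_def diffeomorphism_def
    using bij_Psi smooth_Psi smooth_inv_Psi by blast
qed

end

section \<open>From contracting to arbitrary proper homotheties\<close>

lemma contracting_homothety_theorem:
  fixes A :: "('m::{t2_space,second_countable_topology}, 'e::euclidean_space) chart set"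
  assumes M: "finsler_manifold A F" "forward_complete A F" and \<phi>: "diffeomorphism A A \<phi>"
    "F \<circ> tangent_map A A \<phi> = (\<lambda>u. \<kappa> * F u)" and k: "0 < \<kappa>" "\<kappa> < 1"
  shows "\<exists>p. \<phi> p = p \<and> (\<forall>q. \<phi> q = q \<longrightarrow> q = p) \<and> isometric A F vec_atlas (tangent_minkowski F p)"
proof -
  have d: "bij \<phi>" "smooth_map_on A A UNIV \<phi>" "smooth_map_on A A UNIV (inv \<phi>)"
    using \<phi>(1) by (auto simp: diffeomorphism_def)
  obtain p where p: "\<phi> p = p" "\<And>q. (\<lambda>n. (\<phi> ^^ n) q) \<longlonglongrightarrow> p"
    using contraction_unique_limit[OF M d(2) \<phi>(2) k] by blast
  have uniq: "q = p" if "\<phi> q = q" for q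
  proof -
    have "(\<phi> ^^ n) q = q" for n by (induction n) (auto simp: that)
    then show ?thesis using p(2)[of q] by (simp add: LIMSEQ_const_iff)
  qed
  interpret homothety_fixed_point A F \<phi> \<kappa> p
    using M(1) d(2) fun_cong[OF \<phi>(2)] k p(1)
    by unfold_locales (auto simp: finsler_manifold_def smooth_manifold_def)
  obtain P P' h Y \<theta> L' where lin: "linearized_homothety A F \<phi> \<kappa> p P P' h Y \<theta> L L'"
    using linearization_exists by blast
  have "global_homothety A F \<phi> \<kappa> p P P' h Y \<theta> L L'"
    using lin d p(2) by (simp add: global_homothety_def global_homothety_axioms_def)
  from global_homothety.isometric_tangent_space[OF this] p(1) uniq show ?thesis by blast
qed

lemma diffeomorphism_inv:
  "diffeomorphism A B f \<Longrightarrow> diffeomorphism B A (inv f)"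
  by (simp add: diffeomorphism_def bij_imp_bij_inv inv_inv_eq)

lemma homothety_inv:
  fixes F :: "_ \<Rightarrow> real"
  assumes "smooth_atlas A" "diffeomorphism A A \<phi>" "F \<circ> tangent_map A A \<phi> = (\<lambda>u. l * F u)" "l > 0"
  shows "F \<circ> tangent_map A A (inv \<phi>) = (\<lambda>u. 1 / l * F u)"
proof
  fix u
  have d: "surj \<phi>" "smooth_map_on A A UNIV \<phi>" "smooth_map_on A A UNIV (inv \<phi>)"
    using assms(2) by (auto simp: diffeomorphism_def bij_is_surj)
  have "tangent_map A A (\<phi> \<circ> inv \<phi>) u = tangent_map A A \<phi> (tangent_map A A (inv \<phi>) u)"
    by (rule tangent_map_compose[OF assms(1,1,1) open_UNIV d(3,2)]) auto
  moreover have "\<phi> \<circ> inv \<phi> = id" using d(1) by (simp add: fun_eq_iff surj_f_inv_f)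
  ultimately have "tangent_map A A \<phi> (tangent_map A A (inv \<phi>) u) = u"
    by (simp only: tangent_map_id[OF assms(1)])
  then have "F u = l * F (tangent_map A A (inv \<phi>) u)"
    using fun_cong[OF assms(3), of "tangent_map A A (inv \<phi>) u"] by simp
  then show "(F \<circ> tangent_map A A (inv \<phi>)) u = 1 / l * F u" using assms(4) by (simp add: field_simps)
qed

theorem mainTheorem1:
  fixes A :: "('m::{t2_space,second_countable_topology}, 'e::euclidean_space) chart set"
    and F :: "('m, 'e) tangent_bundle \<Rightarrow> real"
    and \<phi> :: "'m \<Rightarrow> 'm"
  assumes "finsler_manifold A F"
    and "forward_complete A F"
    and "proper_homothety A F \<phi>"
  shows "\<exists>p. \<phi> p = p \<and> (\<forall>q. \<phi> q = q \<longrightarrow> q = p) \<and>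
           isometric A F vector_space_atlas (tangent_minkowski F p)"
proof -
  have A: "smooth_atlas A" using assms(1) by (simp add: finsler_manifold_def smooth_manifold_def)
  from assms(3) obtain l where l: "diffeomorphism A A \<phi>" "l > 0" "F \<circ> tangent_map A A \<phi> = (\<lambda>u. l * F u)"
    by (auto simp: proper_homothety_def homothety_def)
  have "l \<noteq> 1" using assms(3) l by (auto simp: proper_homothety_def isometry_between_def)
  then consider "l < 1" | "l > 1" by linarith
  then show ?thesis
  proof cases
    case 1
    then show ?thesis using contracting_homothety_theorem[OF assms(1,2) l(1,3,2)] by blast
  next
    case 2
    \<comment> \<open>Only the map is replaced: the inverse scales \<open>F\<close> by
      \<open>1 / l < 1\<close> on the same Finsler manifold and has the same fixed points.\<close>
    then have "\<exists>p. inv \<phi> p = p \<and> (\<forall>q. inv \<phi> q = q \<longrightarrow> q = p) \<and>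
        isometric A F vec_atlas (tangent_minkowski F p)"
      by (intro contracting_homothety_theorem[OF assms(1,2) diffeomorphism_inv[OF l(1)]
            homothety_inv[OF A l(1,3,2)]]) auto
    moreover have "inv \<phi> q = q \<longleftrightarrow> \<phi> q = q" for q
      using l(1) by (metis bij_inv_eq_iff diffeomorphism_def)
    ultimately show ?thesis by simp
  qed
qed

end
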